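(* Let $\mu,\nu\in\mathcal P(\mathbb{R}^N)$ and let $c$ be a cost function on $\mathbb{R}^N\times\mathbb{R}^N$ that is lower semicontinuous, bounded from below and of the form $$c(x,y)=c_1(x_1,y_1)+\sum_{1<t\le N}c_t(x_t-x_{t-1},y_t-y_{t-1}).$$ Suppose $\mu$ has independent increments, i.e. $x_1,x_2-x_1,\dots,x_N-x_{N-1}$ are independent under $\mu$. Then $$\inf_{\gamma\in\Pi_c(\mu,\nu)}\int c\,d\gamma=\inf_{\gamma\in\Pi_{bc}(\mu,\nu)}\int c\,d\gamma .$$ If moreover for each $t$ one has $c_t(a,b)=h_t(a-b)$ with $h_t$ convex, then a solution of $\inf_{\gamma\in\Pi_c(\mu,\nu)}\int c\,d\gamma$ is given by the Knothe-Rosenblatt rearrangement of $\mu$ and $\nu$. If additionally each $\mu_i$, $i=1,\dots,N$, is atomless, where $\mu_i$ denotes the $i$-th coordinate marginal of $\mu$, then this rearrangement is induced by the Knothe-Rosenblatt map $T$, i.e. it equals $(\mathrm{id}\times T)_*\mu$.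
   Context: $\Pi(\mu,\nu)$ is the set of couplings of $\mu,\nu$ on $\mathbb{R}^N\times\mathbb{R}^N$ (coordinates $x_1,\dots,x_N,y_1,\dots,y_N$). $\gamma\in\Pi(\mu,\nu)$ is causal, $\gamma\in\Pi_c(\mu,\nu)$, if for every $t\in\{1,\dots,N\}$ and $B\in\sigma(y_1,\dots,y_t)$ the map $x\mapsto\gamma^x(B)$ (with $\gamma^x$ the conditional law of $y$ given $x$) is $\sigma(x_1,\dots,x_t)$-measurable up to a $\mu$-null set. $\Pi_{bc}(\mu,\nu)$ is the set of $\gamma\in\Pi_c(\mu,\nu)$ whose image under $(x,y)\mapsto(y,x)$ belongs to $\Pi_c(\nu,\mu)$. For a probability $\eta$ on $\mathbb{R}$: $F_\eta(y)=\eta((-\infty,y])$ and $F_\eta^{-1}(u)=\inf\{y:F_\eta(y)\ge u\}$. For $\eta\in\mathcal P(\mathbb{R}^N)$, $\eta_1$ is its first-coordinate marginal and $\eta^{x_1,\dots,x_{t-1}}$ the conditional law of the $t$-th coordinate given the first $t-1$. Knothe-Rosenblatt rearrangement of $\mu,\nu$: the law of $(X_1^*,\dots,X_N^*,Y_1^*,\dots,Y_N^* )$ with $X_1^*=F_{\mu_1}^{-1}(U_1)$, $Y_1^*=F_{\nu_1}^{-1}(U_1)$ and, for $t=2,\dots,N$, $X_t^*=F^{-1}_{\mu^{X_1^*,\dots,X_{t-1}^*}}(U_t)$, $Y_t^*=F^{-1}_{\nu^{Y_1^*,\dots,Y_{t-1}^*}}(U_t)$, where $U_1,\dots,U_N$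 are independent and uniform on $[0,1]$. Knothe-Rosenblatt map: $T(x)=(T^1(x_1),T^2(x_2;x_1),\dots,T^N(x_N;x_1,\dots,x_{N-1}))$ with $T^1=F_{\nu_1}^{-1}\circ F_{\mu_1}$ and, for $t\ge2$, $T^t(x_t;x_1,\dots,x_{t-1})=F^{-1}_{\nu^{T^1(x_1),\dots,T^{t-1}(x_{t-1};x_1,\dots,x_{t-2})}}\circ F_{\mu^{x_1,\dots,x_{t-1}}}(x_t)$.
   Formalization: In the last claim (the rearrangement is induced by T) it is additionally assumed that the laws of the increments x_i - x_{i-1}, i=2,...,N, under μ are atomless; with only atomless coordinate marginals the claim fails, e.g. μ the law of (V,V), V uniform, ν=δ_0⊗fair coin. *)

theory Defs
  imports "HOL-Probability.Probability"
begin

section \<open>Paths and their laws\<close>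

text \<open>
  \<open>\<real>\<^sup>N\<close> is the set of functions \<open>nat \<Rightarrow> real\<close> that are extensional on the times \<open>{1..N}\<close>. The
  first \<open>t\<close> coordinates of a path \<open>x\<close> are \<open>restrict x {1..t}\<close>, a point of \<open>path_space t\<close>;
  \<open>path_space 0\<close> has the single point \<open>\<lambda>_. undefined\<close>, the empty past.
\<close>

definition path_space :: "nat \<Rightarrow> (nat \<Rightarrow> real) measure" where
  "path_space N = (\<Pi>\<^sub>M t\<in>{1..N}. borel)"

definition path_topology :: "nat \<Rightarrow> (nat \<Rightarrow> real) topology" where
  "path_topology N = product_topology (\<lambda>_. euclideanreal) {1..N}"

abbreviation pair_space :: "nat \<Rightarrow> ((nat \<Rightarrow> real) \<times> (nat \<Rightarrow> real)) measure" where
  "pair_space N \<equiv> path_space N \<Otimes>\<^sub>M path_space N"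

definition path_laws :: "nat \<Rightarrow> (nat \<Rightarrow> real) measure set" where
  "path_laws N = space (prob_algebra (path_space N))"

definition marginal :: "(nat \<Rightarrow> real) measure \<Rightarrow> nat \<Rightarrow> real measure" where
  "marginal \<eta> t = distr \<eta> borel (\<lambda>x. x t)"

definition increment :: "nat \<Rightarrow> (nat \<Rightarrow> real) \<Rightarrow> real" where
  "increment t x = (if t = 1 then x 1 else x t - x (t - 1))"

definition independent_increments :: "nat \<Rightarrow> (nat \<Rightarrow> real) measure \<Rightarrow> bool" where
  "independent_increments N \<eta> \<longleftrightarrow> prob_space.indep_vars \<eta> (\<lambda>_. borel) increment {1..N}"

text \<open>For a probability on the line, having no atoms amounts to having no point masses.\<close>

definition atomless :: "real measure \<Rightarrow> bool" where
  "atomless \<eta> \<longleftrightarrow> (\<forall>a. measure \<eta> {a} = 0)"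


section \<open>Conditional laws\<close>

text \<open>\<open>\<kappa>\<close> is a regular conditional law of \<open>Y\<close> (valued in \<open>R\<close>) given \<open>X\<close> (valued in \<open>S\<close>) under \<open>M\<close>.\<close>

definition is_cond_law ::
  "'a measure \<Rightarrow> 'b measure \<Rightarrow> ('a \<Rightarrow> 'b) \<Rightarrow> 'c measure \<Rightarrow> ('a \<Rightarrow> 'c) \<Rightarrow> ('b \<Rightarrow> 'c measure) \<Rightarrow> bool"
where
  "is_cond_law M S X R Y \<kappa> \<longleftrightarrow>
     \<kappa> \<in> S \<rightarrow>\<^sub>M prob_algebra R \<and>
     (\<forall>A\<in>sets S. \<forall>B\<in>sets R.
        emeasure M {z\<in>space M. X z \<in> A \<and> Y z \<in> B} =
          (\<integral>\<^sup>+x\<in>A. emeasure (\<kappa> x) B \<partial>distr M S X))"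

text \<open>
  A version of the conditional law of coordinate \<open>t + 1\<close> given the first \<open>t\<close> coordinates. A version
  exists because \<open>\<real>\<close> is standard Borel, and it is unique up to a null set. For \<open>t = 0\<close> its only value
  is the first marginal, so the first step of the constructions below needs no separate clause.
\<close>

definition next_law :: "(nat \<Rightarrow> real) measure \<Rightarrow> nat \<Rightarrow> (nat \<Rightarrow> real) \<Rightarrow> real measure" where
  "next_law \<eta> t =
     (SOME \<kappa>. is_cond_law \<eta> (path_space t) (\<lambda>x. restrict x {1..t}) borel (\<lambda>x. x (Suc t)) \<kappa>)"


section \<open>Causal and bicausal couplings\<close>

definition couplings ::
  "nat \<Rightarrow> (nat \<Rightarrow> real) measure \<Rightarrow> (nat \<Rightarrow> real) measure \<Rightarrow> ((nat \<Rightarrow> real) \<times> (nat \<Rightarrow> real)) measure set"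
where
  "couplings N \<mu> \<nu> = {\<gamma> \<in> space (prob_algebra (pair_space N)).
     distr \<gamma> (path_space N) fst = \<mu> \<and> distr \<gamma> (path_space N) snd = \<nu>}"

text \<open>The sigma-algebra generated by the first \<open>t\<close> coordinates on \<open>\<real>\<^sup>N\<close>.\<close>

definition past :: "nat \<Rightarrow> nat \<Rightarrow> (nat \<Rightarrow> real) measure" where
  "past N t = vimage_algebra (space (path_space N)) (\<lambda>x. restrict x {1..t}) (path_space t)"

text \<open>
  Since versions of the conditional law of \<open>y\<close> given \<open>x\<close> exist and agree outside a null set, and the
  measurability below is only required up to a null set, the choice of \<open>\<kappa>\<close> is immaterial.
\<close>

definition causal_couplings ::
  "nat \<Rightarrow> (nat \<Rightarrow> real) measure \<Rightarrow> (nat \<Rightarrow> real) measure \<Rightarrow> ((nat \<Rightarrow> real) \<times> (nat \<Rightarrow> real)) measure set"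
where
  "causal_couplings N \<mu> \<nu> = {\<gamma> \<in> couplings N \<mu> \<nu>.
     \<exists>\<kappa>. is_cond_law \<gamma> (path_space N) fst (path_space N) snd \<kappa> \<and>
       (\<forall>t\<in>{1..N}. \<forall>B\<in>sets (past N t).
          \<exists>g\<in>borel_measurable (past N t). AE x in \<mu>. measure (\<kappa> x) B = g x)}"

definition bicausal_couplings ::
  "nat \<Rightarrow> (nat \<Rightarrow> real) measure \<Rightarrow> (nat \<Rightarrow> real) measure \<Rightarrow> ((nat \<Rightarrow> real) \<times> (nat \<Rightarrow> real)) measure set"
where
  "bicausal_couplings N \<mu> \<nu> = {\<gamma> \<in> causal_couplings N \<mu> \<nu>.
     distr \<gamma> (pair_space N) prod.swap \<in> causal_couplings N \<nu> \<mu>}"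


section \<open>Costs\<close>

definition lsc_on_topology :: "'a topology \<Rightarrow> ('a \<Rightarrow> real) \<Rightarrow> bool" where
  "lsc_on_topology X f \<longleftrightarrow> (\<forall>a. openin X {z \<in> topspace X. a < f z})"

text \<open>
  The integral with values in \<open>[-\<infinity>, \<infinity>]\<close>. For a function that is bounded below and a probability
  measure the negative part is finite, so that no \<open>\<infinity> - \<infinity>\<close> occurs. (The Bochner integral would
  return \<open>0\<close> where the value is \<open>\<infinity>\<close>.)
\<close>

definition ext_integral :: "'a measure \<Rightarrow> ('a \<Rightarrow> real) \<Rightarrow> ereal" where
  "ext_integral M f =
     enn2ereal (\<integral>\<^sup>+z. ennreal (f z) \<partial>M) - enn2ereal (\<integral>\<^sup>+z. ennreal (- f z) \<partial>M)"


section \<open>The Knothe-Rosenblatt rearrangement and map\<close>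

text \<open>
  The infimum is the intended one for \<open>0 < u < 1\<close>; at other levels the set may be empty or unbounded
  below and the value is an arbitrary real number, which only matters on null sets of levels.
\<close>

definition quantile :: "real measure \<Rightarrow> real \<Rightarrow> real" where
  "quantile \<eta> u = Inf {y. u \<le> cdf \<eta> y}"

text \<open>The first \<open>t\<close> coordinates of the path with law \<open>\<eta>\<close> driven by the uniforms \<open>u 1, \<dots>, u t\<close>.\<close>

primrec quantile_path :: "(nat \<Rightarrow> real) measure \<Rightarrow> (nat \<Rightarrow> real) \<Rightarrow> nat \<Rightarrow> (nat \<Rightarrow> real)" where
  "quantile_path \<eta> u 0 = (\<lambda>_. undefined)"
| "quantile_path \<eta> u (Suc t) =
     (quantile_path \<eta> u t)
       (Suc t := quantile (next_law \<eta> t (quantile_path \<eta> u t)) (u (Suc t)))"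

definition KR_rearrangement ::
  "nat \<Rightarrow> (nat \<Rightarrow> real) measure \<Rightarrow> (nat \<Rightarrow> real) measure \<Rightarrow> ((nat \<Rightarrow> real) \<times> (nat \<Rightarrow> real)) measure"
where
  "KR_rearrangement N \<mu> \<nu> =
     distr (\<Pi>\<^sub>M t\<in>{1..N}. uniform_measure lborel {0..1}) (pair_space N)
       (\<lambda>u. (quantile_path \<mu> u N, quantile_path \<nu> u N))"

text \<open>The first \<open>t\<close> coordinates of the image of \<open>x\<close>.\<close>

primrec KR_map ::
  "(nat \<Rightarrow> real) measure \<Rightarrow> (nat \<Rightarrow> real) measure \<Rightarrow> (nat \<Rightarrow> real) \<Rightarrow> nat \<Rightarrow> (nat \<Rightarrow> real)"
where
  "KR_map \<mu> \<nu> x 0 = (\<lambda>_. undefined)"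
| "KR_map \<mu> \<nu> x (Suc t) =
     (KR_map \<mu> \<nu> x t)
       (Suc t := quantile (next_law \<nu> t (KR_map \<mu> \<nu> x t))
                   (cdf (next_law \<mu> t (restrict x {1..t})) (x (Suc t))))"

end

theory Submission
  imports Defs
begin

text \<open>
  The argument works one time step at a time and on increments, because the cost is a sum of
  functions of the increments of the two paths.

  Let \<open>\<gamma>\<close> be a causal coupling, with coordinates \<open>(X, Y)\<close>. Causality says that the past of \<open>Y\<close> uses
  no information on the future of \<open>X\<close> beyond the past of \<open>X\<close>; since the increments of \<open>X\<close> are
  independent, the next increment of \<open>X\<close> is independent of the past of \<open>Y\<close>
  (\<open>causal_increment_independent\<close>). Hence the conditional law \<open>J(y)\<close> of the two next increments, given
  that the past of \<open>Y\<close> is \<open>y\<close>, couples the unconditional law of the increment of \<open>X\<close> with the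
  conditional law of the increment of \<open>Y\<close>. Build a new pair of paths by drawing its two next increments
  from \<open>J(y)\<close>, where \<open>y\<close> is the past of its own second path. Both paths have the right laws, and given
  the two pasts each of them moves according to its own conditional law, so the new coupling is
  bicausal; and each pair of increments has the same joint law as under \<open>\<gamma>\<close>, so the cost does not
  change. This is \<open>bicausal_coupling_at_most_as_costly\<close>, and it gives the equality of the infima
  without any optimisation.

  If the cost of a step is \<open>h(a - b)\<close> with \<open>h\<close> convex, then among all couplings of two laws on the line
  the monotone one, which applies both quantile functions to the same uniform variable, is cheapest
  (\<open>monotone_coupling_optimal\<close>). The Knothe-Rosenblatt rearrangement moves by the monotone coupling of
  the two conditional laws, while \<open>J(y)\<close>, shifted to the current positions, is another coupling of the
  same two laws. So each step of the rearrangement costs no more than the same step of \<open>\<gamma>\<close>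
  (\<open>KR_rearrangement_increment_cost_le\<close>).

  If the increments of \<open>X\<close> have no atoms, then the conditional distribution function of the next
  coordinate of \<open>X\<close>, evaluated at that coordinate, returns the uniform variable which drove the step.
  The second path is therefore a function of the first one, and this function is the Knothe-Rosenblatt
  map (\<open>KR_rearrangement_eq_map\<close>).

  Two general facts support the argument: regular conditional laws of real variables exist and are
  essentially unique (\<open>ex_cond_law\<close>, \<open>AE_cong_cond_law\<close>), and causality follows from its one-step version,
  that the next coordinate of \<open>X\<close> depends on the two pasts through the past of \<open>X\<close> only
  (\<open>nonanticipative_imp_causal\<close>).
\<close>

section \<open>Regular conditional laws\<close>

lemma measurable_emeasure_kernel:
  assumes "\<kappa> \<in> S \<rightarrow>\<^sub>M prob_algebra R" "B \<in> sets R"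
  shows "(\<lambda>x. emeasure (\<kappa> x) B) \<in> borel_measurable S"
  using measurable_compose[OF measurable_prob_algebraD[OF assms(1)] measurable_emeasure_subprob_algebra[OF assms(2)]] .

lemma measurable_nn_integral_kernel:
  assumes "\<kappa> \<in> S \<rightarrow>\<^sub>M prob_algebra R" "(\<lambda>(x, y). f x y) \<in> borel_measurable (S \<Otimes>\<^sub>M R)"
  shows "(\<lambda>x. \<integral>\<^sup>+y. f x y \<partial>\<kappa> x) \<in> borel_measurable S"
  using assms by (intro nn_integral_measurable_subprob_algebra2[where N=R] measurable_prob_algebraD)

lemma sets_kernel_prob:
  assumes "\<kappa> \<in> S \<rightarrow>\<^sub>M prob_algebra R" "x \<in> space S"
  shows "sets (\<kappa> x) = sets R" "space (\<kappa> x) = space R" "prob_space (\<kappa> x)"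
  using measurable_space[OF assms] by (auto simp: space_prob_algebra dest: sets_eq_imp_space_eq)

lemma emeasure_vimage_eq_nn_integral:
  assumes "X \<in> M \<rightarrow>\<^sub>M S" "A \<in> sets S"
  shows "emeasure M (X -` A \<inter> space M) = (\<integral>\<^sup>+z. indicator A (X z) \<partial>M)"
proof -
  have "emeasure M (X -` A \<inter> space M) = (\<integral>\<^sup>+z. indicator (X -` A \<inter> space M) z \<partial>M)"
    by (rule nn_integral_indicator[symmetric, OF measurable_sets[OF assms]])
  also have "\<dots> = (\<integral>\<^sup>+z. indicator A (X z) \<partial>M)"
    by (rule nn_integral_cong) (simp add: indicator_def)
  finally show ?thesis .
qed

lemma cond_law_joint:
  assumes "prob_space M" and X[measurable]: "X \<in> M \<rightarrow>\<^sub>M S" and Y[measurable]: "Y \<in> M \<rightarrow>\<^sub>M R"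
    and \<kappa>: "is_cond_law M S X R Y \<kappa>"
  shows "distr M (S \<Otimes>\<^sub>M R) (\<lambda>z. (X z, Y z)) =
         distr M S X \<bind> (\<lambda>x. distr (\<kappa> x) (S \<Otimes>\<^sub>M R) (Pair x))" (is "?J = ?B")
proof -
  interpret M: prob_space M by fact
  interpret D: prob_space "distr M S X" by (rule M.prob_space_distr) fact
  have \<kappa>_meas[measurable]: "\<kappa> \<in> S \<rightarrow>\<^sub>M prob_algebra R"
    and eq: "\<And>A B. A \<in> sets S \<Longrightarrow> B \<in> sets R \<Longrightarrow>
       emeasure M {z\<in>space M. X z \<in> A \<and> Y z \<in> B} = (\<integral>\<^sup>+x\<in>A. emeasure (\<kappa> x) B \<partial>distr M S X)"
    using \<kappa> by (auto simp: is_cond_law_def)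
  have K[measurable]: "(\<lambda>x. distr (\<kappa> x) (S \<Otimes>\<^sub>M R) (Pair x)) \<in> S \<rightarrow>\<^sub>M prob_algebra (S \<Otimes>\<^sub>M R)"
    by measurable
  have D: "distr M S X \<in> space (prob_algebra S)"
    by (simp add: space_prob_algebra D.prob_space_axioms)
  have setsB: "sets ?B = sets (S \<Otimes>\<^sub>M R)" by (rule sets_bind'[OF D K])
  show ?thesis
  proof (rule measure_eqI_generator_eq[OF Int_stable_pair_measure_generator[of S R]
          , where A="\<lambda>_. space S \<times> space R" and \<Omega>="space S \<times> space R"])
    show "{a \<times> b |a b. a \<in> sets S \<and> b \<in> sets R} \<subseteq> Pow (space S \<times> space R)"
      by (auto dest: sets.sets_into_space)
    fix Z assume "Z \<in> {a \<times> b |a b. a \<in> sets S \<and> b \<in> sets R}"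
    then obtain A B where Z: "Z = A \<times> B" and [measurable]: "A \<in> sets S" "B \<in> sets R" by auto
    have "emeasure ?J Z = emeasure M {z\<in>space M. X z \<in> A \<and> Y z \<in> B}"
      by (subst emeasure_distr) (auto simp: Z intro!: arg_cong[where f="emeasure M"])
    also have "\<dots> = (\<integral>\<^sup>+x\<in>A. emeasure (\<kappa> x) B \<partial>distr M S X)" by (rule eq) simp_all
    also have "\<dots> = (\<integral>\<^sup>+x. emeasure (distr (\<kappa> x) (S \<Otimes>\<^sub>M R) (Pair x)) Z \<partial>distr M S X)"
    proof (rule nn_integral_cong)
      fix x assume "x \<in> space (distr M S X)"
      then have x: "x \<in> space S" by simp
      from measurable_space[OF \<kappa>_meas x] have s[measurable_cong]: "sets (\<kappa> x) = sets R"
        by (simp add: space_prob_algebra)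
      from sets_eq_imp_space_eq[OF s] have sp: "space (\<kappa> x) = space R" .
      have "B \<subseteq> space R" by (rule sets.sets_into_space) simp
      then have *: "Pair x -` Z \<inter> space (\<kappa> x) = (if x \<in> A then B else {})"
        by (auto simp: Z sp)
      show "emeasure (\<kappa> x) B * indicator A x = emeasure (distr (\<kappa> x) (S \<Otimes>\<^sub>M R) (Pair x)) Z"
        using x by (subst emeasure_distr) (auto simp: Z * [unfolded Z])
    qed
    also have "\<dots> = emeasure ?B Z"
      by (rule emeasure_bind_prob_algebra[symmetric, OF D K]) (simp add: Z)
    finally show "emeasure ?J Z = emeasure ?B Z" .
  next
    interpret J: prob_space ?J by (rule M.prob_space_distr) simp
    show "emeasure ?J (space S \<times> space R) \<noteq> \<infinity>" for i :: nat by simp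
  qed (auto simp: setsB sets_pair_measure)
qed

text \<open>
  The defining identity, which is about events, extends to functions of both variables because
  rectangles determine a measure on a product. Almost every use of a conditional law below is through
  this form.
\<close>

lemma cond_law_nn_integral:
  assumes "prob_space M" and X[measurable]: "X \<in> M \<rightarrow>\<^sub>M S" and Y[measurable]: "Y \<in> M \<rightarrow>\<^sub>M R"
    and \<kappa>: "is_cond_law M S X R Y \<kappa>"
    and f[measurable]: "f \<in> borel_measurable (S \<Otimes>\<^sub>M R)"
  shows "(\<integral>\<^sup>+z. f (X z, Y z) \<partial>M) = (\<integral>\<^sup>+z. \<integral>\<^sup>+y. f (X z, y) \<partial>\<kappa> (X z) \<partial>M)"
proof -
  have \<kappa>_meas[measurable]: "\<kappa> \<in> S \<rightarrow>\<^sub>M prob_algebra R"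
    using \<kappa> by (auto simp: is_cond_law_def)
  have K: "(\<lambda>x. distr (\<kappa> x) (S \<Otimes>\<^sub>M R) (Pair x)) \<in> S \<rightarrow>\<^sub>M prob_algebra (S \<Otimes>\<^sub>M R)"
    by measurable
  have "(\<integral>\<^sup>+z. f (X z, Y z) \<partial>M) = (\<integral>\<^sup>+p. f p \<partial>distr M (S \<Otimes>\<^sub>M R) (\<lambda>z. (X z, Y z)))"
    by (subst nn_integral_distr) simp_all
  also have "\<dots> = (\<integral>\<^sup>+x. \<integral>\<^sup>+p. f p \<partial>distr (\<kappa> x) (S \<Otimes>\<^sub>M R) (Pair x) \<partial>distr M S X)"
    unfolding cond_law_joint[OF assms(1-4)]
    by (rule nn_integral_bind[where B="S \<Otimes>\<^sub>M R"])
       (use measurable_prob_algebraD[OF K] in simp_all)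
  also have "\<dots> = (\<integral>\<^sup>+x. \<integral>\<^sup>+y. f (x, y) \<partial>\<kappa> x \<partial>distr M S X)"
  proof (rule nn_integral_cong)
    fix x assume "x \<in> space (distr M S X)"
    then have x: "x \<in> space S" by simp
    from measurable_space[OF \<kappa>_meas x] have s[measurable_cong]: "sets (\<kappa> x) = sets R"
      by (simp add: space_prob_algebra)
    show "(\<integral>\<^sup>+p. f p \<partial>distr (\<kappa> x) (S \<Otimes>\<^sub>M R) (Pair x)) = (\<integral>\<^sup>+y. f (x, y) \<partial>\<kappa> x)"
      using x by (subst nn_integral_distr) simp_all
  qed
  also have "\<dots> = (\<integral>\<^sup>+z. \<integral>\<^sup>+y. f (X z, y) \<partial>\<kappa> (X z) \<partial>M)"
    by (subst nn_integral_distr) (auto intro!: measurable_nn_integral_kernel[where R=R] \<kappa>_meas)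
  finally show ?thesis .
qed

lemma is_cond_lawI:
  assumes X[measurable]: "X \<in> M \<rightarrow>\<^sub>M S" and \<kappa>[measurable]: "\<kappa> \<in> S \<rightarrow>\<^sub>M prob_algebra R"
    and eq: "\<And>A B. A \<in> sets S \<Longrightarrow> B \<in> sets R \<Longrightarrow>
      emeasure M {z\<in>space M. X z \<in> A \<and> Y z \<in> B} =
        (\<integral>\<^sup>+z. indicator A (X z) * emeasure (\<kappa> (X z)) B \<partial>M)"
  shows "is_cond_law M S X R Y \<kappa>"
  unfolding is_cond_law_def
proof (intro conjI ballI \<kappa>)
  fix A B assume [measurable]: "A \<in> sets S" "B \<in> sets R"
  have "(\<lambda>x. emeasure (\<kappa> x) B) \<in> borel_measurable S" by (rule measurable_emeasure_kernel) fact+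
  then show "emeasure M {z \<in> space M. X z \<in> A \<and> Y z \<in> B} = (\<integral>\<^sup>+x\<in>A. emeasure (\<kappa> x) B \<partial>distr M S X)"
    by (simp add: eq nn_integral_distr mult.commute)
qed

lemma is_cond_lawD:
  assumes X[measurable]: "X \<in> M \<rightarrow>\<^sub>M S" and \<kappa>: "is_cond_law M S X R Y \<kappa>"
    and [measurable]: "A \<in> sets S" "B \<in> sets R"
  shows "emeasure M {z\<in>space M. X z \<in> A \<and> Y z \<in> B} =
        (\<integral>\<^sup>+z. indicator A (X z) * emeasure (\<kappa> (X z)) B \<partial>M)"
proof -
  have [measurable]: "\<kappa> \<in> S \<rightarrow>\<^sub>M prob_algebra R" using \<kappa> by (simp add: is_cond_law_def)
  have "emeasure M {z\<in>space M. X z \<in> A \<and> Y z \<in> B} = (\<integral>\<^sup>+x\<in>A. emeasure (\<kappa> x) B \<partial>distr M S X)"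
    using \<kappa> by (simp add: is_cond_law_def)
  moreover have "(\<lambda>x. emeasure (\<kappa> x) B) \<in> borel_measurable S" by (rule measurable_emeasure_kernel) fact+
  ultimately show ?thesis by (simp add: nn_integral_distr mult.commute)
qed

text \<open>
  Given \<open>X\<close>, the variable \<open>X\<close> may be treated as a constant inside \<open>h\<close>. In particular a known position
  can be added to an increment.
\<close>

lemma cond_law_transform:
  assumes ps: "prob_space M" and X[measurable]: "X \<in> M \<rightarrow>\<^sub>M S" and Y[measurable]: "Y \<in> M \<rightarrow>\<^sub>M R"
    and \<kappa>: "is_cond_law M S X R Y \<kappa>" and h[measurable]: "h \<in> S \<Otimes>\<^sub>M R \<rightarrow>\<^sub>M R'"
  shows "is_cond_law M S X R' (\<lambda>z. h (X z, Y z)) (\<lambda>x. distr (\<kappa> x) R' (\<lambda>y. h (x, y)))"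
proof (rule is_cond_lawI[OF X])
  have \<kappa>m: "\<kappa> \<in> S \<rightarrow>\<^sub>M prob_algebra R" using \<kappa> by (simp add: is_cond_law_def)
  show "(\<lambda>x. distr (\<kappa> x) R' (\<lambda>y. h (x, y))) \<in> S \<rightarrow>\<^sub>M prob_algebra R'"
    by (rule measurable_distr_prob_space2[OF \<kappa>m]) (use h in simp)
  fix A B assume A[measurable]: "A \<in> sets S" and B[measurable]: "B \<in> sets R'"
  have hm: "(\<lambda>z. h (X z, Y z)) \<in> M \<rightarrow>\<^sub>M R'" by measurable
  have "emeasure M {z\<in>space M. X z \<in> A \<and> h (X z, Y z) \<in> B} =
    (\<integral>\<^sup>+z. indicator {z\<in>space M. X z \<in> A \<and> h (X z, Y z) \<in> B} z \<partial>M)"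
    by (rule nn_integral_indicator[symmetric]) measurable
  also have "\<dots> = (\<integral>\<^sup>+z. (\<lambda>q. indicator A (fst q) * indicator B (h q)) (X z, Y z) \<partial>M)"
    by (intro nn_integral_cong) (auto simp: indicator_def)
  also have "\<dots> = (\<integral>\<^sup>+z. \<integral>\<^sup>+y. (\<lambda>q. indicator A (fst q) * indicator B (h q)) (X z, y) \<partial>\<kappa> (X z) \<partial>M)"
    by (rule cond_law_nn_integral[OF ps X Y \<kappa>]) measurable
  also have "\<dots> = (\<integral>\<^sup>+z. indicator A (X z) * emeasure (distr (\<kappa> (X z)) R' (\<lambda>y. h (X z, y))) B \<partial>M)"
  proof (rule nn_integral_cong)
    fix z assume "z \<in> space M"
    then have x: "X z \<in> space S" by (rule measurable_space[OF X])
    note s[measurable_cong] = sets_kernel_prob(1)[OF \<kappa>m x]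
    have hx[measurable]: "(\<lambda>y. h (X z, y)) \<in> \<kappa> (X z) \<rightarrow>\<^sub>M R'"
      unfolding measurable_cong_sets[OF s refl] by (rule measurable_compose[OF measurable_Pair1'[OF x] h])
    have "(\<integral>\<^sup>+y. indicator A (X z) * indicator B (h (X z, y)) \<partial>\<kappa> (X z)) =
       indicator A (X z) * (\<integral>\<^sup>+y. indicator B (h (X z, y)) \<partial>\<kappa> (X z))"
      by (rule nn_integral_cmult) measurable
    also have "(\<integral>\<^sup>+y. indicator B (h (X z, y)) \<partial>\<kappa> (X z)) = emeasure (distr (\<kappa> (X z)) R' (\<lambda>y. h (X z, y))) B"
      by (subst nn_integral_indicator[symmetric], simp, subst nn_integral_distr) auto
    finally show "(\<integral>\<^sup>+y. (\<lambda>q. indicator A (fst q) * indicator B (h q)) (X z, y) \<partial>\<kappa> (X z)) =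
      indicator A (X z) * emeasure (distr (\<kappa> (X z)) R' (\<lambda>y. h (X z, y))) B" by simp
  qed
  finally show "emeasure M {z\<in>space M. X z \<in> A \<and> h (X z, Y z) \<in> B} =
    (\<integral>\<^sup>+z. indicator A (X z) * emeasure (distr (\<kappa> (X z)) R' (\<lambda>y. h (X z, y))) B \<partial>M)" .
qed

lemma cond_law_map:
  assumes "prob_space M" "X \<in> M \<rightarrow>\<^sub>M S" "Y \<in> M \<rightarrow>\<^sub>M R" "is_cond_law M S X R Y \<kappa>" "h \<in> R \<rightarrow>\<^sub>M R'"
  shows "is_cond_law M S X R' (\<lambda>z. h (Y z)) (\<lambda>x. distr (\<kappa> x) R' h)"
  using cond_law_transform[OF assms(1-4) measurable_compose[OF measurable_snd assms(5)]] by simp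

text \<open>
  Disintegration in two stages: first \<open>Y\<close> given \<open>X\<close>, then \<open>Z\<close> given both. It reduces the existence of
  conditional laws of vectors to the case of one real variable.
\<close>

lemma cond_law_pair:
  assumes "prob_space M"
    and X[measurable]: "X \<in> M \<rightarrow>\<^sub>M S" and Y[measurable]: "Y \<in> M \<rightarrow>\<^sub>M R" and Z[measurable]: "Z \<in> M \<rightarrow>\<^sub>M R'"
    and \<kappa>: "is_cond_law M S X R Y \<kappa>"
    and l: "is_cond_law M (S \<Otimes>\<^sub>M R) (\<lambda>z. (X z, Y z)) R' Z l"
  shows "is_cond_law M S X (R \<Otimes>\<^sub>M R') (\<lambda>z. (Y z, Z z))
           (\<lambda>x. \<kappa> x \<bind> (\<lambda>y. distr (l (x, y)) (R \<Otimes>\<^sub>M R') (Pair y)))"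
proof (rule is_cond_lawI[OF X])
  have \<kappa>_meas[measurable]: "\<kappa> \<in> S \<rightarrow>\<^sub>M prob_algebra R" using \<kappa> by (simp add: is_cond_law_def)
  have l_meas[measurable]: "l \<in> S \<Otimes>\<^sub>M R \<rightarrow>\<^sub>M prob_algebra R'" using l by (simp add: is_cond_law_def)
  let ?k = "\<lambda>x. \<kappa> x \<bind> (\<lambda>y. distr (l (x, y)) (R \<Otimes>\<^sub>M R') (Pair y))"
  show "?k \<in> S \<rightarrow>\<^sub>M prob_algebra (R \<Otimes>\<^sub>M R')" by measurable
  fix A B assume [measurable]: "A \<in> sets S" "B \<in> sets (R \<Otimes>\<^sub>M R')"
  have XY[measurable]: "(\<lambda>z. (X z, Y z)) \<in> M \<rightarrow>\<^sub>M S \<Otimes>\<^sub>M R" by measurable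
  have em: "(\<integral>\<^sup>+y'. indicator B (y, y') \<partial>l (x, y)) =
       emeasure (distr (l (x, y)) (R \<Otimes>\<^sub>M R') (Pair y)) B" if "x \<in> space S" "y \<in> space R" for x y
  proof -
    have "(x, y) \<in> space (S \<Otimes>\<^sub>M R)" using that by (simp add: space_pair_measure)
    from measurable_space[OF l_meas this] have s[measurable_cong]: "sets (l (x, y)) = sets R'"
      by (simp add: space_prob_algebra)
    show ?thesis using that
      by (subst nn_integral_indicator[symmetric]) (simp, subst nn_integral_distr, auto)
  qed
  have "emeasure M {z\<in>space M. X z \<in> A \<and> (Y z, Z z) \<in> B} =
     (\<integral>\<^sup>+z. indicator A (X z) * indicator B (Y z, Z z) \<partial>M)"
  proof -
    have "emeasure M {z\<in>space M. X z \<in> A \<and> (Y z, Z z) \<in> B} =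
        (\<integral>\<^sup>+z. indicator {z\<in>space M. X z \<in> A \<and> (Y z, Z z) \<in> B} z \<partial>M)"
      by (rule nn_integral_indicator[symmetric]) measurable
    then show ?thesis by (auto intro!: nn_integral_cong simp: indicator_def)
  qed
  also have "\<dots> = (\<integral>\<^sup>+z. (\<lambda>p. indicator A (fst (fst p)) * indicator B (snd (fst p), snd p)) ((X z, Y z), Z z) \<partial>M)"
    by simp
  also have "\<dots> = (\<integral>\<^sup>+z. \<integral>\<^sup>+y'. (\<lambda>p. indicator A (fst (fst p)) * indicator B (snd (fst p), snd p)) ((X z, Y z), y')
       \<partial>l (X z, Y z) \<partial>M)"
    by (rule cond_law_nn_integral[OF assms(1) XY Z l]) measurable
  also have "\<dots> = (\<integral>\<^sup>+z. indicator A (X z) * emeasure (distr (l (X z, Y z)) (R \<Otimes>\<^sub>M R') (Pair (Y z))) B \<partial>M)"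
  proof (rule nn_integral_cong)
    fix z assume z: "z \<in> space M"
    then have x: "X z \<in> space S" "Y z \<in> space R"
      by (auto intro: measurable_space[OF X] measurable_space[OF Y])
    show "(\<integral>\<^sup>+y'. (\<lambda>p. indicator A (fst (fst p)) * indicator B (snd (fst p), snd p)) ((X z, Y z), y') \<partial>l (X z, Y z))
      = indicator A (X z) * emeasure (distr (l (X z, Y z)) (R \<Otimes>\<^sub>M R') (Pair (Y z))) B"
      by (simp add: em[OF x, symmetric] indicator_def)
  qed
  also have "\<dots> = (\<integral>\<^sup>+z. (\<lambda>(x, y). indicator A x * emeasure (distr (l (x, y)) (R \<Otimes>\<^sub>M R') (Pair y)) B) (X z, Y z) \<partial>M)"
    by simp
  also have "\<dots> = (\<integral>\<^sup>+z. \<integral>\<^sup>+y. (\<lambda>(x, y). indicator A x * emeasure (distr (l (x, y)) (R \<Otimes>\<^sub>M R') (Pair y)) B) (X z, y)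
       \<partial>\<kappa> (X z) \<partial>M)"
  proof (rule cond_law_nn_integral[OF assms(1) X Y \<kappa>])
    have "(\<lambda>(x, y). distr (l (x, y)) (R \<Otimes>\<^sub>M R') (Pair y)) \<in> S \<Otimes>\<^sub>M R \<rightarrow>\<^sub>M prob_algebra (R \<Otimes>\<^sub>M R')"
      by measurable
    from measurable_emeasure_kernel[OF this \<open>B \<in> sets _\<close>]
    show "(\<lambda>(x, y). indicator A x * emeasure (distr (l (x, y)) (R \<Otimes>\<^sub>M R') (Pair y)) B)
        \<in> borel_measurable (S \<Otimes>\<^sub>M R)"
      by (simp add: split_beta')
  qed
  also have "\<dots> = (\<integral>\<^sup>+z. indicator A (X z) * emeasure (?k (X z)) B \<partial>M)"
  proof (rule nn_integral_cong)
    fix z assume z: "z \<in> space M"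
    then have x[measurable]: "X z \<in> space S" by (rule measurable_space[OF X])
    from measurable_space[OF \<kappa>_meas x] have s: "\<kappa> (X z) \<in> space (prob_algebra R)" .
    have "emeasure (?k (X z)) B = (\<integral>\<^sup>+y. emeasure (distr (l (X z, y)) (R \<Otimes>\<^sub>M R') (Pair y)) B \<partial>\<kappa> (X z))"
      by (rule emeasure_bind_prob_algebra[OF s]) measurable
    then show "(\<integral>\<^sup>+y. (\<lambda>(x, y). indicator A x * emeasure (distr (l (x, y)) (R \<Otimes>\<^sub>M R') (Pair y)) B) (X z, y)
       \<partial>\<kappa> (X z)) = indicator A (X z) * emeasure (?k (X z)) B"
      by (simp add: indicator_def)
  qed
  finally show "emeasure M {z\<in>space M. X z \<in> A \<and> (Y z, Z z) \<in> B} = 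
    (\<integral>\<^sup>+z. indicator A (X z) * emeasure (?k (X z)) B \<partial>M)" .
qed

text \<open>Splitting a set along \<open>f \<le> g\<close> shows that \<open>f\<close> and \<open>min f g\<close> have the same integral over every set.\<close>

lemma AE_le_of_set_nn_integral_le:
  assumes "finite_measure M"
    and [measurable]: "f \<in> borel_measurable M" "g \<in> borel_measurable M"
    and le: "\<And>A. A \<in> sets M \<Longrightarrow> (\<integral>\<^sup>+x\<in>A. f x \<partial>M) \<le> (\<integral>\<^sup>+x\<in>A. g x \<partial>M)"
  shows "AE x in M. f x \<le> (g x :: ennreal)"
proof -
  interpret finite_measure M by fact
  have "AE x in M. f x = min (f x) (g x)"
  proof (rule density_unique_finite_measure)
    fix A assume [measurable]: "A \<in> sets M"
    let ?P = "A \<inter> {x\<in>space M. f x \<le> g x}" and ?Q = "A \<inter> {x\<in>space M. \<not> f x \<le> g x}"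
    have split: "(\<integral>\<^sup>+x\<in>A. h x \<partial>M) = (\<integral>\<^sup>+x\<in>?P. h x \<partial>M) + (\<integral>\<^sup>+x\<in>?Q. h x \<partial>M)"
      if [measurable]: "h \<in> borel_measurable M" for h
      by (subst nn_integral_add[symmetric]) (auto intro!: nn_integral_cong simp: indicator_def)
    have "(\<integral>\<^sup>+x\<in>A. f x \<partial>M) = (\<integral>\<^sup>+x\<in>?P. f x \<partial>M) + (\<integral>\<^sup>+x\<in>?Q. f x \<partial>M)" by (rule split) simp
    also have "\<dots> \<le> (\<integral>\<^sup>+x\<in>?P. f x \<partial>M) + (\<integral>\<^sup>+x\<in>?Q. g x \<partial>M)" by (intro add_mono le) auto
    also have "(\<integral>\<^sup>+x\<in>?P. f x \<partial>M) = (\<integral>\<^sup>+x\<in>?P. min (f x) (g x) \<partial>M)"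
      by (intro nn_integral_cong) (auto simp: indicator_def min_def)
    also have "(\<integral>\<^sup>+x\<in>?Q. g x \<partial>M) = (\<integral>\<^sup>+x\<in>?Q. min (f x) (g x) \<partial>M)"
      by (intro nn_integral_cong) (auto simp: indicator_def min_def)
    also have "(\<integral>\<^sup>+x\<in>?P. min (f x) (g x) \<partial>M) + \<dots> = (\<integral>\<^sup>+x\<in>A. min (f x) (g x) \<partial>M)"
      by (rule split[symmetric]) simp
    finally have 1: "(\<integral>\<^sup>+x\<in>A. f x \<partial>M) \<le> (\<integral>\<^sup>+x\<in>A. min (f x) (g x) \<partial>M)" .
    show "(\<integral>\<^sup>+x\<in>A. f x \<partial>M) = (\<integral>\<^sup>+x\<in>A. min (f x) (g x) \<partial>M)"
      by (intro antisym 1 nn_integral_mono) (auto simp: indicator_def)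
  qed auto
  then show ?thesis by eventually_elim (metis min.cobounded2)
qed

text \<open>
  By right-continuity it is enough to compare the distribution functions across rational points, by
  weak inequalities from both sides.
\<close>

lemma finite_borel_measure_eqI_interlaced:
  assumes "finite_borel_measure m" "finite_borel_measure m'"
    and 1: "\<And>y q. y < real_of_rat q \<Longrightarrow> cdf m' y \<le> cdf m (real_of_rat q)"
    and 2: "\<And>y q. real_of_rat q \<le> y \<Longrightarrow> cdf m (real_of_rat q) \<le> cdf m' y"
  shows "m = m'"
proof (rule cdf_unique'[OF assms(1,2)], rule ext)
  interpret m: finite_borel_measure m by fact
  interpret m': finite_borel_measure m' by fact
  fix y :: real
  have ratE: thesis if "y < z" "\<And>q. y < real_of_rat q \<Longrightarrow> real_of_rat q < z \<Longrightarrow> thesis" for y z thesis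
    using Rats_dense_in_real[OF that(1)] that(2) by (auto elim!: Rats_cases)
  have rc: "(cdf n \<longlongrightarrow> cdf n y) (at_right y)" if "finite_borel_measure n" for n
    using finite_borel_measure.cdf_is_right_cont[OF that] by (simp add: continuous_within)
  show "cdf m y = cdf m' y"
  proof (rule antisym; rule ccontr)
    assume "\<not> cdf m y \<le> cdf m' y"
    then have "eventually (\<lambda>z. cdf m' z < cdf m y) (at_right y)"
      by (intro order_tendstoD(2)[OF rc[OF assms(2)]]) simp
    then obtain b where b: "b > y" "\<And>z. y < z \<Longrightarrow> z < b \<Longrightarrow> cdf m' z < cdf m y"
      by (auto simp: eventually_at_right_field)
    obtain q where q: "y < real_of_rat q" "real_of_rat q < b" using ratE[OF b(1)] by blast
    have "cdf m y \<le> cdf m (real_of_rat q)" using q by (intro m.cdf_nondecreasing) simp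
    with 2[of q "real_of_rat q"] b(2)[OF q] show False by simp
  next
    assume "\<not> cdf m' y \<le> cdf m y"
    then have "eventually (\<lambda>z. cdf m z < cdf m' y) (at_right y)"
      by (intro order_tendstoD(2)[OF rc[OF assms(1)]]) simp
    then obtain b where b: "b > y" "\<And>z. y < z \<Longrightarrow> z < b \<Longrightarrow> cdf m z < cdf m' y"
      by (auto simp: eventually_at_right_field)
    obtain q where q: "y < real_of_rat q" "real_of_rat q < b" using ratE[OF b(1)] by blast
    with 1[OF q(1)] b(2)[OF q] show False by simp
  qed
qed

text \<open>
  Two versions of a conditional law give, outside a null set, the same mass to all half-lines with
  rational end, and these countably many values determine a law on the line.
\<close>

lemma AE_cong_cond_law:
  fixes \<kappa> \<kappa>' :: "'b \<Rightarrow> real measure"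
  assumes "prob_space M" and X[measurable]: "X \<in> M \<rightarrow>\<^sub>M S"
    and \<kappa>: "is_cond_law M S X borel Y \<kappa>" and \<kappa>': "is_cond_law M S X borel Y \<kappa>'"
  shows "AE x in distr M S X. \<kappa> x = \<kappa>' x"
proof -
  interpret M: prob_space M by fact
  interpret D: prob_space "distr M S X" by (rule M.prob_space_distr) fact
  have m[measurable]: "\<kappa> \<in> S \<rightarrow>\<^sub>M prob_algebra borel" "\<kappa>' \<in> S \<rightarrow>\<^sub>M prob_algebra borel"
    using \<kappa> \<kappa>' by (auto simp: is_cond_law_def)
  have "AE x in distr M S X. emeasure (\<kappa> x) {..real_of_rat q} = emeasure (\<kappa>' x) {..real_of_rat q}" for q
  proof (rule D.density_unique_finite_measure)
    fix A assume "A \<in> sets (distr M S X)"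
    then have A[measurable]: "A \<in> sets S" by simp
    have q: "{..real_of_rat q} \<in> sets borel" by simp
    have "emeasure M {z\<in>space M. X z \<in> A \<and> Y z \<in> {..real_of_rat q}} =
        (\<integral>\<^sup>+x\<in>A. emeasure (\<kappa> x) {..real_of_rat q} \<partial>distr M S X)"
      using \<kappa> A q unfolding is_cond_law_def by blast
    moreover have "emeasure M {z\<in>space M. X z \<in> A \<and> Y z \<in> {..real_of_rat q}} =
        (\<integral>\<^sup>+x\<in>A. emeasure (\<kappa>' x) {..real_of_rat q} \<partial>distr M S X)"
      using \<kappa>' A q unfolding is_cond_law_def by blast
    ultimately show "(\<integral>\<^sup>+x\<in>A. emeasure (\<kappa> x) {..real_of_rat q} \<partial>distr M S X) =
          (\<integral>\<^sup>+x\<in>A. emeasure (\<kappa>' x) {..real_of_rat q} \<partial>distr M S X)"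
      by simp
  qed (simp_all add: measurable_emeasure_kernel[OF m(1)] measurable_emeasure_kernel[OF m(2)])
  then have "AE x in distr M S X. \<forall>q. emeasure (\<kappa> x) {..real_of_rat q} = emeasure (\<kappa>' x) {..real_of_rat q}"
    by (simp add: AE_all_countable)
  then show ?thesis
  proof (rule AE_mp, intro AE_I2 impI)
    fix x assume "x \<in> space (distr M S X)"
      and *: "\<forall>q. emeasure (\<kappa> x) {..real_of_rat q} = emeasure (\<kappa>' x) {..real_of_rat q}"
    then have x: "x \<in> space S" by simp
    have p: "\<kappa> x \<in> space (prob_algebra borel)" "\<kappa>' x \<in> space (prob_algebra borel)"
      using measurable_space[OF m(1) x] measurable_space[OF m(2) x] by auto
    interpret k: real_distribution "\<kappa> x"
      using p(1) by (auto simp: space_prob_algebra real_distribution_def real_distribution_axioms_def)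
    interpret k': real_distribution "\<kappa>' x"
      using p(2) by (auto simp: space_prob_algebra real_distribution_def real_distribution_axioms_def)
    have q: "cdf (\<kappa> x) (real_of_rat q) = cdf (\<kappa>' x) (real_of_rat q)" for q
      using * by (simp add: cdf_def measure_def)
    show "\<kappa> x = \<kappa>' x"
      by (rule finite_borel_measure_eqI_interlaced[OF k.finite_borel_measure_M k'.finite_borel_measure_M])
        (simp_all add: q k'.cdf_nondecreasing)
  qed
qed

text \<open>
  The right-continuous regularisation of a monotone function on the rationals. The two conditions on
  \<open>g\<close> outside \<open>[-2, 2)\<close> make the limits at \<open>\<plusminus>\<infinity>\<close> automatic.
\<close>

lemma Inf_rat_distribution_function:
  fixes g :: "rat \<Rightarrow> real"
  assumes mono: "\<And>q r. q \<le> r \<Longrightarrow> g q \<le> g r"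
    and bot: "\<And>q. q < -2 \<Longrightarrow> g q = 0" and top: "\<And>q. 2 \<le> q \<Longrightarrow> g q = 1"
  defines "F \<equiv> \<lambda>y. INF q\<in>{q. y < real_of_rat q}. g q"
  shows "\<And>x y. x \<le> y \<Longrightarrow> F x \<le> F y" "\<And>a. continuous (at_right a) F"
    "(F \<longlongrightarrow> 0) at_bot" "(F \<longlongrightarrow> 1) at_top"
    "\<And>y q. y < real_of_rat q \<Longrightarrow> F y \<le> g q" "\<And>y q. real_of_rat q \<le> y \<Longrightarrow> g q \<le> F y"
proof -
  have ge0: "0 \<le> g q" for q
    using mono[of "min q (-3)" q] bot[of "min q (-3)"] by simp
  have bdd: "bdd_below (g ` A)" for A by (rule bdd_belowI2[of _ 0]) (rule ge0)
  have ne: "{q. y < real_of_rat q} \<noteq> {}" for y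
  proof -
    obtain r where "y < r" "r \<in> \<rat>" using Rats_dense_in_real[of y "y+1"] by auto
    then show ?thesis by (auto elim!: Rats_cases)
  qed
  show mF: "F x \<le> F y" if "x \<le> y" for x y
    unfolding F_def using that by (intro cINF_superset_mono bdd ne) auto
  show le: "F y \<le> g q" if "y < real_of_rat q" for y q
    unfolding F_def using that by (intro cINF_lower bdd) auto
  show ge: "g q \<le> F y" if "real_of_rat q \<le> y" for y q
    unfolding F_def using that by (intro cINF_greatest ne mono) (auto simp: of_rat_less[symmetric, where 'a=real] intro: less_imp_le)
  show "continuous (at_right a) F" for a
    unfolding continuous_within
  proof (rule order_tendstoI)
    fix b assume b: "b < F a"
    show "eventually (\<lambda>z. b < F z) (at_right a)"
      by (rule eventually_at_right_less[THEN eventually_mono]) (use mF b in \<open>force intro: less_le_trans\<close>)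
  next
    fix b assume "F a < b"
    then obtain q where q: "a < real_of_rat q" "g q < b"
      unfolding F_def using cINF_less_iff[OF ne bdd] by auto
    have "eventually (\<lambda>z. z < real_of_rat q) (at_right a)"
      using q(1) by (auto simp: eventually_at_right_field)
    then show "eventually (\<lambda>z. F z < b) (at_right a)"
      by eventually_elim (use le q(2) in \<open>force intro: le_less_trans\<close>)
  qed
  have "eventually (\<lambda>y. F y = 0) at_bot"
    unfolding eventually_at_bot_linorder
  proof (intro exI allI impI antisym)
    fix y :: real assume "y \<le> - 4"
    then have "y < real_of_rat (-3)" by (simp add: of_rat_minus)
    from le[OF this] show "F y \<le> 0" by (simp add: bot)
    show "0 \<le> F y" unfolding F_def by (intro cINF_greatest ne ge0)
  qed
  then show "(F \<longlongrightarrow> 0) at_bot" by (rule tendsto_eventually)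
  have "eventually (\<lambda>y. F y = 1) at_top"
    unfolding eventually_at_top_linorder
  proof (intro exI allI impI antisym)
    fix y :: real assume y: "2 \<le> y"
    then have "real_of_rat 2 \<le> y" by simp
    from ge[OF this] show "1 \<le> F y" by (simp add: top)
    obtain q where q: "y < real_of_rat q" using ne[of y] by auto
    with y have "real_of_rat 2 \<le> real_of_rat q" by simp
    then have "2 \<le> q" by (simp only: of_rat_less_eq)
    then show "F y \<le> 1" using le[OF q] by (simp add: top)
  qed
  then show "(F \<longlongrightarrow> 1) at_top" by (rule tendsto_eventually)
qed

text \<open>
  For rational \<open>q\<close>, the conditional probability of \<open>Y \<le> q\<close> is a Radon-Nikodym derivative with respect to
  the law of \<open>X\<close>. Outside a null set these derivatives are monotone in \<open>q\<close>, and their right-continuous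
  regularisation is the distribution function of the conditional law. The bound on \<open>Y\<close> allows to set
  the derivatives to \<open>0\<close> and \<open>1\<close> for large \<open>\<bar>q\<bar>\<close>, so that no limit in \<open>q\<close> has to be controlled.
\<close>

lemma ex_cond_law_bounded:
  fixes Y :: "'a \<Rightarrow> real"
  assumes "prob_space M" and X[measurable]: "X \<in> M \<rightarrow>\<^sub>M S" and Y[measurable]: "Y \<in> borel_measurable M"
    and bnd: "\<And>z. z \<in> space M \<Longrightarrow> -2 < Y z" "\<And>z. z \<in> space M \<Longrightarrow> Y z < 2"
  shows "\<exists>\<kappa>. is_cond_law M S X borel Y \<kappa>"
proof -
  interpret M: prob_space M by fact
  let ?\<rho> = "distr M S X"
  interpret D: prob_space ?\<rho> by (rule M.prob_space_distr) fact
  define \<rho>q where "\<rho>q q = distr (density M (indicator {z\<in>space M. Y z \<le> real_of_rat q})) S X" for q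
  define g0 where "g0 q = RN_deriv ?\<rho> (\<rho>q q)" for q
  have [measurable]: "g0 q \<in> borel_measurable S" for q
    unfolding g0_def using borel_measurable_RN_deriv[of ?\<rho> "\<rho>q q"] by simp
  have \<rho>q: "emeasure (\<rho>q q) A = emeasure M {z\<in>space M. X z \<in> A \<and> Y z \<le> real_of_rat q}"
    if [measurable]: "A \<in> sets S" for q A
    unfolding \<rho>q_def
    by (subst emeasure_distr, simp, simp, subst emeasure_restricted)
      (auto intro!: arg_cong[where f="emeasure M"])
  have g0_int: "(\<integral>\<^sup>+x\<in>A. g0 q x \<partial>?\<rho>) = emeasure M {z\<in>space M. X z \<in> A \<and> Y z \<le> real_of_rat q}"
    if A[measurable]: "A \<in> sets S" for q A
  proof -
    have "absolutely_continuous ?\<rho> (\<rho>q q)"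
      unfolding absolutely_continuous_def
    proof
      fix N assume "N \<in> null_sets ?\<rho>"
      then have N[measurable]: "N \<in> sets S" and "emeasure M (X -` N \<inter> space M) = 0"
        by (auto simp: null_sets_def emeasure_distr)
      moreover have "emeasure M {z\<in>space M. X z \<in> N \<and> Y z \<le> real_of_rat q} \<le> emeasure M (X -` N \<inter> space M)"
        by (intro emeasure_mono) auto
      ultimately show "N \<in> null_sets (\<rho>q q)" by (auto simp: null_sets_def \<rho>q) (simp add: \<rho>q_def)
    qed
    then have "density ?\<rho> (g0 q) = \<rho>q q"
      unfolding g0_def by (rule D.density_RN_deriv) (simp add: \<rho>q_def)
    then have "emeasure (\<rho>q q) A = emeasure (density ?\<rho> (g0 q)) A" by simp
    then show ?thesis by (simp add: \<rho>q emeasure_density)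
  qed
  \<comment> \<open>Finite values; the cut at \<open>1\<close> changes the derivative on a null set only.\<close>
  define g :: "rat \<Rightarrow> 'b \<Rightarrow> real" where "g q x = (if q < -2 then 0 else if 2 \<le> q then 1 else enn2real (min 1 (g0 q x)))" for q x
  have [measurable]: "g q \<in> borel_measurable S" for q unfolding g_def by measurable
  have g_nonneg: "0 \<le> g q x" for q x by (simp add: g_def)
  have g_int: "(\<integral>\<^sup>+x\<in>A. ennreal (g q x) \<partial>?\<rho>) = emeasure M {z\<in>space M. X z \<in> A \<and> Y z \<le> real_of_rat q}"
    if A[measurable]: "A \<in> sets S" for q A
  proof -
    consider "q < -2" | "2 \<le> q" | "\<not> q < -2" "\<not> 2 \<le> q" by blast
    then show ?thesis
    proof cases
      case 1
      then have "real_of_rat q < real_of_rat (-2)" by (simp only: of_rat_less)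
      then have "real_of_rat q < -2" by (simp add: of_rat_minus)
      then have e: "{z\<in>space M. X z \<in> A \<and> Y z \<le> real_of_rat q} = {}" using bnd by force
      show ?thesis unfolding e using 1 by (simp add: g_def)
    next
      case 2
      then have "real_of_rat 2 \<le> real_of_rat q" by (simp only: of_rat_less_eq)
      then have "2 \<le> real_of_rat q" by simp
      then have e: "{z\<in>space M. X z \<in> A \<and> Y z \<le> real_of_rat q} = X -` A \<inter> space M" using bnd by force
      have "\<not> q < -2" using 2 by simp
      then show ?thesis unfolding e using 2 by (simp add: g_def emeasure_distr)
    next
      case 3
      have "AE x in ?\<rho>. g0 q x \<le> 1"
      proof (rule AE_le_of_set_nn_integral_le)
        fix A assume "A \<in> sets ?\<rho>"
        then have [measurable]: "A \<in> sets S" by simp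
        show "(\<integral>\<^sup>+x\<in>A. g0 q x \<partial>?\<rho>) \<le> (\<integral>\<^sup>+x\<in>A. 1 \<partial>?\<rho>)"
          by (simp add: g0_int emeasure_distr) (auto intro!: emeasure_mono)
      qed (auto simp: D.finite_measure_axioms)
      then have "AE x in ?\<rho>. ennreal (g q x) * indicator A x = g0 q x * indicator A x"
      proof eventually_elim
        case (elim x)
        then have "min 1 (g0 q x) = g0 q x" "g0 q x < top"
          by (auto simp: min_def intro: le_less_trans ennreal_one_less_top)
        then show ?case using 3 by (simp add: g_def)
      qed
      then show ?thesis by (subst nn_integral_cong_AE) (auto simp: g0_int)
    qed
  qed
  define good where "good = {x\<in>space S. \<forall>q r. q \<le> r \<longrightarrow> g q x \<le> g r x}"
  have [measurable]: "good \<in> sets S" unfolding good_def by measurable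
  have AE_good: "AE x in ?\<rho>. x \<in> good"
  proof -
    have "AE x in ?\<rho>. q \<le> r \<longrightarrow> g q x \<le> g r x" for q r
    proof (cases "q \<le> r")
      case True
      then have qr: "real_of_rat q \<le> real_of_rat r" by (simp add: of_rat_less_eq)
      have "AE x in ?\<rho>. ennreal (g q x) \<le> ennreal (g r x)"
      proof (rule AE_le_of_set_nn_integral_le)
        fix A assume "A \<in> sets ?\<rho>"
        then have [measurable]: "A \<in> sets S" by simp
        show "(\<integral>\<^sup>+x\<in>A. ennreal (g q x) \<partial>?\<rho>) \<le> (\<integral>\<^sup>+x\<in>A. ennreal (g r x) \<partial>?\<rho>)"
          unfolding g_int[OF \<open>A \<in> sets S\<close>] using qr by (intro emeasure_mono) auto
      qed (auto simp: D.finite_measure_axioms)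
      then show ?thesis by (simp add: g_nonneg)
    qed simp
    then have "AE x in ?\<rho>. \<forall>q r. q \<le> r \<longrightarrow> g q x \<le> g r x" by (simp add: AE_all_countable)
    then show ?thesis by (rule AE_mp) (auto simp: good_def intro!: AE_I2)
  qed
  define F where "F x y = (INF q\<in>{q. y < real_of_rat q}. g q x)" for x y
  have F: "\<And>a b. a \<le> b \<Longrightarrow> F x a \<le> F x b" "\<And>a. continuous (at_right a) (F x)"
    "(F x \<longlongrightarrow> 0) at_bot" "(F x \<longlongrightarrow> 1) at_top"
    "\<And>y q. y < real_of_rat q \<Longrightarrow> F x y \<le> g q x" "\<And>y q. real_of_rat q \<le> y \<Longrightarrow> g q x \<le> F x y"
    if x: "x \<in> good" for x
    unfolding F_def
    by (rule Inf_rat_distribution_function[of "\<lambda>q. g q x"]; use x in \<open>force simp: g_def good_def\<close>)+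
  define \<kappa> where "\<kappa> x = (if x \<in> good then interval_measure (F x) else return borel 0)" for x
  have real_\<kappa>: "real_distribution (\<kappa> x)" for x
  proof (cases "x \<in> good")
    case True
    then show ?thesis using F[OF True] by (auto simp: \<kappa>_def intro!: real_distribution_interval_measure)
  next
    case False
    have "prob_space (return borel (0::real))" by (rule prob_space_return) simp
    then show ?thesis using False
      by (auto simp: \<kappa>_def real_distribution_def real_distribution_axioms_def)
  qed
  have cdf_\<kappa>: "cdf (\<kappa> x) y = F x y" if "x \<in> good" for x y
    using F[OF that] that by (simp add: \<kappa>_def cdf_interval_measure)
  have \<kappa>_meas[measurable]: "\<kappa> \<in> S \<rightarrow>\<^sub>M prob_algebra borel"
  proof (rule measurable_prob_algebra_generated[where G="range (\<lambda>y::real. {..y})" and \<Omega>=UNIV])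
    show "sets borel = sigma_sets UNIV (range (\<lambda>y::real. {..y}))"
      by (simp add: borel_eq_atMost)
    show "Int_stable (range (\<lambda>y::real. {..y}))" by (auto simp: Int_stable_def)
    fix a assume "a \<in> space S"
    show "prob_space (\<kappa> a)" "sets (\<kappa> a) = sets borel"
      using real_\<kappa>[of a] by (auto simp: real_distribution_def real_distribution_axioms_def)
  next
    fix A assume "A \<in> range (\<lambda>y::real. {..y})"
    then obtain y where A: "A = {..y}" by auto
    have Fm[measurable]: "(\<lambda>x. F x y) \<in> borel_measurable S"
      unfolding F_def by (rule borel_measurable_cINF) (auto intro!: bdd_belowI2[of _ 0] g_nonneg)
    have "emeasure (\<kappa> x) A = (if x \<in> good then ennreal (F x y) else indicator A 0)" for x
    proof (cases "x \<in> good")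
      case True
      interpret r: real_distribution "\<kappa> x" by (rule real_\<kappa>)
      show ?thesis using cdf_\<kappa>[OF True, of y] True by (simp add: cdf_def A r.emeasure_eq_measure)
    qed (simp add: \<kappa>_def A)
    then show "(\<lambda>a. emeasure (\<kappa> a) A) \<in> borel_measurable S" by simp
  qed simp
  have "is_cond_law M S X borel Y \<kappa>"
  proof (rule is_cond_lawI[OF X \<kappa>_meas])
    fix A B assume A[measurable]: "A \<in> sets S" and B[measurable]: "B \<in> sets (borel :: real measure)"
    \<comment> \<open>For a fixed event \<open>A\<close> for \<open>X\<close>, both sides are finite measures in \<open>B\<close>; compare their distribution functions.\<close>
    let ?m = "distr (density M (indicator (X -` A \<inter> space M))) borel Y"
    let ?m' = "density ?\<rho> (indicator A) \<bind> \<kappa>"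
    have \<kappa>_sub: "\<kappa> \<in> density ?\<rho> (indicator A) \<rightarrow>\<^sub>M subprob_algebra borel"
      using measurable_prob_algebraD[OF \<kappa>_meas] by simp
    have ne: "space (density ?\<rho> (indicator A)) \<noteq> {}" using D.not_empty by simp
    have em: "emeasure ?m C = emeasure M {z\<in>space M. X z \<in> A \<and> Y z \<in> C}" if [measurable]: "C \<in> sets borel" for C
      by (subst emeasure_distr, simp, simp, subst emeasure_restricted)
        (auto intro!: arg_cong[where f="emeasure M"])
    have em': "emeasure ?m' C = (\<integral>\<^sup>+x\<in>A. emeasure (\<kappa> x) C \<partial>?\<rho>)" if C[measurable]: "C \<in> sets borel" for C
      by (subst emeasure_bind[OF ne \<kappa>_sub C], subst nn_integral_density)
        (auto intro!: nn_integral_cong measurable_emeasure_kernel[OF \<kappa>_meas] simp: mult.commute)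
    have fin_m: "emeasure ?m C \<le> 1" if [measurable]: "C \<in> sets borel" for C
      unfolding em[OF that] by (rule M.emeasure_le_1)
    have fin_m': "emeasure ?m' C \<le> 1" if [measurable]: "C \<in> sets borel" for C
    proof -
      have "(\<integral>\<^sup>+x\<in>A. emeasure (\<kappa> x) C \<partial>?\<rho>) \<le> (\<integral>\<^sup>+x. 1 \<partial>?\<rho>)"
      proof (rule nn_integral_mono)
        fix x
        interpret r: real_distribution "\<kappa> x" by (rule real_\<kappa>)
        show "emeasure (\<kappa> x) C * indicator A x \<le> 1"
          using r.emeasure_le_1[of C] by (auto simp: indicator_def)
      qed
      then show ?thesis unfolding em'[OF that] using D.emeasure_space_1 by simp
    qed
    have "?m = ?m'"
    proof (rule finite_borel_measure_eqI_interlaced)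
      show "finite_borel_measure ?m"
        using fin_m[of UNIV] by (auto intro!: finite_borel_measure.intro finite_measureI simp: finite_borel_measure_axioms_def top_unique)
      show "finite_borel_measure ?m'"
        using fin_m'[of UNIV] sets_bind_measurable[OF \<kappa>_sub ne] space_bind_measurable[OF \<kappa>_sub ne]
        by (auto intro!: finite_borel_measure.intro finite_measureI simp: finite_borel_measure_axioms_def top_unique)
    next
      fix y q
      have rat: "emeasure ?m {..real_of_rat q} = (\<integral>\<^sup>+x\<in>A. ennreal (g q x) \<partial>?\<rho>)"
        by (simp add: em g_int)
      have em'_y: "emeasure ?m' {..y} = (\<integral>\<^sup>+x\<in>A. emeasure (\<kappa> x) {..y} \<partial>?\<rho>)"
        by (rule em') simp
      have key: "AE x in ?\<rho>. emeasure (\<kappa> x) {..y} = ennreal (F x y)"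
        using AE_good
      proof eventually_elim
        case (elim x)
        interpret r: real_distribution "\<kappa> x" by (rule real_\<kappa>)
        show ?case using cdf_\<kappa>[OF elim, of y] by (simp add: cdf_def r.emeasure_eq_measure)
      qed
      have fin: "emeasure ?m {..z} < top" "emeasure ?m' {..z} < top" for z
        using fin_m[of "{..z}"] fin_m'[of "{..z}"] by (auto intro: le_less_trans)
      show "cdf ?m' y \<le> cdf ?m (real_of_rat q)" if "y < real_of_rat q"
      proof -
        have "emeasure ?m' {..y} \<le> emeasure ?m {..real_of_rat q}"
          unfolding rat em'_y
          by (rule nn_integral_mono_AE, use key AE_good in eventually_elim)
            (auto simp: indicator_def intro!: ennreal_leI F(5) that)
        then show ?thesis unfolding cdf_def measure_def using fin by (intro enn2real_mono) auto
      qed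
      show "cdf ?m (real_of_rat q) \<le> cdf ?m' y" if "real_of_rat q \<le> y"
      proof -
        have "emeasure ?m {..real_of_rat q} \<le> emeasure ?m' {..y}"
          unfolding rat em'_y
          by (rule nn_integral_mono_AE, use key AE_good in eventually_elim)
            (auto simp: indicator_def intro!: ennreal_leI F(6) that)
        then show ?thesis unfolding cdf_def measure_def using fin by (intro enn2real_mono) auto
      qed
    qed
    then have eq: "emeasure ?m B = emeasure ?m' B" by simp
    have [measurable]: "(\<lambda>x. emeasure (\<kappa> x) B) \<in> borel_measurable S"
      by (rule measurable_emeasure_kernel[OF \<kappa>_meas B])
    show "emeasure M {z\<in>space M. X z \<in> A \<and> Y z \<in> B} =
        (\<integral>\<^sup>+z. indicator A (X z) * emeasure (\<kappa> (X z)) B \<partial>M)"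
      using eq unfolding em[OF B] em'[OF B] by (subst (asm) nn_integral_distr) (auto simp: mult.commute)
  qed
  then show ?thesis by blast
qed

text \<open>The arctangent makes \<open>Y\<close> bounded, and the tangent transports the conditional law back.\<close>

theorem ex_cond_law:
  fixes Y :: "'a \<Rightarrow> real"
  assumes "prob_space M" and X[measurable]: "X \<in> M \<rightarrow>\<^sub>M S" and Y[measurable]: "Y \<in> borel_measurable M"
  shows "\<exists>\<kappa>. is_cond_law M S X borel Y \<kappa>"
proof -
  have [measurable]: "arctan \<in> borel_measurable borel" "tan \<in> borel_measurable (borel :: real measure)"
    by (auto simp: tan_def[abs_def] intro!: borel_measurable_continuous_onI continuous_intros)
  have "-2 < arctan y \<and> arctan y < 2" for y
    using arctan_bounded[of y] pi_less_4 by auto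
  then obtain \<kappa> where "is_cond_law M S X borel (\<lambda>z. arctan (Y z)) \<kappa>"
    using ex_cond_law_bounded[OF assms(1) X, of "\<lambda>z. arctan (Y z)"] by auto
  from cond_law_map[OF assms(1) X _ this, of tan borel]
  show ?thesis by (auto simp: tan_arctan)
qed

section \<open>Quantile functions\<close>

abbreviation unif :: "real measure" where
  "unif \<equiv> uniform_measure lborel {0..1}"

lemma real_distribution_iff: "real_distribution \<eta> \<longleftrightarrow> \<eta> \<in> space (prob_algebra borel)"
  by (auto simp: space_prob_algebra real_distribution_def real_distribution_axioms_def)

lemma prob_space_unif: "prob_space unif"
  by (rule prob_space_uniform_measure) auto

lemma AE_unif: "AE u in unif. 0 < u \<and> u < 1"
proof -
  have "AE u in lborel. u \<noteq> (0::real)" "AE u in lborel. u \<noteq> (1::real)"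
    by (rule AE_lborel_singleton)+
  then have "AE u in lborel. u \<in> {0..1} \<longrightarrow> 0 < u \<and> u < (1::real)"
    by eventually_elim auto
  then show ?thesis by (intro AE_uniform_measureI) auto
qed

lemma quantile_le_iff:
  assumes "real_distribution \<eta>" "0 < u" "u < 1"
  shows "quantile \<eta> u \<le> x \<longleftrightarrow> u \<le> cdf \<eta> x"
proof -
  interpret cdf_distribution \<eta> using assms(1) by (simp add: cdf_distribution_def)
  show ?thesis using pseudoinverse[OF assms(2,3), of x] by (simp add: quantile_def)
qed

text \<open>
  At the level \<open>1\<close> the defining set is nonempty only if the law has a bounded upper tail, which is why
  this level is separate.
\<close>

lemma quantile_1_le_iff:
  assumes "real_distribution \<eta>" "1 \<le> cdf \<eta> z"
  shows "quantile \<eta> 1 \<le> x \<longleftrightarrow> 1 \<le> cdf \<eta> x"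
proof -
  interpret real_distribution \<eta> by fact
  let ?S = "{y. 1 \<le> cdf \<eta> y}"
  have "eventually (\<lambda>y. cdf \<eta> y < 1) at_bot"
    using order_tendstoD(2)[OF cdf_lim_at_bot, of 1] by simp
  then obtain l where l: "\<And>y. y \<le> l \<Longrightarrow> cdf \<eta> y < 1" by (auto simp: eventually_at_bot_linorder)
  have bdd: "bdd_below ?S"
  proof (rule bdd_belowI)
    fix y assume "y \<in> ?S" then show "l \<le> y" using l[of y] by force
  qed
  have ne: "?S \<noteq> {}" using assms(2) by auto
  show ?thesis
  proof
    assume "1 \<le> cdf \<eta> x" then show "quantile \<eta> 1 \<le> x"
      unfolding quantile_def by (intro cInf_lower bdd) simp
  next
    assume q: "quantile \<eta> 1 \<le> x"
    show "1 \<le> cdf \<eta> x"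
    proof (rule ccontr)
      assume "\<not> 1 \<le> cdf \<eta> x"
      then have "eventually (\<lambda>y. cdf \<eta> y < 1) (at_right x)"
        using cdf_is_right_cont[of x] by (intro order_tendstoD(2)[of _ "cdf \<eta> x"]) (auto simp: continuous_within)
      then obtain b where b: "x < b" "\<And>y. x < y \<Longrightarrow> y < b \<Longrightarrow> cdf \<eta> y < 1"
        by (auto simp: eventually_at_right_field)
      obtain y where y: "x < y" "y < b" using dense[OF b(1)] by auto
      have "Inf ?S < y" using q y by (simp add: quantile_def)
      then obtain s where "s \<in> ?S" "s < y" using cInf_less_iff[OF ne bdd] by auto
      with cdf_nondecreasing[of s y] b(2)[OF y] show False by simp
    qed
  qed
qed

text \<open>
  At a level outside \<open>(0, 1)\<close> the infimum may be over the empty set or over an unbounded set. Its value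
  is then the same for all laws for which this happens, so joint measurability in the law and the level
  holds for all levels.
\<close>

lemma measurable_quantile_pair:
  "(\<lambda>p. quantile (fst p) (snd p)) \<in> borel_measurable (prob_algebra borel \<Otimes>\<^sub>M borel)"
proof (rule borel_measurableI_le)
  let ?M = "prob_algebra borel \<Otimes>\<^sub>M borel :: (real measure \<times> real) measure"
  fix x :: real
  have c[measurable]: "(\<lambda>p. cdf (fst p) y) \<in> borel_measurable ?M" for y
  proof -
    have "(\<lambda>p. fst p) \<in> ?M \<rightarrow>\<^sub>M subprob_algebra borel"
      by (intro measurable_prob_algebraD measurable_fst)
    from measurable_compose[OF this measurable_measure_subprob_algebra[of "{..y}"]]
    show ?thesis by (simp add: cdf_def)
  qed
  \<comment> \<open>The values at degenerate levels, where the infimum is over \<open>UNIV\<close> or the empty set.\<close>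
  define c0 :: real where "c0 = Inf UNIV"
  define c1 :: real where "c1 = Inf {}"
  have "quantile (fst p) (snd p) \<le> x \<longleftrightarrow>
     (if snd p \<le> 0 then c0 \<le> x else if 1 < snd p then c1 \<le> x else
      if snd p = 1 then (if \<exists>n::nat. 1 \<le> cdf (fst p) (real n) then 1 \<le> cdf (fst p) x else c1 \<le> x)
      else snd p \<le> cdf (fst p) x)" if "p \<in> space ?M" for p
  proof -
    have r: "real_distribution (fst p)"
      using that by (auto simp: real_distribution_iff space_pair_measure)
    then interpret real_distribution "fst p" .
    consider "snd p \<le> 0" | "1 < snd p" | "snd p = 1" "\<exists>n::nat. 1 \<le> cdf (fst p) (real n)"
      | "snd p = 1" "\<And>n::nat. \<not> 1 \<le> cdf (fst p) (real n)" | "0 < snd p" "snd p < 1" by fastforce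
    then show ?thesis
    proof cases
      case 1
      then have "{y. snd p \<le> cdf (fst p) y} = UNIV"
        using cdf_nonneg by (auto intro: order_trans)
      then show ?thesis using 1 by (simp add: quantile_def c0_def)
    next
      case 2
      have "\<not> snd p \<le> cdf (fst p) y" for y using cdf_bounded_prob[of y] 2 by linarith
      then have "{y. snd p \<le> cdf (fst p) y} = {}" by blast
      then show ?thesis using 2 by (simp add: quantile_def c1_def)
    next
      case 3 then show ?thesis using quantile_1_le_iff[OF r] by auto
    next
      case 4
      have "\<not> 1 \<le> cdf (fst p) y" for y
      proof -
        obtain n :: nat where "y \<le> real n" using real_arch_simple by blast
        from cdf_nondecreasing[OF this] 4(2)[of n] show ?thesis by linarith
      qed
      then have "{y. snd p \<le> cdf (fst p) y} = {}" using 4 by auto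
      then show ?thesis using 4 by (simp add: quantile_def c1_def)
    next
      case 5 then show ?thesis using quantile_le_iff[OF r] by auto
    qed
  qed
  then have "{p \<in> space ?M. quantile (fst p) (snd p) \<le> x} = {p \<in> space ?M. (if snd p \<le> 0 then c0 \<le> x else if 1 < snd p then c1 \<le> x else
      if snd p = 1 then (if \<exists>n::nat. 1 \<le> cdf (fst p) (real n) then 1 \<le> cdf (fst p) x else c1 \<le> x)
      else snd p \<le> cdf (fst p) x)}" by blast
  also have "\<dots> \<in> sets ?M" by measurable
  finally show "{p \<in> space ?M. quantile (fst p) (snd p) \<le> x} \<in> sets ?M" .
qed

lemma measurable_quantile:
  assumes "\<kappa> \<in> M \<rightarrow>\<^sub>M prob_algebra borel" "f \<in> borel_measurable M"
  shows "(\<lambda>z. quantile (\<kappa> z) (f z)) \<in> borel_measurable M"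
  using measurable_compose[OF measurable_Pair[OF assms] measurable_quantile_pair] by simp

lemma measurable_quantile_level:
  assumes "real_distribution \<eta>"
  shows "quantile \<eta> \<in> borel_measurable borel"
  by (rule measurable_quantile[of "\<lambda>_. \<eta>" borel "\<lambda>u. u"]) (use assms in \<open>simp_all add: real_distribution_iff\<close>)

lemma quantile_mono:
  assumes "real_distribution \<eta>" "0 < u" "u \<le> w" "w < 1"
  shows "quantile \<eta> u \<le> quantile \<eta> w"
  using quantile_le_iff[OF assms(1), of w "quantile \<eta> w"] quantile_le_iff[OF assms(1), of u "quantile \<eta> w"] assms
  by auto

lemma distr_unif_quantile:
  assumes "real_distribution \<eta>"
  shows "distr unif borel (quantile \<eta>) = \<eta>"
proof (rule cdf_unique)
  interpret real_distribution \<eta> by fact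
  interpret U: prob_space unif by (rule prob_space_unif)
  have [measurable]: "quantile \<eta> \<in> borel_measurable borel" by (rule measurable_quantile_level) fact
  show "real_distribution (distr unif borel (quantile \<eta>))" by (rule U.real_distribution_distr) simp
  show "cdf (distr unif borel (quantile \<eta>)) = cdf \<eta>"
  proof
    fix x
    have "emeasure (distr unif borel (quantile \<eta>)) {..x} = emeasure unif {u. quantile \<eta> u \<le> x}"
      by (simp add: emeasure_distr vimage_def del: emeasure_uniform_measure)
    also have "\<dots> = emeasure unif {..cdf \<eta> x}"
      by (rule emeasure_eq_AE, use AE_unif in eventually_elim) (auto simp: quantile_le_iff[OF assms])
    also have "\<dots> = emeasure lborel ({0..1} \<inter> {..cdf \<eta> x})"
      by (simp add: divide_ennreal_def)
    also have "{0..1} \<inter> {..cdf \<eta> x} = {0..cdf \<eta> x}"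
      using cdf_bounded_prob[of x] by auto
    also have "emeasure lborel {0..cdf \<eta> x} = ennreal (cdf \<eta> x)"
      using cdf_nonneg[of x] by simp
    finally show "cdf (distr unif borel (quantile \<eta>)) x = cdf \<eta> x"
      using cdf_nonneg[of x] by (simp add: cdf_def measure_def)
  qed
qed fact

text \<open>
  In general the distribution function at a quantile is at least the level; it cannot jump above it
  where it is continuous.
\<close>

lemma cdf_quantile_atomless:
  assumes "real_distribution \<eta>" "atomless \<eta>" "0 < u" "u < 1"
  shows "cdf \<eta> (quantile \<eta> u) = u"
proof (rule antisym)
  interpret real_distribution \<eta> by fact
  let ?q = "quantile \<eta> u"
  show "u \<le> cdf \<eta> ?q" using quantile_le_iff[OF assms(1,3,4), of ?q] by simp
  have "isCont (cdf \<eta>) ?q" using assms(2) by (simp add: isCont_cdf atomless_def)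
  then have "(cdf \<eta> \<longlongrightarrow> cdf \<eta> ?q) (at_left ?q)"
    by (simp add: isCont_def filterlim_at_split)
  moreover have "eventually (\<lambda>x. cdf \<eta> x \<le> u) (at_left ?q)"
    unfolding eventually_at_filter
  proof (intro always_eventually allI impI)
    fix x assume "x \<in> {..<?q}"
    then have "\<not> u \<le> cdf \<eta> x" using quantile_le_iff[OF assms(1,3,4), of x] by simp
    then show "cdf \<eta> x \<le> u" by simp
  qed
  ultimately show "cdf \<eta> ?q \<le> u" by (intro tendsto_upperbound) auto
qed

section \<open>Optimality of the monotone coupling on the line\<close>

lemma measurable_swap[measurable]: "prod.swap \<in> M \<Otimes>\<^sub>M N \<rightarrow>\<^sub>M N \<Otimes>\<^sub>M M"
proof -
  have e: "prod.swap = (\<lambda>p. (snd p, fst p))" by (auto simp: prod.swap_def)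
  show ?thesis unfolding e by measurable
qed

definition line_coupling :: "real measure \<Rightarrow> real measure \<Rightarrow> (real \<times> real) measure \<Rightarrow> bool" where
  "line_coupling a b J \<longleftrightarrow> J \<in> space (prob_algebra (borel \<Otimes>\<^sub>M borel)) \<and>
     distr J borel fst = a \<and> distr J borel snd = b"

lemma line_couplingD:
  assumes "line_coupling a b J"
  shows "prob_space J" "sets J = sets (borel \<Otimes>\<^sub>M borel)" "space J = UNIV"
    "real_distribution a" "real_distribution b"
proof -
  show *: "prob_space J" and s: "sets J = sets (borel \<Otimes>\<^sub>M borel)"
    using assms by (auto simp: line_coupling_def space_prob_algebra)
  from sets_eq_imp_space_eq[OF s] show "space J = UNIV" by (simp add: space_pair_measure)
  note [measurable_cong] = s
  interpret prob_space J by fact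
  show "real_distribution a" "real_distribution b"
    using assms by (auto simp: line_coupling_def)
qed

lemma line_coupling_swap:
  assumes "line_coupling a b J"
  shows "line_coupling b a (distr J (borel \<Otimes>\<^sub>M borel) prod.swap)"
proof -
  note [measurable_cong] = line_couplingD(2)[OF assms]
  show ?thesis
    using assms prob_space.prob_space_distr[OF line_couplingD(1)[OF assms], of prod.swap]
    by (auto simp: line_coupling_def space_prob_algebra distr_distr comp_def)
qed

text \<open>
  The Frechet bounds: an intersection has at least the probability \<open>0\<close> and at least the sum of the
  two probabilities minus \<open>1\<close>, and one of the two bounds is attained when the events are disjoint or
  cover the space.
\<close>

lemma prob_inter_le_of_nested:
  assumes "prob_space P" "prob_space Q"
    and [measurable]: "A \<in> sets P" "B \<in> sets P" "A' \<in> sets Q" "B' \<in> sets Q"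
    and eq: "measure P A = measure Q A'" "measure P B = measure Q B'"
    and nested: "A \<inter> B = {} \<or> space P \<subseteq> A \<union> B"
  shows "measure P (A \<inter> B) \<le> measure Q (A' \<inter> B')"
proof -
  interpret P: prob_space P by fact
  interpret Q: prob_space Q by fact
  from nested show ?thesis
  proof
    assume "space P \<subseteq> A \<union> B"
    then have "A \<union> B = space P" using sets.sets_into_space[of A P] sets.sets_into_space[of B P] by auto
    then have "measure P A + measure P B = 1 + measure P (A \<inter> B)"
      using P.finite_measure_Union'[of A B] P.finite_measure_Diff'[of B A] P.prob_space by (simp add: Int_commute)
    moreover have "measure Q A' + measure Q B' = measure Q (A' \<union> B') + measure Q (A' \<inter> B')"
      using Q.finite_measure_Union'[of A' B'] Q.finite_measure_Diff'[of B' A'] by (simp add: Int_commute)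
    moreover have "measure Q (A' \<union> B') \<le> 1" by simp
    ultimately show ?thesis using eq by linarith
  qed simp
qed

text \<open>
  In terms of the uniform level, the event that the first quantile is at least \<open>v\<close> is an up-set and the
  event that the second one lies in the down-set \<open>D\<close> is a down-set. An up-set and a down-set of a
  linear order are disjoint or cover it, so the monotone coupling attains the Frechet bound.
\<close>

lemma monotone_coupling_corner:
  assumes J: "line_coupling a b J" and D[measurable]: "D \<in> sets borel"
    and down: "\<And>x y. x \<le> y \<Longrightarrow> y \<in> D \<Longrightarrow> x \<in> D"
  shows "emeasure unif {u. v \<le> quantile a u \<and> quantile b u \<in> D} \<le> emeasure J {p. v \<le> fst p \<and> snd p \<in> D}"
proof -
  interpret U: prob_space unif by (rule prob_space_unif)
  interpret J: prob_space J by (rule line_couplingD(1)[OF J])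
  note J_sets[measurable_cong] = line_couplingD(2)[OF J]
  note sp = line_couplingD(3)[OF J]
  note ab = line_couplingD(4,5)[OF J]
  have m[measurable]: "quantile a \<in> borel_measurable borel" "quantile b \<in> borel_measurable borel"
    by (rule measurable_quantile_level, fact ab)+
  \<comment> \<open>The levels outside \<open>(0, 1)\<close>, a null set, go to \<open>?B\<close> so that the two sets are nested on the whole line.\<close>
  let ?A = "{u. (0 < u \<and> u < 1) \<and> v \<le> quantile a u}" and ?B = "{u. \<not> (0 < u \<and> u < 1) \<or> quantile b u \<in> D}"
  have J1: "measure a {v..} = measure J {p. v \<le> fst p}"
    using J sp by (subst (asm) line_coupling_def) (auto simp: measure_distr vimage_def)
  have J2: "measure b D = measure J {p. snd p \<in> D}"
    using J sp by (subst (asm) line_coupling_def) (auto simp: measure_distr vimage_def)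
  have 1: "measure unif ?A = measure J {p. v \<le> fst p}"
  proof -
    have "measure unif ?A = measure unif {u. v \<le> quantile a u}"
      by (rule U.finite_measure_eq_AE, use AE_unif in eventually_elim) auto
    also have "\<dots> = measure (distr unif borel (quantile a)) {v..}"
      by (subst measure_distr) (auto simp: vimage_def)
    finally show ?thesis by (simp add: distr_unif_quantile ab J1)
  qed
  have 2: "measure unif ?B = measure J {p. snd p \<in> D}"
  proof -
    have "measure unif ?B = measure unif {u. quantile b u \<in> D}"
      by (rule U.finite_measure_eq_AE, use AE_unif in eventually_elim) auto
    also have "\<dots> = measure (distr unif borel (quantile b)) D"
      by (subst measure_distr) (auto simp: vimage_def)
    finally show ?thesis by (simp add: distr_unif_quantile ab J2)
  qed
  have "measure unif (?A \<inter> ?B) \<le> measure J ({p. v \<le> fst p} \<inter> {p. snd p \<in> D})"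
  proof (rule prob_inter_le_of_nested[OF U.prob_space_axioms J.prob_space_axioms _ _ _ _ 1 2])
    have "{p \<in> space J. v \<le> fst p} \<in> sets J" "{p \<in> space J. snd p \<in> D} \<in> sets J" by measurable
    then show "{p. v \<le> fst p} \<in> sets J" "{p. snd p \<in> D} \<in> sets J" by (simp_all add: sp)
    show "?A \<inter> ?B = {} \<or> space unif \<subseteq> ?A \<union> ?B"
    proof (rule disjCI)
      assume "\<not> space unif \<subseteq> ?A \<union> ?B"
      then obtain w where w: "0 < w" "w < 1" "\<not> v \<le> quantile a w" "quantile b w \<notin> D" by auto
      show "?A \<inter> ?B = {}"
      proof (safe, simp)
        fix u assume u: "0 < u" "u < 1" "v \<le> quantile a u" "quantile b u \<in> D"
        show False
        proof (cases "u \<le> w")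
          case True
          from quantile_mono[OF ab(1) u(1) True w(2)] u w show False by simp
        next
          case False
          from quantile_mono[OF ab(2) w(1) _ u(2)] False down u(4) w(4) show False by force
        qed
      qed
    qed
  qed measurable
  also have "{p. v \<le> fst p} \<inter> {p. snd p \<in> D} = {p. v \<le> fst p \<and> snd p \<in> D}" by auto
  also have "measure unif (?A \<inter> ?B) = measure unif {u. v \<le> quantile a u \<and> quantile b u \<in> D}"
    by (rule U.finite_measure_eq_AE, use AE_unif in eventually_elim) auto
  finally show ?thesis by (simp add: U.emeasure_eq_measure J.emeasure_eq_measure)
qed

text \<open>Both sides are the measure of the region under the graph of \<open>w\<close>.\<close>

lemma nn_integral_layer_cake:
  assumes "sigma_finite_measure M" and [measurable]: "w \<in> borel_measurable M"
  shows "(\<integral>\<^sup>+z. ennreal (w z) \<partial>M) = (\<integral>\<^sup>+s. emeasure M {z\<in>space M. s < w z} * indicator {0..} s \<partial>lborel)"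
proof -
  interpret M: sigma_finite_measure M by fact
  interpret P: pair_sigma_finite M lborel by unfold_locales
  have "(\<integral>\<^sup>+z. ennreal (w z) \<partial>M) = (\<integral>\<^sup>+z. \<integral>\<^sup>+s. (if 0 \<le> s \<and> s < w z then 1 else 0) \<partial>lborel \<partial>M)"
  proof (rule nn_integral_cong)
    fix z assume "z \<in> space M"
    then have "(\<integral>\<^sup>+s. (if 0 \<le> s \<and> s < w z then 1 else 0) \<partial>lborel) =
        (\<integral>\<^sup>+s. indicator {0..<w z} s \<partial>lborel)"
      by (intro nn_integral_cong) (auto simp: indicator_def)
    also have "\<dots> = ennreal (w z)"
      by (cases "0 \<le> w z") (auto simp: ennreal_neg)
    finally show "ennreal (w z) = (\<integral>\<^sup>+s. (if 0 \<le> s \<and> s < w z then 1 else 0) \<partial>lborel)" by simp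
  qed
  also have "\<dots> = (\<integral>\<^sup>+s. \<integral>\<^sup>+z. (if 0 \<le> s \<and> s < w z then 1 else 0) \<partial>M \<partial>lborel)"
    by (rule P.Fubini'[symmetric]) measurable
  also have "\<dots> = (\<integral>\<^sup>+s. emeasure M {z\<in>space M. s < w z} * indicator {0..} s \<partial>lborel)"
  proof (rule nn_integral_cong)
    fix s :: real
    have "(\<integral>\<^sup>+z. (if 0 \<le> s \<and> s < w z then 1 else 0) \<partial>M) =
       (\<integral>\<^sup>+z. indicator {0..} s * indicator {z\<in>space M. s < w z} z \<partial>M)"
      by (intro nn_integral_cong) (auto simp: indicator_def)
    then show "(\<integral>\<^sup>+z. (if 0 \<le> s \<and> s < w z then 1 else 0) \<partial>M) = emeasure M {z\<in>space M. s < w z} * indicator {0..} s"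
      by (simp add: nn_integral_cmult mult.commute)
  qed
  finally show ?thesis .
qed

text \<open>
  Superlevel sets of an antitone function are down-sets, so this is the corner case integrated over
  the levels of \<open>\<phi>\<close>.
\<close>

lemma monotone_coupling_step:
  assumes J: "line_coupling a b J" and \<phi>: "antimono \<phi>" "\<And>y. 0 \<le> \<phi> y"
  shows "(\<integral>\<^sup>+u. ennreal (indicator {v..} (quantile a u) * \<phi> (quantile b u)) \<partial>unif)
    \<le> (\<integral>\<^sup>+p. ennreal (indicator {v..} (fst p) * \<phi> (snd p)) \<partial>J)"
proof -
  interpret U: prob_space unif by (rule prob_space_unif)
  interpret J: prob_space J by (rule line_couplingD(1)[OF J])
  note J_sets[measurable_cong] = line_couplingD(2)[OF J]
  note sp = line_couplingD(3)[OF J]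
  note ab = line_couplingD(4,5)[OF J]
  have m[measurable]: "quantile a \<in> borel_measurable borel" "quantile b \<in> borel_measurable borel"
    by (rule measurable_quantile_level, fact ab)+
  have "mono (\<lambda>y. - \<phi> y)" using \<phi>(1) by (auto simp: mono_def antimono_def)
  then have "(\<lambda>y. - \<phi> y) \<in> borel_measurable borel" by (rule borel_measurable_mono)
  then have \<phi>_meas[measurable]: "\<phi> \<in> borel_measurable borel" by simp
  show ?thesis
  proof (subst (1 2) nn_integral_layer_cake)
    show "(\<integral>\<^sup>+s. emeasure unif {u \<in> space unif. s < indicator {v..} (quantile a u) * \<phi> (quantile b u)} * indicator {0..} s \<partial>lborel)
      \<le> (\<integral>\<^sup>+s. emeasure J {p \<in> space J. s < indicator {v..} (fst p) * \<phi> (snd p)} * indicator {0..} s \<partial>lborel)"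
    proof (rule nn_integral_mono)
      fix s :: real
      have "emeasure unif {u. v \<le> quantile a u \<and> quantile b u \<in> {y. s < \<phi> y}}
        \<le> emeasure J {p. v \<le> fst p \<and> snd p \<in> {y. s < \<phi> y}}"
        by (rule monotone_coupling_corner[OF J]) (use \<phi>(1) in \<open>auto simp: antimono_def intro: less_le_trans\<close>)
      moreover have "{u \<in> space unif. s < indicator {v..} (quantile a u) * \<phi> (quantile b u)} =
         {u. v \<le> quantile a u \<and> quantile b u \<in> {y. s < \<phi> y}}" if "0 \<le> s"
        using that by (auto simp: indicator_def split: if_splits)
      moreover have "{p \<in> space J. s < indicator {v..} (fst p) * \<phi> (snd p)} =
         {p. v \<le> fst p \<and> snd p \<in> {y. s < \<phi> y}}" if "0 \<le> s"
        using that by (auto simp: indicator_def sp split: if_splits)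
      ultimately show "emeasure unif {u \<in> space unif. s < indicator {v..} (quantile a u) * \<phi> (quantile b u)} * indicator {0..} s
         \<le> emeasure J {p \<in> space J. s < indicator {v..} (fst p) * \<phi> (snd p)} * indicator {0..} s"
        by (cases "0 \<le> s") auto
    qed
  qed (auto intro: prob_space_imp_sigma_finite prob_space_unif J.prob_space_axioms)
qed

text \<open>
  The part of convexity which the approximation argument uses. Unlike convexity itself it is easily
  seen to survive when a function is made constant on one side of its minimum.
\<close>

definition increasing_increments :: "(real \<Rightarrow> real) \<Rightarrow> bool" where
  "increasing_increments f \<longleftrightarrow> (\<forall>s t d. s \<le> t \<longrightarrow> 0 \<le> d \<longrightarrow> f (s + d) - f s \<le> f (t + d) - f t)"

lemma increasing_incrementsD:
  "increasing_increments f \<Longrightarrow> s \<le> t \<Longrightarrow> 0 \<le> d \<Longrightarrow> f (s + d) - f s \<le> f (t + d) - f t"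
  by (auto simp: increasing_increments_def)

lemma increasing_increments_reflect:
  assumes "increasing_increments f" shows "increasing_increments (\<lambda>z. f (- z))"
  unfolding increasing_increments_def
proof (intro allI impI)
  fix s t d :: real assume "s \<le> t" "0 \<le> d"
  then show "f (- (s + d)) - f (- s) \<le> f (- (t + d)) - f (- t)"
    using increasing_incrementsD[OF assms, of "- t - d" "- s - d" d] by simp
qed

lemma convex_increasing_increments:
  assumes "convex_on UNIV (h :: real \<Rightarrow> real)" shows "increasing_increments h"
  unfolding increasing_increments_def
proof (intro allI impI)
  fix s t d :: real assume st: "s \<le> t" and d: "0 \<le> d"
  show "h (s + d) - h s \<le> h (t + d) - h t"
  proof (cases "t - s + d = 0")
    case True then show ?thesis using st d by (smt (verit))
  next
    case False
    then have pos: "0 < t - s + d" using st d by linarith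
    \<comment> \<open>Both inner points \<open>s + d\<close> and \<open>t\<close> lie between \<open>s\<close> and \<open>t + d\<close>, with complementary weights.\<close>
    define r where "r = d / (t - s + d)"
    have l: "0 \<le> r" "r \<le> 1" using st d pos by (auto simp: r_def divide_simps)
    have "r * (t - s + d) = d" using pos by (simp add: r_def)
    then have e1: "(1 - r) *\<^sub>R s + r *\<^sub>R (t + d) = s + d" and e2: "(1 - r) *\<^sub>R (t + d) + r *\<^sub>R s = t"
      by (simp_all add: algebra_simps)
    have "h (s + d) \<le> (1 - r) * h s + r * h (t + d)"
      using convex_onD[OF assms, of r s "t + d"] l e1 by simp
    moreover have "h t \<le> (1 - r) * h (t + d) + r * h s"
      using convex_onD[OF assms, of r "t + d" s] l e2 by simp
    ultimately show ?thesis by (simp add: algebra_simps)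
  qed
qed

text \<open>
  The sum approximates \<open>f (x - y)\<close>, up to the constant limit of \<open>f\<close> at \<open>-\<infinity>\<close>, by products of an
  indicator \<open>v \<le> x\<close> and a function of \<open>y\<close>. Only the grid points up to \<open>x\<close> contribute, which makes it
  telescope.
\<close>

lemma grid_sum_telescope:
  fixes f :: "real \<Rightarrow> real" and n K :: nat
  defines "v \<equiv> \<lambda>j. real j / real (Suc n) - real (Suc n)"
    and "k \<equiv> \<lambda>x. nat \<lfloor>real (Suc n) * (x + real (Suc n))\<rfloor>"
  shows "(\<Sum>j<K. indicator {v (Suc j)..} x * (f (v (Suc j) - y) - f (v j - y))) =
    f (v (min K (k x)) - y) - f (- real (Suc n) - y)"
proof -
  have iff: "v (Suc j) \<le> x \<longleftrightarrow> j < k x" for j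
  proof -
    have "v (Suc j) \<le> x \<longleftrightarrow> real (Suc j) \<le> real (Suc n) * (x + real (Suc n))"
      unfolding v_def by (simp add: field_simps)
    also have "\<dots> \<longleftrightarrow> int (Suc j) \<le> \<lfloor>real (Suc n) * (x + real (Suc n))\<rfloor>"
      by (simp add: le_floor_iff)
    also have "\<dots> \<longleftrightarrow> j < k x" unfolding k_def by linarith
    finally show ?thesis .
  qed
  have "(\<Sum>j<K. indicator {v (Suc j)..} x * (f (v (Suc j) - y) - f (v j - y))) =
    (\<Sum>j<K. if j < k x then f (v (Suc j) - y) - f (v j - y) else 0)"
    by (intro sum.cong) (auto simp: indicator_def iff)
  also have "\<dots> = (\<Sum>j\<in>{..<min K (k x)}. f (v (Suc j) - y) - f (v j - y))"
    by (subst sum.inter_filter[symmetric]) (auto intro!: sum.cong)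
  also have "\<dots> = f (v (min K (k x)) - y) - f (v 0 - y)"
    by (rule sum_lessThan_telescope)
  finally show ?thesis by (simp add: v_def)
qed

text \<open>
  Each term of the grid sum is the indicator of \<open>v \<le> x\<close> times an increment of \<open>f\<close> that is nonnegative,
  as \<open>f\<close> is monotone, and antitone in \<open>y\<close>, as \<open>f\<close> has increasing increments. The grid sums stay below
  \<open>f (x - y) - i\<close> and converge to it, so Fatou's lemma passes the inequality to the limit.
\<close>

lemma monotone_coupling_optimal_mono:
  assumes J: "line_coupling a b J" and f: "mono f" "increasing_increments f" "continuous_on UNIV f"
    and lim: "(f \<longlongrightarrow> i) at_bot"
  shows "(\<integral>\<^sup>+u. ennreal (f (quantile a u - quantile b u) - i) \<partial>unif)
    \<le> (\<integral>\<^sup>+p. ennreal (f (fst p - snd p) - i) \<partial>J)"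
proof -
  interpret U: prob_space unif by (rule prob_space_unif)
  interpret J: prob_space J by (rule line_couplingD(1)[OF J])
  note J_sets[measurable_cong] = line_couplingD(2)[OF J]
  note ab = line_couplingD(4,5)[OF J]
  have m[measurable]: "quantile a \<in> borel_measurable borel" "quantile b \<in> borel_measurable borel"
    by (rule measurable_quantile_level, fact ab)+
  have [measurable]: "f \<in> borel_measurable borel" by (rule borel_measurable_mono) fact
  have ge: "i \<le> f z" for z
  proof (rule tendsto_upperbound[OF lim])
    show "eventually (\<lambda>x. f x \<le> f z) at_bot"
      using eventually_le_at_bot[of z] by eventually_elim (use f(1) in \<open>auto simp: mono_def\<close>)
  qed simp
  \<comment> \<open>A grid of mesh \<open>1 / (n + 1)\<close> that covers the interval from \<open>- (n + 1)\<close> to \<open>n + 1\<close>.\<close>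
  define v where "v n j = real j / real (Suc n) - real (Suc n)" for n j :: nat
  define \<phi> where "\<phi> n j y = f (v n (Suc j) - y) - f (v n j - y)" for n j y
  define W where "W n x y = (\<Sum>j<2 * (Suc n)\<^sup>2. indicator {v n (Suc j)..} x * \<phi> n j y)" for n x y
  define k where "k n x = nat \<lfloor>real (Suc n) * (x + real (Suc n))\<rfloor>" for n x
  have v_mono: "v n j \<le> v n (Suc j)" for n j by (simp add: v_def divide_right_mono)
  have \<phi>0: "0 \<le> \<phi> n j y" for n j y
    using f(1) v_mono[of n j] by (auto simp: \<phi>_def mono_def)
  have \<phi>_anti: "antimono (\<phi> n j)" for n j
  proof (rule antimonoI)
    fix x y :: real assume "x \<le> y"
    then show "\<phi> n j y \<le> \<phi> n j x"
      using increasing_incrementsD[OF f(2), of "v n j - y" "v n j - x" "v n (Suc j) - v n j"] v_mono[of n j]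
      by (simp add: \<phi>_def)
  qed
  have \<phi>m[measurable]: "\<phi> n j \<in> borel_measurable borel" for n j unfolding \<phi>_def by measurable
  have W_eq: "W n x y = f (v n (min (2 * (Suc n)\<^sup>2) (k n x)) - y) - f (- real (Suc n) - y)" for n x y
    unfolding W_def \<phi>_def v_def k_def by (rule grid_sum_telescope)
  have W_le: "W n x y \<le> f (x - y) - i" for n x y
  proof (cases "k n x = 0")
    case True
    then have "W n x y = 0" unfolding W_eq by (simp add: v_def)
    with ge[of "x - y"] show ?thesis by simp
  next
    case False
    have "v n (min (2 * (Suc n)\<^sup>2) (k n x)) \<le> real (k n x) / real (Suc n) - real (Suc n)"
      unfolding v_def by (intro diff_right_mono divide_right_mono) auto
    also have "\<dots> \<le> x"
    proof -
      have "real (k n x) \<le> real (Suc n) * (x + real (Suc n))"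
        using False unfolding k_def by (simp add: of_nat_nat)
      then show ?thesis by (simp add: field_simps)
    qed
    finally have "f (v n (min (2 * (Suc n)\<^sup>2) (k n x)) - y) \<le> f (x - y)" using f(1) by (auto simp: mono_def)
    with ge[of "- real (Suc n) - y"] show ?thesis unfolding W_eq by simp
  qed
  have W_lim: "(\<lambda>n. W n x y) \<longlonglongrightarrow> f (x - y) - i" for x y
  proof -
    have ev: "eventually (\<lambda>n. \<bar>x\<bar> \<le> real (Suc n)) sequentially"
    proof -
      obtain N :: nat where "\<bar>x\<bar> \<le> real N" using real_arch_simple by blast
      then show ?thesis unfolding eventually_sequentially by (intro exI[of _ N]) auto
    qed
    have "(\<lambda>n. v n (min (2 * (Suc n)\<^sup>2) (k n x))) \<longlonglongrightarrow> x"
    proof (rule tendsto_sandwich)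
      have ev2: "eventually (\<lambda>n. x - 1 / real (Suc n) \<le> v n (min (2 * (Suc n)\<^sup>2) (k n x)) \<and>
           v n (min (2 * (Suc n)\<^sup>2) (k n x)) \<le> x) sequentially"
        using ev
      proof eventually_elim
        case (elim n)
        define N where "N = real (Suc n)"
        have N: "0 < N" "\<bar>x\<bar> \<le> N" using elim by (auto simp: N_def)
        have z: "0 \<le> N * (x + N)" using N by (intro mult_nonneg_nonneg) auto
        have "N * (x + N) \<le> N * (N + N)" using N by (intro mult_left_mono) auto
        also have "\<dots> = real (2 * (Suc n)\<^sup>2)" by (simp add: N_def power2_eq_square algebra_simps)
        finally have "N * (x + N) \<le> real (2 * (Suc n)\<^sup>2)" .
        moreover have rk: "real (k n x) = of_int \<lfloor>N * (x + N)\<rfloor>" using z by (simp add: k_def N_def)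
        ultimately have "real (k n x) \<le> real (2 * (Suc n)\<^sup>2)" by linarith
        then have "min (2 * (Suc n)\<^sup>2) (k n x) = k n x" by (simp only: of_nat_le_iff min_absorb2)
        moreover have "real (k n x) \<le> N * (x + N)" "N * (x + N) - 1 \<le> real (k n x)" using rk by linarith+
        then have "real (k n x) / N \<le> x + N" "x + N - 1 / N \<le> real (k n x) / N"
          using N(1) by (simp_all add: pos_divide_le_eq pos_le_divide_eq mult.commute right_diff_distrib)
        then have "real (k n x) / N - N \<le> x" "x - 1 / N \<le> real (k n x) / N - N" by linarith+
        ultimately show ?case by (simp add: v_def N_def)
      qed
      show "eventually (\<lambda>n. x - 1 / real (Suc n) \<le> v n (min (2 * (Suc n)\<^sup>2) (k n x))) sequentially"
        and "eventually (\<lambda>n. v n (min (2 * (Suc n)\<^sup>2) (k n x)) \<le> x) sequentially"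
        using ev2 by (auto elim: eventually_mono)
      show "(\<lambda>n. x - 1 / real (Suc n)) \<longlonglongrightarrow> x"
        using tendsto_diff[OF tendsto_const LIMSEQ_inverse_real_of_nat, of x] by (simp add: inverse_eq_divide)
    qed simp
    then have "(\<lambda>n. v n (min (2 * (Suc n)\<^sup>2) (k n x)) - y) \<longlonglongrightarrow> x - y" by (intro tendsto_intros)
    then have "(\<lambda>n. f (v n (min (2 * (Suc n)\<^sup>2) (k n x)) - y)) \<longlonglongrightarrow> f (x - y)"
      using f(3) by (intro isCont_tendsto_compose[of _ f]) (auto simp: continuous_on_eq_continuous_at)
    moreover have "filterlim (\<lambda>n. - real (Suc n) - y) at_bot sequentially"
    proof -
      have "filterlim (\<lambda>n. real n + (1 + y)) at_top sequentially"
        by (rule filterlim_tendsto_add_at_top[OF tendsto_const filterlim_real_sequentially, of "1 + y", simplified add.commute])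
      then show ?thesis by (simp add: filterlim_uminus_at_top algebra_simps)
    qed
    then have "(\<lambda>n. f (- real (Suc n) - y)) \<longlonglongrightarrow> i" by (rule filterlim_compose[OF lim])
    ultimately show ?thesis unfolding W_eq by (intro tendsto_diff)
  qed
  have W_meas[measurable]: "(\<lambda>p. W n (fst p) (snd p)) \<in> borel_measurable (borel \<Otimes>\<^sub>M borel)" for n
    unfolding W_def by measurable
  have W_int: "(\<integral>\<^sup>+u. ennreal (W n (quantile a u) (quantile b u)) \<partial>unif) \<le> (\<integral>\<^sup>+p. ennreal (W n (fst p) (snd p)) \<partial>J)" for n
  proof -
    have "(\<integral>\<^sup>+u. ennreal (W n (quantile a u) (quantile b u)) \<partial>unif) =
      (\<integral>\<^sup>+u. (\<Sum>j<2 * (Suc n)\<^sup>2. ennreal (indicator {v n (Suc j)..} (quantile a u) * \<phi> n j (quantile b u))) \<partial>unif)"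
      unfolding W_def using \<phi>0 by (subst sum_ennreal) auto
    also have "\<dots> = (\<Sum>j<2 * (Suc n)\<^sup>2. \<integral>\<^sup>+u. ennreal (indicator {v n (Suc j)..} (quantile a u) * \<phi> n j (quantile b u)) \<partial>unif)"
      by (rule nn_integral_sum) measurable
    also have "\<dots> \<le> (\<Sum>j<2 * (Suc n)\<^sup>2. \<integral>\<^sup>+p. ennreal (indicator {v n (Suc j)..} (fst p) * \<phi> n j (snd p)) \<partial>J)"
      by (intro sum_mono monotone_coupling_step[OF J \<phi>_anti \<phi>0])
    also have "\<dots> = (\<integral>\<^sup>+p. (\<Sum>j<2 * (Suc n)\<^sup>2. ennreal (indicator {v n (Suc j)..} (fst p) * \<phi> n j (snd p))) \<partial>J)"
      by (rule nn_integral_sum[symmetric]) measurable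
    also have "\<dots> = (\<integral>\<^sup>+p. ennreal (W n (fst p) (snd p)) \<partial>J)"
      unfolding W_def using \<phi>0 by (subst sum_ennreal) auto
    finally show ?thesis .
  qed
  have "(\<integral>\<^sup>+u. ennreal (f (quantile a u - quantile b u) - i) \<partial>unif) =
     (\<integral>\<^sup>+u. liminf (\<lambda>n. ennreal (W n (quantile a u) (quantile b u))) \<partial>unif)"
    by (intro nn_integral_cong lim_imp_Liminf[symmetric] tendsto_ennrealI W_lim) simp
  also have "\<dots> \<le> liminf (\<lambda>n. \<integral>\<^sup>+u. ennreal (W n (quantile a u) (quantile b u)) \<partial>unif)"
  proof (rule nn_integral_liminf)
    fix n
    have "(\<lambda>u. (quantile a u, quantile b u)) \<in> unif \<rightarrow>\<^sub>M borel \<Otimes>\<^sub>M borel" by measurable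
    from measurable_compose[OF this W_meas[of n]]
    show "(\<lambda>u. ennreal (W n (quantile a u) (quantile b u))) \<in> borel_measurable unif" by simp
  qed
  also have "\<dots> \<le> (\<integral>\<^sup>+p. ennreal (f (fst p - snd p) - i) \<partial>J)"
    by (rule Liminf_le)
      (auto intro!: always_eventually order_trans[OF W_int] nn_integral_mono ennreal_leI W_le)
  finally show ?thesis .
qed

text \<open>Exchanging the two marginals reflects \<open>f\<close> and turns it into a monotone function.\<close>

lemma monotone_coupling_optimal_antimono:
  assumes J: "line_coupling a b J" and f: "antimono f" "increasing_increments f" "continuous_on UNIV f"
    and lim: "(f \<longlongrightarrow> i) at_top"
  shows "(\<integral>\<^sup>+u. ennreal (f (quantile a u - quantile b u) - i) \<partial>unif)
    \<le> (\<integral>\<^sup>+p. ennreal (f (fst p - snd p) - i) \<partial>J)"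
proof -
  let ?J = "distr J (borel \<Otimes>\<^sub>M borel) prod.swap"
  note J_sets[measurable_cong] = line_couplingD(2)[OF J]
  have [measurable]: "f \<in> borel_measurable borel" by (rule borel_measurable_continuous_onI) fact
  have "(\<integral>\<^sup>+u. ennreal (f (- (quantile b u - quantile a u)) - i) \<partial>unif)
    \<le> (\<integral>\<^sup>+p. ennreal (f (- (fst p - snd p)) - i) \<partial>?J)"
  proof (rule monotone_coupling_optimal_mono[OF line_coupling_swap[OF J]])
    show "mono (\<lambda>z. f (- z))" using f(1) by (auto simp: mono_def antimono_def)
    show "increasing_increments (\<lambda>z. f (- z))" by (rule increasing_increments_reflect) fact
    show "continuous_on UNIV (\<lambda>z. f (- z))"
      by (rule continuous_on_compose2[OF f(3)]) (auto intro: continuous_intros)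
    show "((\<lambda>z. f (- z)) \<longlongrightarrow> i) at_bot"
      by (rule filterlim_compose[OF lim filterlim_uminus_at_top_at_bot])
  qed
  also have "\<dots> = (\<integral>\<^sup>+p. ennreal (f (fst p - snd p) - i) \<partial>J)"
    by (subst nn_integral_distr) simp_all
  finally show ?thesis by simp
qed

lemma mono_tendsto_Inf_at_bot:
  fixes h :: "real \<Rightarrow> real"
  assumes "mono h" "\<And>z. m \<le> h z"
  shows "(h \<longlongrightarrow> Inf (range h)) at_bot" "m \<le> Inf (range h)"
proof -
  have bdd: "bdd_below (range h)" using assms(2) by (auto intro!: bdd_belowI2[of _ m])
  show "m \<le> Inf (range h)" using assms(2) by (auto intro!: cInf_greatest)
  show "(h \<longlongrightarrow> Inf (range h)) at_bot"
  proof (rule order_tendstoI)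
    fix c assume "c < Inf (range h)"
    then have "c < h z" for z by (rule less_le_trans) (auto intro: cInf_lower bdd)
    then show "eventually (\<lambda>z. c < h z) at_bot" by simp
  next
    fix c assume "Inf (range h) < c"
    then obtain z where z: "h z < c" using cInf_less_iff[OF _ bdd] by auto
    show "eventually (\<lambda>z. h z < c) at_bot"
      using eventually_le_at_bot[of z] by eventually_elim (use assms(1) z in \<open>auto simp: mono_def intro: le_less_trans\<close>)
  qed
qed

lemma increasing_part:
  assumes h: "increasing_increments h" "continuous_on UNIV h" and min: "\<And>z. h z0 \<le> h z"
  defines "f \<equiv> \<lambda>z. h (max z z0) - h z0"
  shows "mono f" "increasing_increments f" "continuous_on UNIV f" "(f \<longlongrightarrow> 0) at_bot" "\<And>z. 0 \<le> f z"
proof -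
  have right: "h x \<le> h y" if "z0 \<le> x" "x \<le> y" for x y
    using increasing_incrementsD[OF h(1), of z0 x "y - x"] min[of "z0 + (y - x)"] that by simp
  show mf: "mono f" unfolding f_def by (intro monoI) (auto intro!: right simp: max_def)
  show f0: "0 \<le> f z" for z unfolding f_def using min by simp
  show "continuous_on UNIV f"
    unfolding f_def by (intro continuous_intros continuous_on_compose2[OF h(2)]) auto
  have "eventually (\<lambda>z. f z = 0) at_bot"
    using eventually_le_at_bot[of z0] by eventually_elim (simp add: f_def)
  then show "(f \<longlongrightarrow> 0) at_bot" by (rule tendsto_eventually)
  show "increasing_increments f"
    unfolding increasing_increments_def
  proof (intro allI impI)
    fix s t d :: real assume st: "s \<le> t" and d: "0 \<le> d"
    have le0: "f z = 0" if "z \<le> z0" for z using that by (simp add: f_def)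
    have ge0: "f z = h z - h z0" if "z0 \<le> z" for z using that by (simp add: f_def max_absorb1)
    have mono: "f x \<le> f y" if "x \<le> y" for x y using mf that by (auto simp: mono_def)
    consider "z0 \<le> s" | "s + d \<le> z0" | "s < z0" "t \<le> z0" | "s < z0" "z0 < s + d" "z0 < t" by linarith
    then show "f (s + d) - f s \<le> f (t + d) - f t"
    proof cases
      case 1 then show ?thesis using increasing_incrementsD[OF h(1) st d] st d by (simp add: ge0)
    next
      case 2 then show ?thesis using mono[of t "t + d"] le0[of s] le0[of "s + d"] d by simp
    next
      case 3 then show ?thesis using mono[of "s + d" "t + d"] le0[of s] le0[of t] st by simp
    next
      case 4
      have "h (z0 + (s + d - z0)) - h z0 \<le> h (t + (s + d - z0)) - h t"
        using 4 by (intro increasing_incrementsD[OF h(1)]) auto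
      moreover have "h (t + (s + d - z0)) \<le> h (t + d)" using 4 by (intro right) auto
      ultimately show ?thesis using 4 d by (simp add: ge0 le0)
    qed
  qed
qed

text \<open>
  If \<open>h\<close> is neither monotone nor antitone, it decreases somewhere and increases somewhere; convexity
  then makes its minimum over an interval containing both places a global one.
\<close>

lemma convex_on_real_cases:
  fixes h :: "real \<Rightarrow> real"
  assumes h: "convex_on UNIV h" "continuous_on UNIV h"
  obtains "mono h" | "antimono h" | z0 where "\<And>z. h z0 \<le> h z"
proof -
  have quasi: "h y \<le> max (h x) (h z)" if "x \<le> y" "y \<le> z" for x y z
  proof (cases "x = z")
    case False
    define u where "u = (y - x) / (z - x)"
    have u: "0 \<le> u" "u \<le> 1" using that False by (auto simp: u_def divide_simps)
    have "u * (z - x) = y - x" using False by (simp add: u_def)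
    then have "(1 - u) *\<^sub>R x + u *\<^sub>R z = y" by (simp add: algebra_simps)
    then have "h y \<le> (1 - u) * h x + u * h z" using convex_onD[OF h(1), of u x z] u by simp
    also have "\<dots> \<le> (1 - u) * max (h x) (h z) + u * max (h x) (h z)"
      using u by (intro add_mono mult_left_mono) auto
    finally show ?thesis by (simp add: algebra_simps)
  qed (use that in auto)
  have "\<exists>z0. \<forall>z. h z0 \<le> h z" if "\<not> mono h" "\<not> antimono h"
  proof -
    from that(1) obtain a b where ab: "a \<le> b" "h b < h a" by (auto simp: mono_def not_le)
    from that(2) obtain c d where cd: "c \<le> d" "h c < h d" by (auto simp: antimono_def not_le)
    define l r where "l = min a c" and "r = max b d"
    have "\<exists>x\<in>{l..r}. \<forall>y\<in>{l..r}. h x \<le> h y"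
      by (rule continuous_attains_inf)
        (use ab cd h(2) in \<open>auto simp: l_def r_def intro: continuous_on_subset\<close>)
    then obtain z0 where z0: "z0 \<in> {l..r}" "\<And>y. y \<in> {l..r} \<Longrightarrow> h z0 \<le> h y" by auto
    have "h z0 \<le> h z" for z
    proof -
      consider "z \<in> {l..r}" | "z < l" | "r < z" by fastforce
      then show ?thesis
      proof cases
        case 1 then show ?thesis by (rule z0)
      next
        case 2
        then have "h a \<le> max (h z) (h b)" using ab by (intro quasi) (auto simp: l_def)
        then have "h a \<le> h z" using ab by simp
        moreover have "h z0 \<le> h a" using ab by (intro z0) (auto simp: l_def r_def)
        ultimately show ?thesis by simp
      next
        case 3
        then have "h d \<le> max (h c) (h z)" using cd by (intro quasi) (auto simp: r_def)
        then have "h d \<le> h z" using cd by simp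
        moreover have "h z0 \<le> h d" using cd by (intro z0) (auto simp: l_def r_def)
        ultimately show ?thesis by simp
      qed
    qed
    then show ?thesis by blast
  qed
  then show thesis using that by blast
qed

text \<open>
  Split \<open>h\<close> at its minimum. If the infimum is not attained, \<open>h\<close> is monotone or antitone, one of the
  two parts is zero, and \<open>k\<close> is the infimum. The functions \<open>f\<close> and \<open>g\<close> and the number \<open>k - m\<close> are
  nonnegative, so that their integrals can be added even where they are infinite.
\<close>

lemma convex_monotone_decomposition:
  fixes h :: "real \<Rightarrow> real"
  assumes h: "convex_on UNIV h" and m: "\<And>z. m \<le> h z"
  obtains f g k where "\<And>z. h z = f z + g z + k" "m \<le> k" "\<And>z. 0 \<le> f z" "\<And>z. 0 \<le> g z"
    "mono f" "increasing_increments f" "continuous_on UNIV f" "(f \<longlongrightarrow> 0) at_bot"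
    "antimono g" "increasing_increments g" "continuous_on UNIV g" "(g \<longlongrightarrow> 0) at_top"
proof -
  have cont: "continuous_on UNIV h" using convex_on_continuous[OF open_UNIV h] .
  have inc: "increasing_increments h" by (rule convex_increasing_increments) fact
  have const: "mono (\<lambda>_. 0 :: real)" "antimono (\<lambda>_. 0 :: real)" "increasing_increments (\<lambda>_. 0)"
    by (auto simp: mono_def antimono_def increasing_increments_def)
  have reflect_cont: "continuous_on UNIV (\<lambda>z. f (- z))" if "continuous_on UNIV f" for f :: "real \<Rightarrow> real"
    by (rule continuous_on_compose2[OF that]) (auto intro: continuous_intros)
  have reflect: "mono f \<Longrightarrow> antimono (\<lambda>z. f (- z))" "continuous_on UNIV f \<Longrightarrow> continuous_on UNIV (\<lambda>z. f (- z))"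
      "(f \<longlongrightarrow> 0) at_bot \<Longrightarrow> ((\<lambda>z. f (- z)) \<longlongrightarrow> 0) at_top" for f :: "real \<Rightarrow> real"
    by (auto simp: mono_def antimono_def intro: reflect_cont filterlim_compose[OF _ filterlim_uminus_at_bot_at_top])
  have cont': "continuous_on UNIV (\<lambda>z. h (- z))"
    by (rule continuous_on_compose2[OF cont]) (auto intro: continuous_intros)
  have inc': "increasing_increments (\<lambda>z. h (- z))" by (rule increasing_increments_reflect) fact
  have shift: "((\<lambda>z. f z - c) \<longlongrightarrow> 0) at_bot" if "(f \<longlongrightarrow> c) at_bot" for f :: "real \<Rightarrow> real" and c
    using tendsto_diff[OF that tendsto_const[of c]] by simp
  have inc_shift: "increasing_increments (\<lambda>z. f z - c)" if "increasing_increments f" for f c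
    using that by (simp add: increasing_increments_def)
  have Inf_le: "Inf (range f) \<le> f z" if "\<And>z. m \<le> f z" for f and z :: real
    using that by (intro cInf_lower bdd_belowI2[of _ m]) auto
  from h cont show thesis
  proof (cases rule: convex_on_real_cases)
    case 1
    show thesis
      by (rule that[of "\<lambda>z. h z - Inf (range h)" "\<lambda>_. 0" "Inf (range h)"])
        (use 1 mono_tendsto_Inf_at_bot[OF 1 m] const inc cont Inf_le[OF m] in
          \<open>auto intro!: shift inc_shift continuous_intros simp: mono_def\<close>)
  next
    case 2
    let ?f = "\<lambda>z. h (- z)"
    have mf: "mono ?f" using 2 by (auto simp: mono_def antimono_def)
    have r: "range ?f = range h" by (auto simp: image_def) (metis minus_minus)
    note L = mono_tendsto_Inf_at_bot[OF mf m, unfolded r]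
    have "((\<lambda>z. (h (- (- z)) - Inf (range h))) \<longlongrightarrow> 0) at_top"
      using reflect(3)[OF shift[OF L(1)]] .
    then show thesis
      by (intro that[of "\<lambda>_. 0" "\<lambda>z. h z - Inf (range h)" "Inf (range h)"])
        (use 2 L const inc cont Inf_le[OF m] in \<open>auto intro!: inc_shift continuous_intros simp: antimono_def\<close>)
  next
    case (3 z0)
    let ?f' = "\<lambda>z. h (- (max z (- z0))) - h (- (- z0))"
    note F = increasing_part[OF inc cont 3]
    note G = increasing_part[of "\<lambda>z. h (- z)" "- z0", OF inc' cont']
    have G': "mono ?f'" "increasing_increments ?f'" "continuous_on UNIV ?f'" "(?f' \<longlongrightarrow> 0) at_bot" "\<And>z. 0 \<le> ?f' z"
      by (rule G, use 3 in simp)+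
    have eq: "?f' (- z) = h (min z z0) - h z0" for z
      by (cases "z \<le> z0") (auto simp: max_def min_def)
    have "h z = h (max z z0) - h z0 + ?f' (- z) + h z0" for z
      unfolding eq by (cases "z \<le> z0") (auto simp: max_def min_def)
    from that[where f="\<lambda>z. h (max z z0) - h z0" and g="\<lambda>z. ?f' (- z)" and k="h z0",
        OF this m F(5) G'(5) F(1-4) reflect(1)[OF G'(1)] increasing_increments_reflect[OF G'(2)]
          reflect_cont[OF G'(3)] reflect(3)[OF G'(4)]]
    show thesis .
  qed
qed

theorem monotone_coupling_optimal:
  fixes h :: "real \<Rightarrow> real"
  assumes J: "line_coupling a b J" and h: "convex_on UNIV h" and m: "\<And>z. m \<le> h z"
  shows "(\<integral>\<^sup>+u. ennreal (h (quantile a u - quantile b u) - m) \<partial>unif)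
    \<le> (\<integral>\<^sup>+p. ennreal (h (fst p - snd p) - m) \<partial>J)"
proof -
  interpret U: prob_space unif by (rule prob_space_unif)
  interpret J: prob_space J by (rule line_couplingD(1)[OF J])
  note J_sets[measurable_cong] = line_couplingD(2)[OF J]
  note ab = line_couplingD(4,5)[OF J]
  have [measurable]: "quantile a \<in> borel_measurable borel" "quantile b \<in> borel_measurable borel"
    by (rule measurable_quantile_level, fact ab)+
  obtain f g k where fg: "\<And>z. h z = f z + g z + k" "m \<le> k" "\<And>z. 0 \<le> f z" "\<And>z. 0 \<le> g z"
    "mono f" "increasing_increments f" "continuous_on UNIV f" "(f \<longlongrightarrow> 0) at_bot"
    "antimono g" "increasing_increments g" "continuous_on UNIV g" "(g \<longlongrightarrow> 0) at_top"
    using convex_monotone_decomposition[OF h m] by blast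
  have [measurable]: "f \<in> borel_measurable borel" "g \<in> borel_measurable borel"
    by (rule borel_measurable_continuous_onI, fact fg)+
  have split: "ennreal (h z - m) = ennreal (f z - 0) + ennreal (g z - 0) + ennreal (k - m)" for z
    using fg by (simp add: ennreal_plus[symmetric] algebra_simps del: ennreal_plus)
  have "(\<integral>\<^sup>+u. ennreal (h (quantile a u - quantile b u) - m) \<partial>unif) =
     (\<integral>\<^sup>+u. ennreal (f (quantile a u - quantile b u) - 0) \<partial>unif) +
     (\<integral>\<^sup>+u. ennreal (g (quantile a u - quantile b u) - 0) \<partial>unif) + ennreal (k - m)"
    unfolding split by ((subst nn_integral_add, measurable)+)
  also have "\<dots> \<le> (\<integral>\<^sup>+p. ennreal (f (fst p - snd p) - 0) \<partial>J) +
     (\<integral>\<^sup>+p. ennreal (g (fst p - snd p) - 0) \<partial>J) + ennreal (k - m)"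
    by (intro add_mono monotone_coupling_optimal_mono[OF J] monotone_coupling_optimal_antimono[OF J] fg order_refl)
  also have "\<dots> = (\<integral>\<^sup>+p. ennreal (h (fst p - snd p) - m) \<partial>J)"
    unfolding split by (subst nn_integral_add, measurable)+ (use J.emeasure_space_1 in simp)
  finally show ?thesis .
qed

section \<open>Paths\<close>

definition initial :: "nat \<Rightarrow> (nat \<Rightarrow> real) \<Rightarrow> (nat \<Rightarrow> real)" where
  "initial t x = restrict x {1..t}"

lemma restrict_eq_initial: "(\<lambda>x. restrict x {1..t}) = initial t"
  by (simp add: initial_def fun_eq_iff)

abbreviation initials ::
  "nat \<Rightarrow> (nat \<Rightarrow> real) \<times> (nat \<Rightarrow> real) \<Rightarrow> (nat \<Rightarrow> real) \<times> (nat \<Rightarrow> real)" where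
  "initials t z \<equiv> (initial t (fst z), initial t (snd z))"

lemma space_path_space: "space (path_space t) = extensional {1..t}"
  by (simp add: path_space_def space_PiM PiE_def)

lemma measurable_initial[measurable]:
  "t \<le> n \<Longrightarrow> initial t \<in> path_space n \<rightarrow>\<^sub>M path_space t"
  unfolding path_space_def restrict_eq_initial[symmetric] by (rule measurable_restrict_subset) auto

lemma measurable_initials:
  "t \<le> n \<Longrightarrow> initials t \<in> pair_space n \<rightarrow>\<^sub>M pair_space t"
  by (intro measurable_Pair measurable_compose[OF measurable_fst] measurable_compose[OF measurable_snd]
      measurable_initial)

lemma measurable_coordinate: "1 \<le> t \<Longrightarrow> t \<le> n \<Longrightarrow> (\<lambda>x. x t) \<in> borel_measurable (path_space n)"
  unfolding path_space_def by (rule measurable_component_singleton) auto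

lemma measurable_extend:
  assumes "f \<in> M \<rightarrow>\<^sub>M path_space t" "g \<in> borel_measurable M"
  shows "(\<lambda>z. (f z)(Suc t := g z)) \<in> M \<rightarrow>\<^sub>M path_space (Suc t)"
  unfolding path_space_def
  by (rule measurable_fun_upd[where J="{1..t}"]) (use assms in \<open>auto simp: path_space_def\<close>)

lemma initial_id: "x \<in> space (path_space t) \<Longrightarrow> initial t x = x"
  by (simp add: space_path_space initial_def extensional_restrict)

lemma initial_initial: "s \<le> t \<Longrightarrow> initial s (initial t x) = initial s x"
  by (auto simp: fun_eq_iff initial_def restrict_def)

lemma initial_extend: "s \<le> t \<Longrightarrow> initial s (x(Suc t := a)) = initial s x"
  by (auto simp: fun_eq_iff initial_def restrict_def)

lemma initial_Suc: "(initial t x)(Suc t := x (Suc t)) = initial (Suc t) x"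
  by (auto simp: fun_eq_iff initial_def restrict_def)

lemma initial_0: "initial 0 x = (\<lambda>_. undefined)"
  by (auto simp: fun_eq_iff initial_def)

lemma initial_in_space: "initial t x \<in> space (path_space t)"
  by (simp add: space_path_space initial_def)

lemma path_laws_prob: "\<eta> \<in> path_laws N \<Longrightarrow> prob_space \<eta>"
  and path_laws_sets: "\<eta> \<in> path_laws N \<Longrightarrow> sets \<eta> = sets (path_space N)"
  by (auto simp: path_laws_def space_prob_algebra)

lemma path_laws_measurable: "\<eta> \<in> path_laws N \<Longrightarrow> \<eta> \<rightarrow>\<^sub>M S = path_space N \<rightarrow>\<^sub>M S"
  by (rule measurable_cong_sets) (simp_all add: path_laws_sets)

section \<open>Conditional laws of paths\<close>

lemma cond_law_cong:
  assumes "is_cond_law M S X R Y \<kappa>" "\<And>z. z \<in> space M \<Longrightarrow> Y z = Y' z"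
  shows "is_cond_law M S X R Y' \<kappa>"
  using assms unfolding is_cond_law_def by (auto cong: conj_cong Collect_cong)

text \<open>Coordinates are added one at a time; the empty path has a deterministic law.\<close>

lemma ex_cond_law_path:
  assumes "prob_space M" and X: "X \<in> M \<rightarrow>\<^sub>M S"
  shows "Y \<in> M \<rightarrow>\<^sub>M path_space n \<Longrightarrow> \<exists>\<kappa>. is_cond_law M S X (path_space n) Y \<kappa>"
proof (induction n arbitrary: Y)
  case 0
  let ?e = "\<lambda>_::nat. undefined :: real"
  have sp: "space (path_space 0) = {?e}" by (simp add: space_path_space extensional_def fun_eq_iff) auto
  have "is_cond_law M S X (path_space 0) Y (\<lambda>_. return (path_space 0) ?e)"
  proof (rule is_cond_lawI[OF X])
    show "(\<lambda>_. return (path_space 0) ?e) \<in> S \<rightarrow>\<^sub>M prob_algebra (path_space 0)"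
      by (rule measurable_const) (auto simp: space_prob_algebra sp intro: prob_space_return)
    fix A B assume A[measurable]: "A \<in> sets S" and B: "B \<in> sets (path_space 0)"
    note [measurable] = X
    have "B \<subseteq> {?e}" using sets.sets_into_space[OF B] sp by simp
    moreover have "Y z = ?e" if "z \<in> space M" for z using measurable_space[OF 0 that] sp by simp
    ultimately have *: "{z \<in> space M. X z \<in> A \<and> Y z \<in> B} = (if ?e \<in> B then {z\<in>space M. X z \<in> A} else {})" by auto
    have "{z\<in>space M. X z \<in> A} = X -` A \<inter> space M" by auto
    then have "emeasure M {z\<in>space M. X z \<in> A} = (\<integral>\<^sup>+z. indicator A (X z) \<partial>M)"
      using emeasure_vimage_eq_nn_integral[OF X A] by simp
    then show "emeasure M {z \<in> space M. X z \<in> A \<and> Y z \<in> B} =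
        (\<integral>\<^sup>+z. indicator A (X z) * emeasure (return (path_space 0) ?e) B \<partial>M)"
      using B by (simp add: * indicator_def)
  qed
  then show ?case by blast
next
  case (Suc n)
  let ?Y = "\<lambda>z. initial n (Y z)" and ?Z = "\<lambda>z. Y z (Suc n)"
  have Y[measurable]: "?Y \<in> M \<rightarrow>\<^sub>M path_space n"
    by (rule measurable_compose[OF Suc.prems measurable_initial]) simp
  have Z[measurable]: "?Z \<in> borel_measurable M"
    by (rule measurable_compose[OF Suc.prems measurable_coordinate]) auto
  note [measurable] = X
  obtain \<kappa> where \<kappa>: "is_cond_law M S X (path_space n) ?Y \<kappa>" using Suc.IH[OF Y] by blast
  obtain l where l: "is_cond_law M (S \<Otimes>\<^sub>M path_space n) (\<lambda>z. (X z, ?Y z)) borel ?Z l"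
    using ex_cond_law[OF assms(1), of "\<lambda>z. (X z, ?Y z)" "S \<Otimes>\<^sub>M path_space n" ?Z] by auto
  note p = cond_law_pair[OF assms(1) X Y Z \<kappa> l]
  have ext: "(\<lambda>q. (fst q)(Suc n := snd q)) \<in> path_space n \<Otimes>\<^sub>M borel \<rightarrow>\<^sub>M path_space (Suc n)"
    by (rule measurable_extend) auto
  have YZ: "(\<lambda>z. (?Y z, ?Z z)) \<in> M \<rightarrow>\<^sub>M path_space n \<Otimes>\<^sub>M borel" by measurable
  show ?case
  proof (rule exI, rule cond_law_cong[OF cond_law_map[OF assms(1) X YZ p ext]])
    fix z assume "z \<in> space M"
    then have "initial (Suc n) (Y z) = Y z" by (intro initial_id measurable_space[OF Suc.prems])
    then show "(fst (?Y z, ?Z z))(Suc n := snd (?Y z, ?Z z)) = Y z"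
      by (simp only: fst_conv snd_conv initial_Suc)
  qed
qed

lemma next_law:
  assumes "\<eta> \<in> path_laws N" "t < N"
  shows "is_cond_law \<eta> (path_space t) (initial t) borel (\<lambda>x. x (Suc t)) (next_law \<eta> t)"
proof -
  note [measurable_cong] = path_laws_sets[OF assms(1)]
  have "initial t \<in> \<eta> \<rightarrow>\<^sub>M path_space t" "(\<lambda>x. x (Suc t)) \<in> borel_measurable \<eta>"
    using assms(2) measurable_initial[OF less_imp_le[OF assms(2)]] measurable_coordinate[of "Suc t" N]
    by (simp_all add: path_laws_measurable[OF assms(1)])
  from ex_cond_law[OF path_laws_prob[OF assms(1)] this]
  show ?thesis unfolding next_law_def restrict_eq_initial by (rule someI_ex)
qed

lemma measurable_next_law:
  "\<eta> \<in> path_laws N \<Longrightarrow> t < N \<Longrightarrow> next_law \<eta> t \<in> path_space t \<rightarrow>\<^sub>M prob_algebra borel"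
  using next_law by (auto simp: is_cond_law_def)

text \<open>
  A process is determined in law by the conditional laws of its next coordinates. Here the history \<open>H\<close>
  may contain more than the path itself, and the agreement of the conditional laws is required almost
  surely only, under the hypothesis that the pasts already have the same law: this is what makes an
  almost sure statement about \<open>\<eta>\<close> available for the process.
\<close>

lemma path_law_eqI:
  assumes "prob_space \<gamma>" and W: "W \<in> \<gamma> \<rightarrow>\<^sub>M path_space N" and \<eta>: "\<eta> \<in> path_laws N"
    and H: "\<And>t. t < N \<Longrightarrow> H t \<in> \<gamma> \<rightarrow>\<^sub>M S t" "\<And>t z. t < N \<Longrightarrow> p (H t z) = initial t (W z)"
    and p: "\<And>t. t < N \<Longrightarrow> p \<in> S t \<rightarrow>\<^sub>M path_space t"
    and L: "\<And>t. t < N \<Longrightarrow> is_cond_law \<gamma> (S t) (H t) borel (\<lambda>z. W z (Suc t)) (L t)"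
    and k: "\<And>t. t < N \<Longrightarrow> is_cond_law \<eta> (path_space t) (initial t) borel (\<lambda>x. x (Suc t)) (k t)"
    and ae: "\<And>t. t < N \<Longrightarrow> distr \<gamma> (path_space t) (\<lambda>z. initial t (W z)) = distr \<eta> (path_space t) (initial t) \<Longrightarrow>
       AE z in \<gamma>. L t (H t z) = k t (initial t (W z))"
  shows "t \<le> N \<Longrightarrow> distr \<gamma> (path_space t) (\<lambda>z. initial t (W z)) = distr \<eta> (path_space t) (initial t)"
proof (induction t)
  case 0
  interpret prob_space \<gamma> by fact
  interpret \<eta>: prob_space \<eta> by (rule path_laws_prob) fact
  note [measurable_cong] = path_laws_sets[OF \<eta>]
  have sp: "(\<lambda>_. undefined) \<in> space (path_space 0)" by (simp add: space_path_space)
  then show ?case unfolding initial_0 using distr_const[OF sp] \<eta>.distr_const[OF sp] by simp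
next
  case (Suc t)
  then have t: "t < N" "Suc t \<le> N" "t \<le> N" by auto
  interpret prob_space \<gamma> by fact
  interpret \<eta>: prob_space \<eta> by (rule path_laws_prob) fact
  note \<eta>s[measurable_cong] = path_laws_sets[OF \<eta>]
  have Wt[measurable]: "(\<lambda>z. initial s (W z)) \<in> \<gamma> \<rightarrow>\<^sub>M path_space s" if "s \<le> N" for s
    by (rule measurable_compose[OF W measurable_initial[OF that]])
  have Wn[measurable]: "(\<lambda>z. W z (Suc t)) \<in> borel_measurable \<gamma>"
    by (rule measurable_compose[OF W measurable_coordinate]) (use t in auto)
  have xt[measurable]: "initial s \<in> \<eta> \<rightarrow>\<^sub>M path_space s" if "s \<le> N" for s
    using measurable_initial[OF that] by (simp cong: measurable_cong_sets)
  have xn[measurable]: "(\<lambda>x. x (Suc t)) \<in> borel_measurable \<eta>"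
    using measurable_coordinate[of "Suc t" N] t by (simp cong: measurable_cong_sets)
  note eq = Suc.IH[OF t(3)]
  have km: "k t \<in> path_space t \<rightarrow>\<^sub>M prob_algebra borel" using k[OF t(1)] by (simp add: is_cond_law_def)
  show ?case
  proof (rule measure_eqI)
    fix A assume "A \<in> sets (distr \<gamma> (path_space (Suc t)) (\<lambda>z. initial (Suc t) (W z)))"
    then have A: "A \<in> sets (path_space (Suc t))" by simp
    have ext: "(\<lambda>q. (fst q)(Suc t := snd q)) \<in> path_space t \<Otimes>\<^sub>M borel \<rightarrow>\<^sub>M path_space (Suc t)"
      by (rule measurable_extend) auto
    define f :: "(nat \<Rightarrow> real) \<times> real \<Rightarrow> ennreal" where "f q = indicator A ((fst q)(Suc t := snd q))" for q
    have fm[measurable]: "f \<in> borel_measurable (path_space t \<Otimes>\<^sub>M borel)"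
      unfolding f_def by (rule measurable_compose[OF ext]) (use A in simp)
    have gm: "(\<lambda>x. \<integral>\<^sup>+a. f (x, a) \<partial>k t x) \<in> borel_measurable (path_space t)"
      by (rule measurable_nn_integral_kernel[OF km]) simp
    have "emeasure (distr \<gamma> (path_space (Suc t)) (\<lambda>z. initial (Suc t) (W z))) A =
      (\<integral>\<^sup>+z. indicator A (initial (Suc t) (W z)) \<partial>\<gamma>)"
      using A t by (subst nn_integral_indicator[symmetric], simp, subst nn_integral_distr) auto
    also have "\<dots> = (\<integral>\<^sup>+z. (\<lambda>(h, a). f (p h, a)) (H t z, W z (Suc t)) \<partial>\<gamma>)"
      by (simp add: f_def H(2)[OF t(1)] initial_Suc)
    also have "\<dots> = (\<integral>\<^sup>+z. \<integral>\<^sup>+a. (\<lambda>(h, a). f (p h, a)) (H t z, a) \<partial>L t (H t z) \<partial>\<gamma>)"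
      proof (rule cond_law_nn_integral[OF prob_space_axioms H(1)[OF t(1)] Wn L[OF t(1)]])
      note [measurable] = p[OF t(1)]
      show "(\<lambda>(h, a). f (p h, a)) \<in> borel_measurable (S t \<Otimes>\<^sub>M borel)" by measurable
    qed
    also have "\<dots> = (\<integral>\<^sup>+z. \<integral>\<^sup>+a. f (initial t (W z), a) \<partial>k t (initial t (W z)) \<partial>\<gamma>)"
      by (rule nn_integral_cong_AE) (use ae[OF t(1) eq] in eventually_elim, simp add: H(2)[OF t(1)])
    also have "\<dots> = (\<integral>\<^sup>+x. \<integral>\<^sup>+a. f (x, a) \<partial>k t x \<partial>distr \<gamma> (path_space t) (\<lambda>z. initial t (W z)))"
      by (subst nn_integral_distr) (use gm t in auto)
    also have "\<dots> = (\<integral>\<^sup>+x. \<integral>\<^sup>+a. f (initial t x, a) \<partial>k t (initial t x) \<partial>\<eta>)"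
      unfolding eq by (subst nn_integral_distr) (use gm t in auto)
    also have "\<dots> = (\<integral>\<^sup>+x. f (initial t x, x (Suc t)) \<partial>\<eta>)"
      by (rule cond_law_nn_integral[OF \<eta>.prob_space_axioms _ xn k[OF t(1)], symmetric]) (use t in auto)
    also have "\<dots> = emeasure (distr \<eta> (path_space (Suc t)) (initial (Suc t))) A"
      using A t by (subst nn_integral_indicator[symmetric], simp, subst nn_integral_distr) (auto simp: f_def initial_Suc)
    finally show "emeasure (distr \<gamma> (path_space (Suc t)) (\<lambda>z. initial (Suc t) (W z))) A =
      emeasure (distr \<eta> (path_space (Suc t)) (initial (Suc t))) A" .
  qed simp
qed

section \<open>A sequential criterion for causality\<close>

text \<open>
  The one-step version of causality. The conditional law is expressed through integrals of functions of
  both pasts and the next coordinate, which is the form that passes through an exchange of the two paths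
  and through inductions that integrate one coordinate at a time.
\<close>

definition nonanticipative :: "nat \<Rightarrow> (nat \<Rightarrow> (nat \<Rightarrow> real) \<Rightarrow> real measure) \<Rightarrow>
    ((nat \<Rightarrow> real) \<times> (nat \<Rightarrow> real)) measure \<Rightarrow> bool" where
  "nonanticipative N k \<gamma> \<longleftrightarrow> (\<forall>t<N. \<forall>f\<in>borel_measurable (pair_space t \<Otimes>\<^sub>M borel).
     (\<integral>\<^sup>+z. f (initials t z, fst z (Suc t)) \<partial>\<gamma>) =
     (\<integral>\<^sup>+z. \<integral>\<^sup>+a. f (initials t z, a) \<partial>k t (initial t (fst z)) \<partial>\<gamma>))"

lemma nonanticipativeD:
  assumes "nonanticipative N k \<gamma>" "t < N" "f \<in> borel_measurable (pair_space t \<Otimes>\<^sub>M borel)"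
  shows "(\<integral>\<^sup>+z. f (initials t z, fst z (Suc t)) \<partial>\<gamma>) =
     (\<integral>\<^sup>+z. \<integral>\<^sup>+a. f (initials t z, a) \<partial>k t (initial t (fst z)) \<partial>\<gamma>)"
  using assms by (simp add: nonanticipative_def)

lemma couplingsD:
  assumes "\<gamma> \<in> couplings N \<mu> \<nu>"
  shows "prob_space \<gamma>" "sets \<gamma> = sets (pair_space N)" "space \<gamma> = space (pair_space N)"
    "fst \<in> \<gamma> \<rightarrow>\<^sub>M path_space N" "snd \<in> \<gamma> \<rightarrow>\<^sub>M path_space N"
    "distr \<gamma> (path_space N) fst = \<mu>" "distr \<gamma> (path_space N) snd = \<nu>"
proof -
  show "prob_space \<gamma>" and s: "sets \<gamma> = sets (pair_space N)"
    and "distr \<gamma> (path_space N) fst = \<mu>" "distr \<gamma> (path_space N) snd = \<nu>"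
    using assms by (auto simp: couplings_def space_prob_algebra)
  from sets_eq_imp_space_eq[OF s] show "space \<gamma> = space (pair_space N)" .
  note [measurable_cong] = s
  show "fst \<in> \<gamma> \<rightarrow>\<^sub>M path_space N" "snd \<in> \<gamma> \<rightarrow>\<^sub>M path_space N" by measurable
qed

text \<open>
  If \<open>G\<close> is the conditional probability of an event \<open>B\<close> for the past of the second path given the past
  of the first path up to the same time, then \<open>G\<close> is also its conditional probability given a longer
  piece of the first path: each further coordinate is drawn from a law which does not involve the second
  path. The claim is stated for functions \<open>f\<close> instead of events so that the new coordinate can be
  integrated out in the induction step.
\<close>

lemma nonanticipative_extend:
  assumes "prob_space \<gamma>" and s[measurable_cong]: "sets \<gamma> = sets (pair_space N)"
    and non: "nonanticipative N k \<gamma>"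
    and k: "\<And>t. t < N \<Longrightarrow> k t \<in> path_space t \<rightarrow>\<^sub>M prob_algebra borel"
    and B: "B \<in> sets (path_space t)" and G: "G \<in> borel_measurable (path_space t)"
    and base: "\<And>f. f \<in> borel_measurable (path_space t) \<Longrightarrow>
       (\<integral>\<^sup>+z. f (initial t (fst z)) * indicator B (initial t (snd z)) \<partial>\<gamma>) =
       (\<integral>\<^sup>+z. f (initial t (fst z)) * G (initial t (fst z)) \<partial>\<gamma>)"
  shows "t + j \<le> N \<Longrightarrow> f \<in> borel_measurable (path_space (t + j)) \<Longrightarrow>
       (\<integral>\<^sup>+z. f (initial (t + j) (fst z)) * indicator B (initial t (snd z)) \<partial>\<gamma>) =
       (\<integral>\<^sup>+z. f (initial (t + j) (fst z)) * G (initial t (fst z)) \<partial>\<gamma>)"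
proof (induction j arbitrary: f)
  case 0 then show ?case using base by simp
next
  case (Suc j)
  let ?s = "t + j"
  have s': "?s < N" "?s \<le> N" using Suc.prems by auto
  have fm: "f \<in> borel_measurable (path_space (Suc ?s))" using Suc.prems by simp
  have fe: "(\<lambda>q. f ((fst q)(Suc ?s := snd q))) \<in> borel_measurable (path_space ?s \<Otimes>\<^sub>M borel)"
    by (rule measurable_compose[OF measurable_extend fm]) auto
  have fe1: "(\<lambda>q. f ((fst (fst q))(Suc ?s := snd q))) \<in> borel_measurable (pair_space ?s \<Otimes>\<^sub>M borel)"
    by (rule measurable_compose[OF measurable_extend fm]) measurable
  have iB: "(\<lambda>q. indicator B (initial t (snd (fst q))) :: ennreal) \<in> borel_measurable (pair_space ?s \<Otimes>\<^sub>M borel)"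
    by (rule measurable_compose[where N="path_space t"],
      rule measurable_compose[OF measurable_compose[OF measurable_fst measurable_snd] measurable_initial]) (use B in auto)
  have iG: "(\<lambda>q. G (initial t (fst (fst q)))) \<in> borel_measurable (pair_space ?s \<Otimes>\<^sub>M borel)"
    by (rule measurable_compose[where N="path_space t"],
      rule measurable_compose[OF measurable_compose[OF measurable_fst measurable_fst] measurable_initial]) (use G in auto)
  define \<psi> where "\<psi> x = (\<integral>\<^sup>+a. f (x(Suc ?s := a)) \<partial>k ?s x)" for x
  have \<psi>m: "\<psi> \<in> borel_measurable (path_space ?s)"
    unfolding \<psi>_def by (rule measurable_nn_integral_kernel[OF k[OF s'(1)]]) (use fe in \<open>simp add: split_beta'\<close>)
  have fk: "(\<lambda>a. f (x(Suc ?s := a))) \<in> borel_measurable (k ?s x)" if "x \<in> space (path_space ?s)" for x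
  proof -
    have "(\<lambda>a. f (x(Suc ?s := a))) \<in> borel_measurable borel"
      by (rule measurable_compose[OF measurable_extend fm]) (use that in auto)
    then show ?thesis using sets_kernel_prob(1)[OF k[OF s'(1)] that] by (simp cong: measurable_cong_sets)
  qed
  have tt: "t \<le> ?s" by simp
  have "(\<integral>\<^sup>+z. f (initial (t + Suc j) (fst z)) * indicator B (initial t (snd z)) \<partial>\<gamma>) =
     (\<integral>\<^sup>+z. (\<lambda>q. f ((fst (fst q))(Suc ?s := snd q)) * indicator B (initial t (snd (fst q)))) (initials ?s z, fst z (Suc ?s)) \<partial>\<gamma>)"
    by (simp add: initial_Suc initial_initial[OF tt])
  also have "\<dots> = (\<integral>\<^sup>+z. \<integral>\<^sup>+a. (\<lambda>q. f ((fst (fst q))(Suc ?s := snd q)) * indicator B (initial t (snd (fst q)))) (initials ?s z, a) \<partial>k ?s (initial ?s (fst z)) \<partial>\<gamma>)"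
    by (rule nonanticipativeD[OF non s'(1) borel_measurable_times_ennreal[OF fe1 iB]])
  also have "\<dots> = (\<integral>\<^sup>+z. \<psi> (initial ?s (fst z)) * indicator B (initial t (snd z)) \<partial>\<gamma>)"
    by (intro nn_integral_cong)
      (simp add: \<psi>_def initial_initial[OF tt] nn_integral_multc[OF fk[OF initial_in_space]])
  also have "\<dots> = (\<integral>\<^sup>+z. \<psi> (initial ?s (fst z)) * G (initial t (fst z)) \<partial>\<gamma>)"
    by (rule Suc.IH[OF s'(2) \<psi>m])
  also have "\<dots> = (\<integral>\<^sup>+z. \<integral>\<^sup>+a. (\<lambda>q. f ((fst (fst q))(Suc ?s := snd q)) * G (initial t (fst (fst q)))) (initials ?s z, a) \<partial>k ?s (initial ?s (fst z)) \<partial>\<gamma>)"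
    by (intro nn_integral_cong)
      (simp add: \<psi>_def initial_initial[OF tt] nn_integral_multc[OF fk[OF initial_in_space]])
  also have "\<dots> = (\<integral>\<^sup>+z. (\<lambda>q. f ((fst (fst q))(Suc ?s := snd q)) * G (initial t (fst (fst q)))) (initials ?s z, fst z (Suc ?s)) \<partial>\<gamma>)"
    by (rule nonanticipativeD[OF non s'(1) borel_measurable_times_ennreal[OF fe1 iG], symmetric])
  also have "\<dots> = (\<integral>\<^sup>+z. f (initial (t + Suc j) (fst z)) * G (initial t (fst z)) \<partial>\<gamma>)"
    by (simp add: initial_Suc initial_initial[OF tt])
  finally show ?case .
qed

text \<open>
  Extending to the whole first path shows that the conditional probability of an event before time \<open>t\<close>
  given the whole first path is almost surely the one given the first path up to time \<open>t\<close>.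
\<close>

theorem nonanticipative_imp_causal:
  assumes \<gamma>: "\<gamma> \<in> couplings N \<mu> \<nu>" and non: "nonanticipative N k \<gamma>"
    and k: "\<And>t. t < N \<Longrightarrow> k t \<in> path_space t \<rightarrow>\<^sub>M prob_algebra borel"
  shows "\<gamma> \<in> causal_couplings N \<mu> \<nu>"
proof -
  note D = couplingsD[OF \<gamma>]
  interpret prob_space \<gamma> by (rule D)
  note s[measurable_cong] = D(2)
  note fs[measurable] = D(4,5)
  have ini: "(\<lambda>z. initial t (fst z)) \<in> \<gamma> \<rightarrow>\<^sub>M path_space t" "(\<lambda>z. initial t (snd z)) \<in> \<gamma> \<rightarrow>\<^sub>M path_space t"
    if "t \<le> N" for t
    by (rule measurable_compose[OF D(4) measurable_initial[OF that]],
        rule measurable_compose[OF D(5) measurable_initial[OF that]])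
  obtain \<kappa> where \<kappa>: "is_cond_law \<gamma> (path_space N) fst (path_space N) snd \<kappa>"
    using ex_cond_law_path[OF prob_space_axioms D(4) D(5)] by blast
  have \<kappa>m: "\<kappa> \<in> path_space N \<rightarrow>\<^sub>M prob_algebra (path_space N)" using \<kappa> by (simp add: is_cond_law_def)
  have "\<exists>g\<in>borel_measurable (past N t). AE x in \<mu>. measure (\<kappa> x) B = g x"
    if t: "t \<in> {1..N}" and B: "B \<in> sets (past N t)" for t B
  proof -
    have tN: "t \<le> N" using t by simp
    obtain B' where B': "B' \<in> sets (path_space t)" and BB: "B = initial t -` B' \<inter> space (path_space N)"
      using B unfolding past_def restrict_eq_initial by (auto simp: sets_vimage_algebra2 initial_in_space)
    have Bm: "B \<in> sets (path_space N)"
      unfolding BB by (rule measurable_sets[OF measurable_initial[OF tN] B'])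
    obtain l where l: "is_cond_law \<gamma> (path_space t) (\<lambda>z. initial t (fst z)) (path_space t) (\<lambda>z. initial t (snd z)) l"
      using ex_cond_law_path[OF prob_space_axioms ini[OF tN]] by blast
    have lm: "l \<in> path_space t \<rightarrow>\<^sub>M prob_algebra (path_space t)" using l by (simp add: is_cond_law_def)
    define G where "G x = emeasure (l x) B'" for x
    have Gm: "G \<in> borel_measurable (path_space t)"
      unfolding G_def by (rule measurable_emeasure_kernel[OF lm B'])
    have GN: "(\<lambda>x. G (initial t x)) \<in> borel_measurable (path_space N)"
      by (rule measurable_compose[OF measurable_initial[OF tN] Gm])
    have base: "(\<integral>\<^sup>+z. f (initial t (fst z)) * indicator B' (initial t (snd z)) \<partial>\<gamma>) =
       (\<integral>\<^sup>+z. f (initial t (fst z)) * G (initial t (fst z)) \<partial>\<gamma>)" if f: "f \<in> borel_measurable (path_space t)" for f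
    proof -
      have m: "(\<lambda>q. f (fst q) * indicator B' (snd q)) \<in> borel_measurable (pair_space t)"
        using f B' by measurable
      have "(\<integral>\<^sup>+z. f (initial t (fst z)) * indicator B' (initial t (snd z)) \<partial>\<gamma>) =
        (\<integral>\<^sup>+z. \<integral>\<^sup>+y. f (initial t (fst z)) * indicator B' y \<partial>l (initial t (fst z)) \<partial>\<gamma>)"
        using cond_law_nn_integral[OF prob_space_axioms ini[OF tN] l m] by simp
      also have "\<dots> = (\<integral>\<^sup>+z. f (initial t (fst z)) * G (initial t (fst z)) \<partial>\<gamma>)"
        using B' sets_kernel_prob(1)[OF lm initial_in_space]
        by (intro nn_integral_cong) (simp add: nn_integral_cmult_indicator G_def)
      finally show ?thesis .
    qed
    note ext = nonanticipative_extend[OF prob_space_axioms s non k B' Gm base, of "N - t"]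
    have key: "AE x in distr \<gamma> (path_space N) fst. emeasure (\<kappa> x) B = G (initial t x)"
    proof (rule finite_measure.density_unique_finite_measure)
      interpret d: prob_space "distr \<gamma> (path_space N) fst" by (rule prob_space_distr) (rule D)
      show "finite_measure (distr \<gamma> (path_space N) fst)" by unfold_locales
      show "(\<lambda>x. emeasure (\<kappa> x) B) \<in> borel_measurable (distr \<gamma> (path_space N) fst)"
        using measurable_emeasure_kernel[OF \<kappa>m Bm] by simp
      show "(\<lambda>x. G (initial t x)) \<in> borel_measurable (distr \<gamma> (path_space N) fst)" using GN by simp
      fix A assume "A \<in> sets (distr \<gamma> (path_space N) fst)"
      then have A[measurable]: "A \<in> sets (path_space N)" by simp
      have "(\<integral>\<^sup>+x\<in>A. emeasure (\<kappa> x) B \<partial>distr \<gamma> (path_space N) fst) =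
         emeasure \<gamma> {z\<in>space \<gamma>. fst z \<in> A \<and> snd z \<in> B}"
        using \<kappa> A Bm by (simp add: is_cond_law_def)
      also have "\<dots> = (\<integral>\<^sup>+z. indicator {z\<in>space \<gamma>. fst z \<in> A \<and> snd z \<in> B} z \<partial>\<gamma>)"
        by (rule nn_integral_indicator[symmetric]) (use Bm in measurable)
      also have "\<dots> = (\<integral>\<^sup>+z. indicator A (initial (t + (N - t)) (fst z)) * indicator B' (initial t (snd z)) \<partial>\<gamma>)"
      proof (rule nn_integral_cong)
        fix z assume z: "z \<in> space \<gamma>"
        then have "fst z \<in> space (path_space N)" "snd z \<in> space (path_space N)"
          by (auto simp: D(3) space_pair_measure)
        then have "initial (t + (N - t)) (fst z) = fst z" "snd z \<in> B \<longleftrightarrow> initial t (snd z) \<in> B'"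
          using tN by (simp_all add: initial_id BB)
        then show "indicator {z\<in>space \<gamma>. fst z \<in> A \<and> snd z \<in> B} z =
            (indicator A (initial (t + (N - t)) (fst z)) * indicator B' (initial t (snd z)) :: ennreal)"
          using z by (simp add: indicator_def)
      qed
      also have "\<dots> = (\<integral>\<^sup>+z. indicator A (initial (t + (N - t)) (fst z)) * G (initial t (fst z)) \<partial>\<gamma>)"
        by (rule ext) (use tN A in auto)
      also have "\<dots> = (\<integral>\<^sup>+z. G (initial t (fst z)) * indicator A (fst z) \<partial>\<gamma>)"
      proof (rule nn_integral_cong)
        fix z assume "z \<in> space \<gamma>"
        then have "fst z \<in> space (path_space N)" by (auto simp: D(3) space_pair_measure)
        then have "initial (t + (N - t)) (fst z) = fst z" using tN by (simp add: initial_id)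
        then show "indicator A (initial (t + (N - t)) (fst z)) * G (initial t (fst z)) =
          G (initial t (fst z)) * indicator A (fst z)" by (simp add: mult.commute)
      qed
      also have "\<dots> = (\<integral>\<^sup>+x\<in>A. G (initial t x) \<partial>distr \<gamma> (path_space N) fst)"
        using GN by (subst nn_integral_distr) auto
      finally show "(\<integral>\<^sup>+x\<in>A. emeasure (\<kappa> x) B \<partial>distr \<gamma> (path_space N) fst) =
        (\<integral>\<^sup>+x\<in>A. G (initial t x) \<partial>distr \<gamma> (path_space N) fst)" .
    qed auto
    show ?thesis
    proof (rule bexI[of _ "\<lambda>x. enn2real (G (initial t x))"])
      show "AE x in \<mu>. measure (\<kappa> x) B = enn2real (G (initial t x))"
        using key unfolding D(6) by eventually_elim (simp add: measure_def)
      have "initial t \<in> past N t \<rightarrow>\<^sub>M path_space t"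
        unfolding past_def restrict_eq_initial by (rule measurable_vimage_algebra1) (simp add: initial_in_space)
      from measurable_compose[OF this Gm]
      have [measurable]: "(\<lambda>x. G (initial t x)) \<in> borel_measurable (past N t)" .
      show "(\<lambda>x. enn2real (G (initial t x))) \<in> borel_measurable (past N t)" by measurable
    qed
  qed
  then show ?thesis using \<gamma> \<kappa> by (auto simp: causal_couplings_def)
qed

section \<open>Bicausal couplings with given transition kernels\<close>

text \<open>
  With the identity and with the exchange of the two paths for \<open>g\<close>, and for the corresponding map \<open>\<sigma>\<close> of
  histories, this gives both directions of bicausality from one computation.
\<close>

lemma nonanticipative_distrI:
  assumes ps: "prob_space M" and g: "g \<in> M \<rightarrow>\<^sub>M pair_space N"
    and H: "\<And>t. t < N \<Longrightarrow> H t \<in> M \<rightarrow>\<^sub>M pair_space t"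
    and \<sigma>: "\<And>t. t < N \<Longrightarrow> \<sigma> \<in> pair_space t \<rightarrow>\<^sub>M pair_space t" "\<And>t z. initials t (g z) = \<sigma> (H t z)"
    and L: "\<And>t. t < N \<Longrightarrow> is_cond_law M (pair_space t) (H t) borel (\<lambda>z. fst (g z) (Suc t)) (L t)"
    and ae: "\<And>t. t < N \<Longrightarrow> AE z in M. L t (H t z) = k t (initial t (fst (g z)))"
    and k: "\<And>t. t < N \<Longrightarrow> k t \<in> path_space t \<rightarrow>\<^sub>M prob_algebra borel"
  shows "nonanticipative N k (distr M (pair_space N) g)"
  unfolding nonanticipative_def
proof (intro allI impI ballI)
  fix t and f :: "((nat \<Rightarrow> real) \<times> (nat \<Rightarrow> real)) \<times> real \<Rightarrow> ennreal"
  assume t: "t < N" and f: "f \<in> borel_measurable (pair_space t \<Otimes>\<^sub>M borel)"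
  have i: "initials t \<in> pair_space N \<rightarrow>\<^sub>M pair_space t" using measurable_initials[of t N] t by simp
  have c: "(\<lambda>z. fst z (Suc t)) \<in> borel_measurable (pair_space N)"
    by (rule measurable_compose[OF measurable_fst measurable_coordinate]) (use t in auto)
  have f': "(\<lambda>q. f (\<sigma> (fst q), snd q)) \<in> borel_measurable (pair_space t \<Otimes>\<^sub>M borel)"
    by (intro measurable_compose[OF _ f] measurable_Pair measurable_compose[OF measurable_fst \<sigma>(1)[OF t]] measurable_snd)
  have fm: "(\<lambda>z. f (initials t z, fst z (Suc t))) \<in> borel_measurable (pair_space N)"
    by (rule measurable_compose[OF measurable_Pair[OF i c] f])
  have km: "(\<lambda>z. \<integral>\<^sup>+a. f (initials t z, a) \<partial>k t (initial t (fst z))) \<in> borel_measurable (pair_space N)"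
  proof (rule measurable_nn_integral_kernel[where R=borel])
    show "(\<lambda>z. k t (initial t (fst z))) \<in> pair_space N \<rightarrow>\<^sub>M prob_algebra borel"
      by (rule measurable_compose[OF measurable_compose[OF measurable_fst measurable_initial] k[OF t]]) (use t in simp)
    show "(\<lambda>(z, a). f (initials t z, a)) \<in> borel_measurable (pair_space N \<Otimes>\<^sub>M borel)"
      unfolding split_beta' by (rule measurable_compose[OF _ f], rule measurable_Pair[OF measurable_compose[OF measurable_fst i] measurable_snd])
  qed
  have "(\<integral>\<^sup>+z. f (initials t z, fst z (Suc t)) \<partial>distr M (pair_space N) g) =
     (\<integral>\<^sup>+z. (\<lambda>q. f (\<sigma> (fst q), snd q)) (H t z, fst (g z) (Suc t)) \<partial>M)"
    by (subst nn_integral_distr[OF g]) (use fm in \<open>simp_all add: \<sigma>(2)[symmetric]\<close>)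
  also have "\<dots> = (\<integral>\<^sup>+z. \<integral>\<^sup>+a. (\<lambda>q. f (\<sigma> (fst q), snd q)) (H t z, a) \<partial>L t (H t z) \<partial>M)"
    by (rule cond_law_nn_integral[OF ps H[OF t] measurable_compose[OF g c] L[OF t] f'])
  also have "\<dots> = (\<integral>\<^sup>+z. \<integral>\<^sup>+a. f (initials t (g z), a) \<partial>k t (initial t (fst (g z))) \<partial>M)"
    by (rule nn_integral_cong_AE) (use ae[OF t] in eventually_elim, simp add: \<sigma>(2))
  also have "\<dots> = (\<integral>\<^sup>+z. \<integral>\<^sup>+a. f (initials t z, a) \<partial>k t (initial t (fst z)) \<partial>distr M (pair_space N) g)"
    by (rule nn_integral_distr[OF g, symmetric]) (use km in simp)
  finally show "(\<integral>\<^sup>+z. f (initials t z, fst z (Suc t)) \<partial>distr M (pair_space N) g) =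
    (\<integral>\<^sup>+z. \<integral>\<^sup>+a. f (initials t z, a) \<partial>k t (initial t (fst z)) \<partial>distr M (pair_space N) g)" .
qed

text \<open>
  The one-step kernels need to have the right marginals only for almost every past \<open>y\<close> of the second
  path, but for all pasts of the first one. The law of the second path is therefore identified first; it
  turns the null sets of \<open>\<nu>\<close> into null sets of \<open>\<gamma>\<close>, and the law of the first path follows.
\<close>

theorem bicausalI_cond_law:
  assumes \<mu>: "\<mu> \<in> path_laws N" and \<nu>: "\<nu> \<in> path_laws N"
    and \<gamma>: "\<gamma> \<in> space (prob_algebra (pair_space N))"
    and K: "\<And>t. t < N \<Longrightarrow> is_cond_law \<gamma> (pair_space t) (initials t) (borel \<Otimes>\<^sub>M borel)
              (\<lambda>z. (fst z (Suc t), snd z (Suc t))) (K t)"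
    and k: "\<And>t. t < N \<Longrightarrow> is_cond_law \<mu> (path_space t) (initial t) borel (\<lambda>x. x (Suc t)) (k t)"
    and l: "\<And>t. t < N \<Longrightarrow> is_cond_law \<nu> (path_space t) (initial t) borel (\<lambda>x. x (Suc t)) (l t)"
    and ae: "\<And>t. t < N \<Longrightarrow> AE y in distr \<nu> (path_space t) (initial t). \<forall>x\<in>space (path_space t).
              distr (K t (x, y)) borel fst = k t x \<and> distr (K t (x, y)) borel snd = l t y"
  shows "\<gamma> \<in> bicausal_couplings N \<mu> \<nu>"
    and "\<And>t. t \<le> N \<Longrightarrow> distr \<gamma> (path_space t) (\<lambda>z. initial t (fst z)) = distr \<mu> (path_space t) (initial t)"
    and "\<And>t. t \<le> N \<Longrightarrow> distr \<gamma> (path_space t) (\<lambda>z. initial t (snd z)) = distr \<nu> (path_space t) (initial t)"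
proof -
  have ps: "prob_space \<gamma>" and s[measurable_cong]: "sets \<gamma> = sets (pair_space N)"
    using \<gamma> by (auto simp: space_prob_algebra)
  interpret prob_space \<gamma> by (rule ps)
  have fs: "fst \<in> \<gamma> \<rightarrow>\<^sub>M path_space N" "snd \<in> \<gamma> \<rightarrow>\<^sub>M path_space N" by measurable
  have i: "initials t \<in> \<gamma> \<rightarrow>\<^sub>M pair_space t" if "t < N" for t
    unfolding measurable_cong_sets[OF s refl] using measurable_initials[of t N] that by simp
  have c: "(\<lambda>z. (fst z (Suc t), snd z (Suc t))) \<in> \<gamma> \<rightarrow>\<^sub>M borel \<Otimes>\<^sub>M borel" if "t < N" for t
    by (intro measurable_Pair measurable_compose[OF fs(1) measurable_coordinate]
        measurable_compose[OF fs(2) measurable_coordinate]) (use that in auto)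
  have km: "k t \<in> path_space t \<rightarrow>\<^sub>M prob_algebra borel" and lm: "l t \<in> path_space t \<rightarrow>\<^sub>M prob_algebra borel" if "t < N" for t
    using k[OF that] l[OF that] by (auto simp: is_cond_law_def)
  have K1: "is_cond_law \<gamma> (pair_space t) (initials t) borel (\<lambda>z. fst z (Suc t)) (\<lambda>h. distr (K t h) borel fst)"
    and K2: "is_cond_law \<gamma> (pair_space t) (initials t) borel (\<lambda>z. snd z (Suc t)) (\<lambda>h. distr (K t h) borel snd)" if t: "t < N" for t
    using cond_law_map[OF ps i[OF t] c[OF t] K[OF t] measurable_fst] cond_law_map[OF ps i[OF t] c[OF t] K[OF t] measurable_snd]
    by simp_all
  \<comment> \<open>Null sets of pasts of the second path are null under \<open>\<gamma>\<close> as soon as that past has the law prescribed by \<open>\<nu>\<close>.\<close>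
  have AE_transfer: "AE z in \<gamma>. distr (K t (initials t z)) borel fst = k t (initial t (fst z)) \<and>
      distr (K t (initials t z)) borel snd = l t (initial t (snd z))"
    if t: "t < N" and eq: "distr \<gamma> (path_space t) (\<lambda>z. initial t (snd z)) = distr \<nu> (path_space t) (initial t)" for t
  proof -
    have m: "(\<lambda>z. initial t (snd z)) \<in> \<gamma> \<rightarrow>\<^sub>M path_space t"
      by (rule measurable_compose[OF fs(2) measurable_initial]) (use t in simp)
    from AE_distrD[OF m ae[OF t, folded eq]] show ?thesis
      by eventually_elim (simp add: initial_in_space)
  qed
  have snd_law: "distr \<gamma> (path_space t) (\<lambda>z. initial t (snd z)) = distr \<nu> (path_space t) (initial t)" if "t \<le> N" for t
    by (rule path_law_eqI[OF ps fs(2) \<nu> i _ measurable_snd K2 l _ that])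
      (auto elim: eventually_mono[OF AE_transfer])
  have AE_K: "AE z in \<gamma>. distr (K t (initials t z)) borel fst = k t (initial t (fst z)) \<and>
      distr (K t (initials t z)) borel snd = l t (initial t (snd z))" if "t < N" for t
    using AE_transfer[OF that snd_law] that by simp
  have fst_law: "distr \<gamma> (path_space t) (\<lambda>z. initial t (fst z)) = distr \<mu> (path_space t) (initial t)" if "t \<le> N" for t
    by (rule path_law_eqI[OF ps fs(1) \<mu> i _ measurable_fst K1 k _ that])
      (auto elim: eventually_mono[OF AE_K])
  have idN: "distr \<eta> (path_space N) (initial N) = \<eta>" if "\<eta> \<in> path_laws N" for \<eta>
  proof -
    have "distr \<eta> (path_space N) (initial N) = distr \<eta> (path_space N) (\<lambda>x. x)"
      by (rule distr_cong) (simp_all add: initial_id sets_eq_imp_space_eq[OF path_laws_sets[OF that]])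
    then show ?thesis using distr_id2[OF path_laws_sets[OF that, symmetric]] by simp
  qed
  have spN: "z \<in> space \<gamma> \<Longrightarrow> fst z \<in> space (path_space N) \<and> snd z \<in> space (path_space N)" for z
    by (auto simp: sets_eq_imp_space_eq[OF s] space_pair_measure)
  have "distr \<gamma> (path_space N) fst = distr \<gamma> (path_space N) (\<lambda>z. initial N (fst z))"
    by (rule distr_cong) (simp_all add: initial_id spN)
  then have f\<mu>: "distr \<gamma> (path_space N) fst = \<mu>" by (simp add: fst_law idN \<mu>)
  have "distr \<gamma> (path_space N) snd = distr \<gamma> (path_space N) (\<lambda>z. initial N (snd z))"
    by (rule distr_cong) (simp_all add: initial_id spN)
  then have s\<nu>: "distr \<gamma> (path_space N) snd = \<nu>" by (simp add: snd_law idN \<nu>)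
  have cpl: "\<gamma> \<in> couplings N \<mu> \<nu>" using \<gamma> f\<mu> s\<nu> by (simp add: couplings_def)
  have sw: "prod.swap \<in> \<gamma> \<rightarrow>\<^sub>M pair_space N" unfolding measurable_cong_sets[OF s refl] by (rule measurable_swap)
  have "distr \<gamma> (pair_space N) prod.swap \<in> couplings N \<nu> \<mu>"
    using prob_space_distr[OF sw] f\<mu> s\<nu>
    by (simp add: couplings_def space_prob_algebra distr_distr[OF measurable_fst sw] distr_distr[OF measurable_snd sw] comp_def)
  moreover have "nonanticipative N l (distr \<gamma> (pair_space N) prod.swap)"
    by (rule nonanticipative_distrI[OF ps sw i measurable_swap _ _ _ lm, where L="\<lambda>t h. distr (K t h) borel snd"])
      (auto simp: K2 elim: eventually_mono[OF AE_K])
  ultimately have 2: "distr \<gamma> (pair_space N) prod.swap \<in> causal_couplings N \<nu> \<mu>"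
    using lm by (rule nonanticipative_imp_causal)
  have "nonanticipative N k (distr \<gamma> (pair_space N) (\<lambda>z. z))"
    by (rule nonanticipative_distrI[OF ps _ i measurable_ident_sets[OF refl] _ _ _ km, where L="\<lambda>t h. distr (K t h) borel fst"])
      (auto simp: K1 measurable_ident_sets[OF s] elim: eventually_mono[OF AE_K])
  then have "nonanticipative N k \<gamma>" by (simp add: distr_id2[OF s[symmetric]])
  from nonanticipative_imp_causal[OF cpl this km] 2
  show "\<gamma> \<in> bicausal_couplings N \<mu> \<nu>" by (simp add: bicausal_couplings_def)
  show "\<And>t. t \<le> N \<Longrightarrow> distr \<gamma> (path_space t) (\<lambda>z. initial t (fst z)) = distr \<mu> (path_space t) (initial t)"
    by (rule fst_law)
  show "\<And>t. t \<le> N \<Longrightarrow> distr \<gamma> (path_space t) (\<lambda>z. initial t (snd z)) = distr \<nu> (path_space t) (initial t)"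
    by (rule snd_law)
qed

section \<open>Composition of transition kernels\<close>

definition extend2 :: "nat \<Rightarrow> (nat \<Rightarrow> real) \<times> (nat \<Rightarrow> real) \<Rightarrow> real \<times> real \<Rightarrow> (nat \<Rightarrow> real) \<times> (nat \<Rightarrow> real)" where
  "extend2 t z p = ((fst z)(Suc t := fst p), (snd z)(Suc t := snd p))"

text \<open>The Ionescu-Tulcea construction over finitely many steps.\<close>

primrec seq_law :: "(nat \<Rightarrow> (nat \<Rightarrow> real) \<times> (nat \<Rightarrow> real) \<Rightarrow> (real \<times> real) measure) \<Rightarrow> nat \<Rightarrow>
    ((nat \<Rightarrow> real) \<times> (nat \<Rightarrow> real)) measure" where
  "seq_law K 0 = return (pair_space 0) (\<lambda>_. undefined, \<lambda>_. undefined)"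
| "seq_law K (Suc t) = seq_law K t \<bind> (\<lambda>z. distr (K t z) (pair_space (Suc t)) (extend2 t z))"

lemma measurable_extend2:
  "(\<lambda>q. extend2 t (fst q) (snd q)) \<in> pair_space t \<Otimes>\<^sub>M (borel \<Otimes>\<^sub>M borel) \<rightarrow>\<^sub>M pair_space (Suc t)"
  unfolding extend2_def by (intro measurable_Pair measurable_extend) measurable

context
  fixes N :: nat and K :: "nat \<Rightarrow> (nat \<Rightarrow> real) \<times> (nat \<Rightarrow> real) \<Rightarrow> (real \<times> real) measure"
  assumes K: "\<And>t. t < N \<Longrightarrow> K t \<in> pair_space t \<rightarrow>\<^sub>M prob_algebra (borel \<Otimes>\<^sub>M borel)"
begin

lemma measurable_seq_step:
  "t < N \<Longrightarrow> (\<lambda>z. distr (K t z) (pair_space (Suc t)) (extend2 t z)) \<in> pair_space t \<rightarrow>\<^sub>M prob_algebra (pair_space (Suc t))"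
  by (rule measurable_distr_prob_space2[OF K]) (use measurable_extend2 in \<open>simp_all add: split_beta'\<close>)

lemma seq_law_in_space: "t \<le> N \<Longrightarrow> seq_law K t \<in> space (prob_algebra (pair_space t))"
proof (induction t)
  case 0
  have "(\<lambda>_. undefined, \<lambda>_. undefined) \<in> space (pair_space 0)"
    by (simp add: space_pair_measure space_path_space)
  then show ?case by (simp add: space_prob_algebra prob_space_return)
next
  case (Suc t)
  then have t: "t < N" "seq_law K t \<in> space (prob_algebra (pair_space t))" by auto
  show ?case
    using prob_space_bind'[OF t(2) measurable_seq_step[OF t(1)]] sets_bind'[OF t(2) measurable_seq_step[OF t(1)]]
    by (simp add: space_prob_algebra)
qed

lemma nn_integral_seq_law_Suc:
  assumes t: "t < N" and f: "f \<in> borel_measurable (pair_space (Suc t))"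
  shows "(\<integral>\<^sup>+z. f z \<partial>seq_law K (Suc t)) = (\<integral>\<^sup>+z. \<integral>\<^sup>+p. f (extend2 t z p) \<partial>K t z \<partial>seq_law K t)"
proof -
  have sl: "seq_law K t \<in> space (prob_algebra (pair_space t))" by (rule seq_law_in_space) (use t in simp)
  then have ss: "sets (seq_law K t) = sets (pair_space t)" by (simp add: space_prob_algebra)
  have "(\<integral>\<^sup>+z. f z \<partial>seq_law K (Suc t)) =
      (\<integral>\<^sup>+z. \<integral>\<^sup>+w. f w \<partial>distr (K t z) (pair_space (Suc t)) (extend2 t z) \<partial>seq_law K t)"
    unfolding seq_law.simps
    by (rule nn_integral_bind[OF f]) (use measurable_prob_algebraD[OF measurable_seq_step[OF t]] in \<open>simp add: measurable_cong_sets[OF ss refl]\<close>)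
  also have "\<dots> = (\<integral>\<^sup>+z. \<integral>\<^sup>+p. f (extend2 t z p) \<partial>K t z \<partial>seq_law K t)"
  proof (rule nn_integral_cong)
    fix z assume "z \<in> space (seq_law K t)"
    then have z: "z \<in> space (pair_space t)" by (simp add: sets_eq_imp_space_eq[OF ss])
    have "extend2 t z \<in> K t z \<rightarrow>\<^sub>M pair_space (Suc t)"
      unfolding measurable_cong_sets[OF sets_kernel_prob(1)[OF K[OF t] z] refl]
      using measurable_compose[OF measurable_Pair1'[OF z] measurable_extend2[of t]] by simp
    then show "(\<integral>\<^sup>+w. f w \<partial>distr (K t z) (pair_space (Suc t)) (extend2 t z)) = (\<integral>\<^sup>+p. f (extend2 t z p) \<partial>K t z)"
      by (rule nn_integral_distr) (use f in simp)
  qed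
  finally show ?thesis .
qed

lemma nn_integral_seq_law_initials:
  assumes f: "f \<in> borel_measurable (pair_space s)"
  shows "s + j \<le> N \<Longrightarrow> (\<integral>\<^sup>+z. f (initials s z) \<partial>seq_law K (s + j)) = (\<integral>\<^sup>+z. f z \<partial>seq_law K s)"
proof (induction j)
  case 0
  then have "seq_law K s \<in> space (prob_algebra (pair_space s))" by (intro seq_law_in_space) simp
  then have ss: "sets (seq_law K s) = sets (pair_space s)" by (simp add: space_prob_algebra)
  show ?case unfolding add_0_right
    by (rule nn_integral_cong) (auto simp: sets_eq_imp_space_eq[OF ss] space_pair_measure initial_id)
next
  case (Suc j)
  then have t: "s + j < N" "s + j \<le> N" by auto
  then have sl: "seq_law K (s + j) \<in> space (prob_algebra (pair_space (s + j)))" by (intro seq_law_in_space) simp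
  then have ss: "sets (seq_law K (s + j)) = sets (pair_space (s + j))" by (simp add: space_prob_algebra)
  have fm: "(\<lambda>z. f (initials s z)) \<in> borel_measurable (pair_space (Suc (s + j)))"
    by (rule measurable_compose[OF measurable_initials f]) simp
  have "(\<integral>\<^sup>+z. f (initials s z) \<partial>seq_law K (s + Suc j)) =
    (\<integral>\<^sup>+z. \<integral>\<^sup>+p. f (initials s (extend2 (s + j) z p)) \<partial>K (s + j) z \<partial>seq_law K (s + j))"
    using nn_integral_seq_law_Suc[OF t(1) fm] by simp
  also have "\<dots> = (\<integral>\<^sup>+z. f (initials s z) \<partial>seq_law K (s + j))"
  proof (rule nn_integral_cong)
    fix z assume "z \<in> space (seq_law K (s + j))"
    then have z: "z \<in> space (pair_space (s + j))" by (simp add: sets_eq_imp_space_eq[OF ss])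
    interpret k: prob_space "K (s + j) z" by (rule sets_kernel_prob(3)[OF K[OF t(1)] z])
    show "(\<integral>\<^sup>+p. f (initials s (extend2 (s + j) z p)) \<partial>K (s + j) z) = f (initials s z)"
      by (simp add: extend2_def initial_extend k.emeasure_space_1)
  qed
  finally show ?case using Suc.IH[OF t(2)] by simp
qed

lemma cond_law_seq_law:
  assumes t: "t < N"
  shows "is_cond_law (seq_law K N) (pair_space t) (initials t) (borel \<Otimes>\<^sub>M borel)
           (\<lambda>z. (fst z (Suc t), snd z (Suc t))) (K t)"
proof -
  have sl: "seq_law K N \<in> space (prob_algebra (pair_space N))" by (rule seq_law_in_space) simp
  then have ss[measurable_cong]: "sets (seq_law K N) = sets (pair_space N)" by (simp add: space_prob_algebra)
  have sl: "seq_law K t \<in> space (prob_algebra (pair_space t))" by (rule seq_law_in_space) (use t in simp)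
  then have sst: "sets (seq_law K t) = sets (pair_space t)" by (simp add: space_prob_algebra)
  have i: "initials n \<in> seq_law K N \<rightarrow>\<^sub>M pair_space n" if "n \<le> N" for n
    unfolding measurable_cong_sets[OF ss refl] by (rule measurable_initials) fact
  have c: "(\<lambda>z. (fst z (Suc t), snd z (Suc t))) \<in> pair_space n \<rightarrow>\<^sub>M borel \<Otimes>\<^sub>M borel" if "t < n" for n
    by (intro measurable_Pair measurable_compose[OF measurable_fst measurable_coordinate]
        measurable_compose[OF measurable_snd measurable_coordinate]) (use that in auto)
  show ?thesis
  proof (rule is_cond_lawI[OF i K])
    fix A B assume A[measurable]: "A \<in> sets (pair_space t)" and B[measurable]: "B \<in> sets (borel \<Otimes>\<^sub>M borel :: (real \<times> real) measure)"
    define f where "f z = (indicator A (initials t z) * indicator B (fst z (Suc t), snd z (Suc t)) :: ennreal)" for z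
    have fm: "f \<in> borel_measurable (pair_space (Suc t))"
      unfolding f_def
      by (intro borel_measurable_times_ennreal measurable_compose[OF measurable_initials borel_measurable_indicator]
        measurable_compose[OF c borel_measurable_indicator]) (use A B in auto)
    have gm: "(\<lambda>z. indicator A z * emeasure (K t z) B) \<in> borel_measurable (pair_space t)"
      by (intro borel_measurable_times_ennreal borel_measurable_indicator A measurable_emeasure_kernel[OF K[OF t] B])
    have set: "{z\<in>space (seq_law K N). initials t z \<in> A \<and> (fst z (Suc t), snd z (Suc t)) \<in> B} \<in> sets (seq_law K N)"
    proof -
      have "{z\<in>space (seq_law K N). initials t z \<in> A \<and> (fst z (Suc t), snd z (Suc t)) \<in> B} =
        (initials t -` A \<inter> space (seq_law K N)) \<inter> ((\<lambda>z. (fst z (Suc t), snd z (Suc t))) -` B \<inter> space (seq_law K N))" by auto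
      moreover have "(\<lambda>z. (fst z (Suc t), snd z (Suc t))) -` B \<inter> space (seq_law K N) \<in> sets (seq_law K N)"
        by (rule measurable_sets[OF _ B]) (use c[OF t] measurable_cong_sets[OF ss refl] in simp)
      ultimately show ?thesis using measurable_sets[OF i A] t by auto
    qed
    have "emeasure (seq_law K N) {z\<in>space (seq_law K N). initials t z \<in> A \<and> (fst z (Suc t), snd z (Suc t)) \<in> B} =
       (\<integral>\<^sup>+z. indicator {z\<in>space (seq_law K N). initials t z \<in> A \<and> (fst z (Suc t), snd z (Suc t)) \<in> B} z \<partial>seq_law K N)"
      by (rule nn_integral_indicator[symmetric, OF set])
    also have "\<dots> = (\<integral>\<^sup>+z. f (initials (Suc t) z) \<partial>seq_law K (Suc t + (N - Suc t)))"
    proof -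
      have "Suc t + (N - Suc t) = N" using t by simp
      moreover have "f (initials (Suc t) z) = f z" for z
        by (simp add: f_def initial_initial) (simp add: initial_def)
      ultimately show ?thesis by (auto intro!: nn_integral_cong simp: f_def indicator_def)
    qed
    also have "\<dots> = (\<integral>\<^sup>+z. f z \<partial>seq_law K (Suc t))"
      by (rule nn_integral_seq_law_initials[OF fm]) (use t in simp)
    also have "\<dots> = (\<integral>\<^sup>+z. \<integral>\<^sup>+p. f (extend2 t z p) \<partial>K t z \<partial>seq_law K t)"
      by (rule nn_integral_seq_law_Suc[OF t fm])
    also have "\<dots> = (\<integral>\<^sup>+z. indicator A z * emeasure (K t z) B \<partial>seq_law K t)"
    proof (rule nn_integral_cong)
      fix z assume "z \<in> space (seq_law K t)"
      then have z: "z \<in> space (pair_space t)" by (simp add: sets_eq_imp_space_eq[OF sst])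
      then have "initials t z = z" by (auto simp: space_pair_measure initial_id)
      then have "f (extend2 t z p) = indicator A z * indicator B p" for p
        by (simp add: f_def extend2_def initial_extend)
      then show "(\<integral>\<^sup>+p. f (extend2 t z p) \<partial>K t z) = indicator A z * emeasure (K t z) B"
        using sets_kernel_prob(1)[OF K[OF t] z] B by (simp add: nn_integral_cmult_indicator)
    qed
    also have "\<dots> = (\<integral>\<^sup>+z. indicator A (initials t z) * emeasure (K t (initials t z)) B \<partial>seq_law K (t + (N - t)))"
      by (rule nn_integral_seq_law_initials[OF gm, symmetric]) (use t in simp)
    finally show "emeasure (seq_law K N) {z\<in>space (seq_law K N). initials t z \<in> A \<and> (fst z (Suc t), snd z (Suc t)) \<in> B} =
      (\<integral>\<^sup>+z. indicator A (initials t z) * emeasure (K t (initials t z)) B \<partial>seq_law K N)"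
      using t by simp
  qed (use t in auto)
qed

end

section \<open>Further calculus of conditional laws\<close>

lemma cond_law_pullback:
  assumes g: "g \<in> M \<rightarrow>\<^sub>M M'" and X: "X \<in> M' \<rightarrow>\<^sub>M S" and Y: "Y \<in> M' \<rightarrow>\<^sub>M R"
    and \<kappa>: "is_cond_law (distr M M' g) S X R Y \<kappa>"
  shows "is_cond_law M S (\<lambda>z. X (g z)) R (\<lambda>z. Y (g z)) \<kappa>"
proof (rule is_cond_lawI)
  show "(\<lambda>z. X (g z)) \<in> M \<rightarrow>\<^sub>M S" by (rule measurable_compose[OF g X])
  show \<kappa>m: "\<kappa> \<in> S \<rightarrow>\<^sub>M prob_algebra R" using \<kappa> by (simp add: is_cond_law_def)
  fix A B assume A: "A \<in> sets S" and B: "B \<in> sets R"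
  have XA: "{z\<in>space M'. X z \<in> A \<and> Y z \<in> B} \<in> sets M'"
    using sets.Int[OF measurable_sets[OF X A] measurable_sets[OF Y B]]
    by (rule back_subst[of "\<lambda>S. S \<in> sets M'"]) auto
  have "emeasure M {z\<in>space M. X (g z) \<in> A \<and> Y (g z) \<in> B} =
    emeasure (distr M M' g) {z\<in>space (distr M M' g). X z \<in> A \<and> Y z \<in> B}"
    by (subst emeasure_distr[OF g]) (auto simp: XA intro!: arg_cong[where f="emeasure M"] dest: measurable_space[OF g])
  also have "\<dots> = (\<integral>\<^sup>+z. indicator A (X z) * emeasure (\<kappa> (X z)) B \<partial>distr M M' g)"
    by (rule is_cond_lawD[OF _ \<kappa> A B]) (use X in simp)
  also have "\<dots> = (\<integral>\<^sup>+z. indicator A (X (g z)) * emeasure (\<kappa> (X (g z))) B \<partial>M)"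
  proof (rule nn_integral_distr[OF g])
    have "(\<lambda>x. indicator A x * emeasure (\<kappa> x) B) \<in> borel_measurable S"
      by (intro borel_measurable_times_ennreal borel_measurable_indicator A measurable_emeasure_kernel[OF \<kappa>m B])
    from measurable_compose[OF X this]
    show "(\<lambda>z. indicator A (X z) * emeasure (\<kappa> (X z)) B) \<in> borel_measurable (distr M M' g)" by simp
  qed
  finally show "emeasure M {z\<in>space M. X (g z) \<in> A \<and> Y (g z) \<in> B} =
    (\<integral>\<^sup>+z. indicator A (X (g z)) * emeasure (\<kappa> (X (g z))) B \<partial>M)" .
qed

lemma ex_cond_law_pair:
  fixes Y Z :: "'a \<Rightarrow> real"
  assumes ps: "prob_space M" and X[measurable]: "X \<in> M \<rightarrow>\<^sub>M S"
    and Y[measurable]: "Y \<in> borel_measurable M" and Z[measurable]: "Z \<in> borel_measurable M"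
  shows "\<exists>\<kappa>. is_cond_law M S X (borel \<Otimes>\<^sub>M borel) (\<lambda>z. (Y z, Z z)) \<kappa>"
proof -
  obtain \<kappa> where \<kappa>: "is_cond_law M S X borel Y \<kappa>" using ex_cond_law[OF ps X Y] by blast
  have "(\<lambda>z. (X z, Y z)) \<in> M \<rightarrow>\<^sub>M S \<Otimes>\<^sub>M borel" by measurable
  from ex_cond_law[OF ps this Z] obtain l
    where l: "is_cond_law M (S \<Otimes>\<^sub>M borel) (\<lambda>z. (X z, Y z)) borel Z l" by blast
  show ?thesis using cond_law_pair[OF ps X Y Z \<kappa> l] by blast
qed

section \<open>Increments\<close>

text \<open>The position from which the next increment starts; the first increment starts at \<open>0\<close>.\<close>

definition level :: "nat \<Rightarrow> (nat \<Rightarrow> real) \<Rightarrow> real" where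
  "level t x = (if t = 0 then 0 else x t)"

lemma increment_Suc: "increment (Suc t) x = x (Suc t) - level t x"
  by (simp add: increment_def level_def)

lemma level_initial: "level t (initial t x) = level t x"
  by (simp add: level_def initial_def)

lemma measurable_level: "t \<le> n \<Longrightarrow> level t \<in> borel_measurable (path_space n)"
  unfolding level_def using measurable_coordinate[of t n] by (cases "t = 0") auto

lemma measurable_increment: "t < n \<Longrightarrow> increment (Suc t) \<in> borel_measurable (path_space n)"
  unfolding increment_Suc by (intro borel_measurable_diff measurable_coordinate measurable_level) auto

lemma sum_increments: "1 \<le> s \<Longrightarrow> (\<Sum>r=1..s. increment r x) = x s"
proof (induction s rule: nat_induct_at_least)
  case (Suc s)
  then show ?case by (simp add: increment_Suc level_def)
qed (simp add: increment_def)

text \<open>The past of the path is a function of the past increments, namely their partial sums.\<close>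

lemma independent_increment:
  assumes \<mu>: "\<mu> \<in> path_laws N" and ind: "independent_increments N \<mu>" and t: "t < N"
  shows "is_cond_law \<mu> (path_space t) (initial t) borel (increment (Suc t)) (\<lambda>_. distr \<mu> borel (increment (Suc t)))"
proof -
  interpret prob_space \<mu> by (rule path_laws_prob[OF \<mu>])
  have "indep_vars (\<lambda>_. borel) increment {1..N}" using ind by (simp add: independent_increments_def)
  from indep_var_restrict[OF this, of "{1..t}" "{Suc t}"] t
  have 1: "indep_var (PiM {1..t} (\<lambda>_. borel)) (\<lambda>x. \<lambda>i\<in>{1..t}. increment i x)
        (PiM {Suc t} (\<lambda>_. borel)) (\<lambda>x. \<lambda>i\<in>{Suc t}. increment i x)" by auto
  define cum :: "(nat \<Rightarrow> real) \<Rightarrow> nat \<Rightarrow> real" where "cum d = (\<lambda>s\<in>{1..t}. \<Sum>r=1..s. d r)" for d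
  have cum: "cum \<in> PiM {1..t} (\<lambda>_. borel) \<rightarrow>\<^sub>M path_space t"
    unfolding cum_def path_space_def
    by (rule measurable_restrict, rule borel_measurable_sum, rule measurable_component_singleton) auto
  have "cum \<circ> (\<lambda>x. \<lambda>i\<in>{1..t}. increment i x) = initial t"
  proof (rule ext, rule ext)
    fix x s
    show "(cum \<circ> (\<lambda>x. \<lambda>i\<in>{1..t}. increment i x)) x s = initial t x s"
    proof (cases "s \<in> {1..t}")
      case True
      then have "(\<Sum>r=1..s. (\<lambda>i\<in>{1..t}. increment i x) r) = (\<Sum>r=1..s. increment r x)"
        by (intro sum.cong) auto
      then show ?thesis using True sum_increments[of s x] by (auto simp: cum_def initial_def)
    qed (auto simp: cum_def initial_def)
  qed
  then have iv: "indep_var (path_space t) (initial t) (PiM {Suc t} (\<lambda>_. borel)) (\<lambda>x. \<lambda>i\<in>{Suc t}. increment i x)"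
    using indep_var_compose[OF 1 cum measurable_ident] by simp
  have m: "initial t \<in> \<mu> \<rightarrow>\<^sub>M path_space t" "increment (Suc t) \<in> borel_measurable \<mu>"
    using measurable_initial[of t N] measurable_increment[OF t] t by (simp_all add: path_laws_measurable[OF \<mu>])
  have pd: "distr \<mu> borel (increment (Suc t)) \<in> space (prob_algebra borel)"
    using prob_space_distr[OF m(2)] by (simp add: space_prob_algebra)
  show ?thesis
  proof (rule is_cond_lawI[OF m(1)])
    show "(\<lambda>_. distr \<mu> borel (increment (Suc t))) \<in> path_space t \<rightarrow>\<^sub>M prob_algebra borel"
      by (rule measurable_const[OF pd])
    fix A B assume A: "A \<in> sets (path_space t)" and B: "B \<in> sets (borel :: real measure)"
    define D where "D = (\<lambda>d. d (Suc t)) -` B \<inter> space (PiM {Suc t} (\<lambda>_. borel :: real measure))"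
    have D: "D \<in> sets (PiM {Suc t} (\<lambda>_. borel))"
      unfolding D_def
      by (rule measurable_sets[OF measurable_component_singleton[where M=\<open>\<lambda>_. borel\<close>] B]) simp
    define W where "W x = (\<lambda>i\<in>{Suc t}. increment i x)" for x
    have W: "W x \<in> D \<longleftrightarrow> increment (Suc t) x \<in> B" for x
      by (simp add: W_def D_def space_PiM)
    have "{x\<in>space \<mu>. initial t x \<in> A \<and> increment (Suc t) x \<in> B} = (\<lambda>x. (initial t x, W x)) -` (A \<times> D) \<inter> space \<mu>"
      using W by auto
    moreover have "W -` D \<inter> space \<mu> = increment (Suc t) -` B \<inter> space \<mu>"
      using W by auto
    ultimately have "emeasure \<mu> {x\<in>space \<mu>. initial t x \<in> A \<and> increment (Suc t) x \<in> B} =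
      emeasure \<mu> (initial t -` A \<inter> space \<mu>) * emeasure \<mu> (increment (Suc t) -` B \<inter> space \<mu>)"
      using indep_varD[OF iv[folded W_def] A D] by (simp add: emeasure_eq_measure ennreal_mult)
    also have "emeasure \<mu> (increment (Suc t) -` B \<inter> space \<mu>) = emeasure (distr \<mu> borel (increment (Suc t))) B"
      by (rule emeasure_distr[OF m(2) B, symmetric])
    also have "emeasure \<mu> (initial t -` A \<inter> space \<mu>) = (\<integral>\<^sup>+x. indicator A (initial t x) \<partial>\<mu>)"
      by (rule emeasure_vimage_eq_nn_integral[OF m(1) A])
    also have "\<dots> * emeasure (distr \<mu> borel (increment (Suc t))) B =
      (\<integral>\<^sup>+x. indicator A (initial t x) * emeasure (distr \<mu> borel (increment (Suc t))) B \<partial>\<mu>)"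
      by (rule nn_integral_multc[symmetric], rule measurable_compose[OF m(1)]) (use A in simp)
    finally show "emeasure \<mu> {x\<in>space \<mu>. initial t x \<in> A \<and> increment (Suc t) x \<in> B} =
      (\<integral>\<^sup>+x. indicator A (initial t x) * emeasure (distr \<mu> borel (increment (Suc t))) B \<partial>\<mu>)" .
  qed
qed

lemma cond_law_coordinate_of_increment:
  assumes ps: "prob_space M" and X: "X \<in> M \<rightarrow>\<^sub>M path_space N" and t: "t < N"
    and \<kappa>: "is_cond_law M (path_space t) (\<lambda>z. initial t (X z)) borel (\<lambda>z. increment (Suc t) (X z)) \<kappa>"
  shows "is_cond_law M (path_space t) (\<lambda>z. initial t (X z)) borel (\<lambda>z. X z (Suc t))
    (\<lambda>x. distr (\<kappa> x) borel (\<lambda>d. level t x + d))"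
proof -
  have i: "(\<lambda>z. initial t (X z)) \<in> M \<rightarrow>\<^sub>M path_space t"
    by (rule measurable_compose[OF X measurable_initial]) (use t in simp)
  have c: "(\<lambda>z. increment (Suc t) (X z)) \<in> borel_measurable M"
    by (rule measurable_compose[OF X measurable_increment[OF t]])
  have h: "(\<lambda>q. level t (fst q) + snd q) \<in> path_space t \<Otimes>\<^sub>M borel \<rightarrow>\<^sub>M borel"
    by (intro borel_measurable_add measurable_compose[OF measurable_fst measurable_level] measurable_snd) simp
  show ?thesis using cond_law_transform[OF ps i c \<kappa> h] by (simp add: level_initial increment_Suc)
qed

section \<open>Increments under causal couplings\<close>

text \<open>
  Padding a path of length \<open>t\<close> with zeros gives a measurable section of the projection to the first \<open>t\<close>
  coordinates, and \<open>g\<close> cannot distinguish two paths with the same projection.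
\<close>

lemma past_measurable_factor:
  assumes g: "g \<in> borel_measurable (past N t)" and t: "t \<le> N"
  obtains G :: "(nat \<Rightarrow> real) \<Rightarrow> real" where "G \<in> borel_measurable (path_space t)"
    "\<And>x. x \<in> space (path_space N) \<Longrightarrow> g x = G (initial t x)"
proof
  define e :: "(nat \<Rightarrow> real) \<Rightarrow> nat \<Rightarrow> real" where "e x = (\<lambda>i\<in>{1..N}. if i \<le> t then x i else 0)" for x
  have sp: "space (past N t) = space (path_space N)" by (simp add: past_def)
  have e_space: "e x \<in> space (path_space N)" for x by (simp add: e_def space_path_space)
  have ie: "initial t (e x) = x" if "x \<in> space (path_space t)" for x
    using that t by (auto simp: initial_def e_def fun_eq_iff restrict_def space_path_space extensional_def)
  have em: "e \<in> path_space t \<rightarrow>\<^sub>M past N t"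
    unfolding past_def restrict_eq_initial
  proof (rule measurable_vimage_algebra2)
    show "(\<lambda>x. initial t (e x)) \<in> path_space t \<rightarrow>\<^sub>M path_space t"
      using ie by (subst measurable_cong[where g="\<lambda>x. x"]) auto
  qed (use e_space in auto)
  show "(\<lambda>x. g (e x)) \<in> borel_measurable (path_space t)" by (rule measurable_compose[OF em g])
  fix x assume x: "x \<in> space (path_space N)"
  have "g -` {g x} \<inter> space (past N t) \<in> sets (past N t)" by (rule measurable_sets[OF g]) simp
  then obtain D where D: "g -` {g x} \<inter> space (past N t) = initial t -` D \<inter> space (path_space N)"
    unfolding past_def restrict_eq_initial by (auto simp: sets_vimage_algebra2 initial_in_space)
  have "x \<in> g -` {g x} \<inter> space (past N t)" using x sp by simp
  then have "initial t x \<in> D" unfolding D by simp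
  then have "e (initial t x) \<in> initial t -` D \<inter> space (path_space N)"
    by (simp add: ie[OF initial_in_space] e_space)
  then show "g x = g (e (initial t x))" unfolding D[symmetric] by simp
qed

text \<open>
  By causality, the conditional probability of an event \<open>B\<close> for the past of the second path, given the
  whole first path, is a function \<open>G\<close> of the past of the first path. That past is independent of the next
  increment of the first path, and integrating out gives a product.
\<close>

lemma causal_increment_independent:
  assumes \<mu>: "\<mu> \<in> path_laws N" and ind: "independent_increments N \<mu>" and t: "t < N"
    and \<gamma>: "\<gamma> \<in> causal_couplings N \<mu> \<nu>"
  shows "is_cond_law \<gamma> (path_space t) (\<lambda>z. initial t (snd z)) borel (\<lambda>z. increment (Suc t) (fst z))
    (\<lambda>_. distr \<mu> borel (increment (Suc t)))"
proof -
  let ?p = "distr \<mu> borel (increment (Suc t))"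
  have cpl: "\<gamma> \<in> couplings N \<mu> \<nu>" using \<gamma> by (simp add: causal_couplings_def)
  note D = couplingsD[OF cpl]
  interpret prob_space \<gamma> by (rule D)
  interpret \<mu>: prob_space \<mu> by (rule path_laws_prob[OF \<mu>])
  have \<mu>m: "initial t \<in> \<mu> \<rightarrow>\<^sub>M path_space t" "increment (Suc t) \<in> borel_measurable \<mu>"
    using measurable_initial[of t N] measurable_increment[OF t] t by (simp_all add: path_laws_measurable[OF \<mu>])
  have pd: "?p \<in> space (prob_algebra borel)"
    using \<mu>.prob_space_distr[OF \<mu>m(2)] by (simp add: space_prob_algebra)
  have i: "(\<lambda>z. initial t (snd z)) \<in> \<gamma> \<rightarrow>\<^sub>M path_space t"
    by (rule measurable_compose[OF D(5) measurable_initial]) (use t in simp)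
  obtain \<kappa> where \<kappa>: "is_cond_law \<gamma> (path_space N) fst (path_space N) snd \<kappa>"
    and caus: "\<forall>t\<in>{1..N}. \<forall>B\<in>sets (past N t). \<exists>g\<in>borel_measurable (past N t). AE x in \<mu>. measure (\<kappa> x) B = g x"
    using \<gamma> by (auto simp: causal_couplings_def)
  have \<kappa>m: "\<kappa> \<in> path_space N \<rightarrow>\<^sub>M prob_algebra (path_space N)" using \<kappa> by (simp add: is_cond_law_def)
  have sp\<mu>: "space \<mu> = space (path_space N)" by (rule sets_eq_imp_space_eq[OF path_laws_sets[OF \<mu>]])
  show ?thesis
  proof (rule is_cond_lawI[OF i])
    show "(\<lambda>_. ?p) \<in> path_space t \<rightarrow>\<^sub>M prob_algebra borel" by (rule measurable_const[OF pd])
    fix A C assume A: "A \<in> sets (path_space t)" and C: "C \<in> sets (borel :: real measure)"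
    define B where "B = initial t -` A \<inter> space (path_space N)"
    have BN: "B \<in> sets (path_space N)"
      unfolding B_def by (rule measurable_sets[OF measurable_initial A]) (use t in simp)
    have Bpast: "B \<in> sets (past N t)"
      unfolding past_def restrict_eq_initial B_def by (rule in_vimage_algebra[OF A])
    \<comment> \<open>Causality speaks of times \<open>t \<ge> 1\<close>; at time \<open>0\<close> every past event is trivial.\<close>
    have "\<exists>g\<in>borel_measurable (past N t). AE x in \<mu>. measure (\<kappa> x) B = g x"
    proof (cases "t = 0")
      case False then show ?thesis using caus t Bpast by auto
    next
      case True
      have "B = {} \<or> B = space (path_space N)" unfolding B_def True initial_0 by auto
      then show ?thesis
      proof
        assume "B = {}" then show ?thesis by (intro bexI[of _ "\<lambda>_. 0"]) auto
      next
        assume B: "B = space (path_space N)"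
        have "measure (\<kappa> x) B = 1" if "x \<in> space \<mu>" for x
          using prob_space.prob_space[OF sets_kernel_prob(3)[OF \<kappa>m]] sets_kernel_prob(2)[OF \<kappa>m] that sp\<mu> B by simp
        then show ?thesis by (intro bexI[of _ "\<lambda>_. 1"]) auto
      qed
    qed
    then obtain g where g: "g \<in> borel_measurable (past N t)" and gae: "AE x in \<mu>. measure (\<kappa> x) B = g x" by auto
    obtain G where G: "G \<in> borel_measurable (path_space t)"
      and gG: "\<And>x. x \<in> space (path_space N) \<Longrightarrow> g x = G (initial t x)"
      using past_measurable_factor[OF g] t by (metis less_imp_le)
    have ae: "AE x in \<mu>. emeasure (\<kappa> x) B = ennreal (G (initial t x))"
      using gae AE_space
    proof eventually_elim
      case (elim x)
      then have x: "x \<in> space (path_space N)" by (simp add: sp\<mu>)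
      interpret k: prob_space "\<kappa> x" by (rule sets_kernel_prob(3)[OF \<kappa>m x])
      show ?case using elim gG[OF x] by (simp add: k.emeasure_eq_measure)
    qed
    have eG: "(\<lambda>q. ennreal (G (fst q)) * indicator C' (snd q)) \<in> borel_measurable (path_space t \<Otimes>\<^sub>M borel)"
      if "C' \<in> sets borel" for C'
      by (intro borel_measurable_times_ennreal measurable_compose[OF measurable_fst measurable_compose[OF G measurable_ennreal]]
          measurable_compose[OF measurable_snd borel_measurable_indicator[OF that]])
    have key: "emeasure \<gamma> {z\<in>space \<gamma>. initial t (snd z) \<in> A \<and> increment (Suc t) (fst z) \<in> C'} =
       (\<integral>\<^sup>+x. ennreal (G (initial t x)) \<partial>\<mu>) * emeasure ?p C'" if C': "C' \<in> sets borel" for C'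
    proof -
      let ?A = "increment (Suc t) -` C' \<inter> space (path_space N)"
      have A': "?A \<in> sets (path_space N)" by (rule measurable_sets[OF measurable_increment[OF t] C'])
      have "{z\<in>space \<gamma>. initial t (snd z) \<in> A \<and> increment (Suc t) (fst z) \<in> C'} = {z\<in>space \<gamma>. fst z \<in> ?A \<and> snd z \<in> B}"
        by (auto simp: B_def D(3) space_pair_measure)
      also have "emeasure \<gamma> \<dots> = (\<integral>\<^sup>+x\<in>?A. emeasure (\<kappa> x) B \<partial>\<mu>)"
        unfolding D(6)[symmetric] using \<kappa> A' BN unfolding is_cond_law_def by blast
      also have "\<dots> = (\<integral>\<^sup>+x. (\<lambda>q. ennreal (G (fst q)) * indicator C' (snd q)) (initial t x, increment (Suc t) x) \<partial>\<mu>)"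
        by (rule nn_integral_cong_AE, use ae AE_space in eventually_elim) (auto simp: indicator_def sp\<mu>)
      also have "\<dots> = (\<integral>\<^sup>+x. \<integral>\<^sup>+d. (\<lambda>q. ennreal (G (fst q)) * indicator C' (snd q)) (initial t x, d) \<partial>?p \<partial>\<mu>)"
        by (rule cond_law_nn_integral[OF \<mu>.prob_space_axioms \<mu>m independent_increment[OF \<mu> ind t] eG[OF C']])
      also have "\<dots> = (\<integral>\<^sup>+x. ennreal (G (initial t x)) * emeasure ?p C' \<partial>\<mu>)"
        using C' by (simp add: nn_integral_cmult_indicator)
      also have "\<dots> = (\<integral>\<^sup>+x. ennreal (G (initial t x)) \<partial>\<mu>) * emeasure ?p C'"
        by (rule nn_integral_multc) (rule measurable_compose[OF \<mu>m(1) measurable_compose[OF G measurable_ennreal]])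
      finally show ?thesis .
    qed
    have one: "emeasure ?p UNIV = 1"
      using prob_space.emeasure_space_1[OF \<mu>.prob_space_distr[OF \<mu>m(2)]] by simp
    have "(\<integral>\<^sup>+z. indicator A (initial t (snd z)) \<partial>\<gamma>) = emeasure \<gamma> {z\<in>space \<gamma>. initial t (snd z) \<in> A}"
      unfolding emeasure_vimage_eq_nn_integral[OF i A, symmetric]
      by (rule arg_cong[where f="emeasure \<gamma>"]) auto
    also have "\<dots> = (\<integral>\<^sup>+x. ennreal (G (initial t x)) \<partial>\<mu>)"
      using key[of UNIV] one by simp
    finally have "(\<integral>\<^sup>+z. indicator A (initial t (snd z)) \<partial>\<gamma>) = (\<integral>\<^sup>+x. ennreal (G (initial t x)) \<partial>\<mu>)" .
    moreover have "(\<integral>\<^sup>+z. indicator A (initial t (snd z)) * emeasure ?p C \<partial>\<gamma>) =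
       (\<integral>\<^sup>+z. indicator A (initial t (snd z)) \<partial>\<gamma>) * emeasure ?p C"
      by (rule nn_integral_multc) (rule measurable_compose[OF i borel_measurable_indicator[OF A]])
    ultimately show "emeasure \<gamma> {z\<in>space \<gamma>. initial t (snd z) \<in> A \<and> increment (Suc t) (fst z) \<in> C} =
      (\<integral>\<^sup>+z. indicator A (initial t (snd z)) * emeasure ?p C \<partial>\<gamma>)"
      using key[OF C] by simp
  qed
qed

section \<open>Transfer of increment costs\<close>

text \<open>
  Turns a law of increments into a law of next coordinates. The increments depend on the past of the
  second path only; the past of the first one enters through its last position.
\<close>

definition shift_kernel :: "nat \<Rightarrow> ((nat \<Rightarrow> real) \<Rightarrow> (real \<times> real) measure) \<Rightarrow>
    (nat \<Rightarrow> real) \<times> (nat \<Rightarrow> real) \<Rightarrow> (real \<times> real) measure" where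
  "shift_kernel t J z = distr (J (snd z)) (borel \<Otimes>\<^sub>M borel)
     (\<lambda>p. (level t (fst z) + fst p, level t (snd z) + snd p))"

lemma measurable_shift_kernel:
  assumes "J \<in> path_space t \<rightarrow>\<^sub>M prob_algebra (borel \<Otimes>\<^sub>M borel)"
  shows "shift_kernel t J \<in> pair_space t \<rightarrow>\<^sub>M prob_algebra (borel \<Otimes>\<^sub>M borel)"
  unfolding shift_kernel_def
proof (rule measurable_distr_prob_space2)
  show "(\<lambda>z. J (snd z)) \<in> pair_space t \<rightarrow>\<^sub>M prob_algebra (borel \<Otimes>\<^sub>M borel)"
    by (rule measurable_compose[OF measurable_snd assms])
  have l: "(\<lambda>q. level t (fst (fst q))) \<in> borel_measurable (pair_space t \<Otimes>\<^sub>M (borel \<Otimes>\<^sub>M borel :: (real \<times> real) measure))"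
    "(\<lambda>q. level t (snd (fst q))) \<in> borel_measurable (pair_space t \<Otimes>\<^sub>M (borel \<Otimes>\<^sub>M borel :: (real \<times> real) measure))"
    by (rule measurable_compose[OF _ measurable_level[OF order_refl]], measurable)+
  show "(\<lambda>(z, p). (level t (fst z) + fst p, level t (snd z) + snd p))
    \<in> pair_space t \<Otimes>\<^sub>M (borel \<Otimes>\<^sub>M borel) \<rightarrow>\<^sub>M borel \<Otimes>\<^sub>M borel"
    unfolding split_beta' by (intro measurable_Pair borel_measurable_add l) measurable
qed

lemma shift_kernel_marginals:
  assumes J: "J \<in> path_space t \<rightarrow>\<^sub>M prob_algebra (borel \<Otimes>\<^sub>M borel)" and y: "y \<in> space (path_space t)"
  shows "distr (shift_kernel t J (x, y)) borel fst = distr (distr (J y) borel fst) borel (\<lambda>d. level t x + d)"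
    "distr (shift_kernel t J (x, y)) borel snd = distr (distr (J y) borel snd) borel (\<lambda>d. level t y + d)"
proof -
  note [measurable_cong] = sets_kernel_prob(1)[OF J y]
  show "distr (shift_kernel t J (x, y)) borel fst = distr (distr (J y) borel fst) borel (\<lambda>d. level t x + d)"
    "distr (shift_kernel t J (x, y)) borel snd = distr (distr (J y) borel snd) borel (\<lambda>d. level t y + d)"
    unfolding shift_kernel_def by (simp_all add: distr_distr comp_def)
qed

lemma nn_integral_shift_kernel:
  assumes J: "J \<in> path_space t \<rightarrow>\<^sub>M prob_algebra (borel \<Otimes>\<^sub>M borel)" and y: "y \<in> space (path_space t)"
    and f: "f \<in> borel_measurable (borel \<Otimes>\<^sub>M borel)"
  shows "(\<integral>\<^sup>+p. f p \<partial>shift_kernel t J (x, y)) = (\<integral>\<^sup>+p. f (level t x + fst p, level t y + snd p) \<partial>J y)"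
proof -
  note [measurable_cong] = sets_kernel_prob(1)[OF J y]
  show ?thesis unfolding shift_kernel_def by (subst nn_integral_distr) (use f in simp_all)
qed

definition increment_kernel where
  "increment_kernel \<gamma> t J \<longleftrightarrow> is_cond_law \<gamma> (path_space t) (\<lambda>z. initial t (snd z)) (borel \<Otimes>\<^sub>M borel)
     (\<lambda>z. (increment (Suc t) (fst z), increment (Suc t) (snd z))) J"

text \<open>
  The first marginal is the law of an increment independent of the conditioning variable. The second
  one, shifted by the current position, is the conditional law of the next coordinate. Both follow from
  the uniqueness of conditional laws.
\<close>

lemma causal_increment_kernel:
  assumes \<mu>: "\<mu> \<in> path_laws N" and \<nu>: "\<nu> \<in> path_laws N" and ind: "independent_increments N \<mu>" and t: "t < N"
    and \<gamma>: "\<gamma> \<in> causal_couplings N \<mu> \<nu>"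
  obtains J where "increment_kernel \<gamma> t J"
    "AE y in distr \<nu> (path_space t) (initial t).
       distr (J y) borel fst = distr \<mu> borel (increment (Suc t)) \<and>
       distr (distr (J y) borel snd) borel (\<lambda>d. level t y + d) = next_law \<nu> t y"
proof -
  have cpl: "\<gamma> \<in> couplings N \<mu> \<nu>" using \<gamma> by (simp add: causal_couplings_def)
  note D = couplingsD[OF cpl]
  have i: "(\<lambda>z. initial t (snd z)) \<in> \<gamma> \<rightarrow>\<^sub>M path_space t"
    by (rule measurable_compose[OF D(5) measurable_initial]) (use t in simp)
  have c: "(\<lambda>z. increment (Suc t) (fst z)) \<in> borel_measurable \<gamma>" "(\<lambda>z. increment (Suc t) (snd z)) \<in> borel_measurable \<gamma>"
    by (rule measurable_compose[OF D(4) measurable_increment[OF t]], rule measurable_compose[OF D(5) measurable_increment[OF t]])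
  obtain J where J: "increment_kernel \<gamma> t J"
    using ex_cond_law_pair[OF D(1) i c] by (auto simp: increment_kernel_def)
  note J' = J[unfolded increment_kernel_def]
  have i': "initial t \<in> path_space N \<rightarrow>\<^sub>M path_space t" by (rule measurable_initial) (use t in simp)
  have law: "distr \<gamma> (path_space t) (\<lambda>z. initial t (snd z)) = distr \<nu> (path_space t) (initial t)"
    unfolding D(7)[symmetric] by (subst distr_distr[OF i' D(5)]) (simp add: comp_def)
  note c2 = measurable_Pair[OF c]
  have 1: "AE y in distr \<nu> (path_space t) (initial t). distr (J y) borel fst = distr \<mu> borel (increment (Suc t))"
    unfolding law[symmetric]
    using AE_cong_cond_law[OF D(1) i cond_law_map[OF D(1) i c2 J' measurable_fst, simplified]
        causal_increment_independent[OF \<mu> ind t \<gamma>]] .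
  have "is_cond_law \<gamma> (path_space t) (\<lambda>z. initial t (snd z)) borel (\<lambda>z. snd z (Suc t))
      (\<lambda>y. distr (distr (J y) borel snd) borel (\<lambda>d. level t y + d))"
    using cond_law_coordinate_of_increment[OF D(1) D(5) t cond_law_map[OF D(1) i c2 J' measurable_snd, simplified]] .
  moreover have "is_cond_law \<gamma> (path_space t) (\<lambda>z. initial t (snd z)) borel (\<lambda>z. snd z (Suc t)) (next_law \<nu> t)"
    by (rule cond_law_pullback[OF D(5) i']) (use next_law[OF \<nu> t] measurable_coordinate[of "Suc t" N] t D(7) in auto)
  ultimately have 2: "AE y in distr \<nu> (path_space t) (initial t).
      distr (distr (J y) borel snd) borel (\<lambda>d. level t y + d) = next_law \<nu> t y"
    unfolding law[symmetric] by (rule AE_cong_cond_law[OF D(1) i])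
  show thesis by (rule that[OF J]) (use 1 2 in eventually_elim, simp)
qed

text \<open>
  The cost of a step under \<open>\<gamma>'\<close> is first integrated against its kernel \<open>K\<close>, which may depend on both
  pasts, and then compared with the integral against \<open>J\<close>, which depends on the past of the second path
  only. That past has the same law under \<open>\<gamma>\<close> and \<open>\<gamma>'\<close>.
\<close>

lemma increment_cost_le:
  assumes \<gamma>: "\<gamma> \<in> couplings N \<mu> \<nu>" and t: "t < N" and J: "increment_kernel \<gamma> t J"
    and ps: "prob_space \<gamma>'" and s: "sets \<gamma>' = sets (pair_space N)"
    and K: "is_cond_law \<gamma>' (pair_space t) (initials t) (borel \<Otimes>\<^sub>M borel) (\<lambda>z. (fst z (Suc t), snd z (Suc t))) K"
    and law: "distr \<gamma>' (path_space t) (\<lambda>z. initial t (snd z)) = distr \<nu> (path_space t) (initial t)"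
    and f: "f \<in> borel_measurable (borel \<Otimes>\<^sub>M borel)"
    and le: "AE z in \<gamma>'. (\<integral>\<^sup>+p. f (fst p - level t (fst z), snd p - level t (snd z)) \<partial>K (initials t z))
       \<le> (\<integral>\<^sup>+p. f p \<partial>J (initial t (snd z)))"
  shows "(\<integral>\<^sup>+z. f (increment (Suc t) (fst z), increment (Suc t) (snd z)) \<partial>\<gamma>') \<le>
    (\<integral>\<^sup>+z. f (increment (Suc t) (fst z), increment (Suc t) (snd z)) \<partial>\<gamma>)"
proof -
  note D = couplingsD[OF \<gamma>]
  note J' = J[unfolded increment_kernel_def]
  have Jm: "J \<in> path_space t \<rightarrow>\<^sub>M prob_algebra (borel \<Otimes>\<^sub>M borel)" using J' by (simp add: is_cond_law_def)
  have i: "(\<lambda>z. initial t (snd z)) \<in> \<gamma> \<rightarrow>\<^sub>M path_space t"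
    by (rule measurable_compose[OF D(5) measurable_initial]) (use t in simp)
  have i': "(\<lambda>z. initial t (snd z)) \<in> \<gamma>' \<rightarrow>\<^sub>M path_space t"
    unfolding measurable_cong_sets[OF s refl]
    by (rule measurable_compose[OF measurable_snd measurable_initial]) (use t in simp)
  have ii: "initials t \<in> \<gamma>' \<rightarrow>\<^sub>M pair_space t"
    unfolding measurable_cong_sets[OF s refl] by (rule measurable_initials) (use t in simp)
  have cc: "(\<lambda>z. (fst z (Suc t), snd z (Suc t))) \<in> \<gamma>' \<rightarrow>\<^sub>M borel \<Otimes>\<^sub>M borel"
    unfolding measurable_cong_sets[OF s refl]
    by (intro measurable_Pair measurable_compose[OF measurable_fst measurable_coordinate]
        measurable_compose[OF measurable_snd measurable_coordinate]) (use t in auto)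
  have c: "(\<lambda>z. (increment (Suc t) (fst z), increment (Suc t) (snd z))) \<in> \<gamma> \<rightarrow>\<^sub>M borel \<Otimes>\<^sub>M borel"
    by (intro measurable_Pair measurable_compose[OF D(4) measurable_increment[OF t]]
        measurable_compose[OF D(5) measurable_increment[OF t]])
  have tm: "(\<lambda>y. \<integral>\<^sup>+p. f p \<partial>J y) \<in> borel_measurable (path_space t)"
    by (rule measurable_nn_integral_kernel[OF Jm]) (use f in simp)
  let ?g = "\<lambda>q. f (fst (snd q) - level t (fst (fst q)), snd (snd q) - level t (snd (fst q)))"
  have l: "(\<lambda>q. level t (fst (fst q))) \<in> borel_measurable (pair_space t \<Otimes>\<^sub>M (borel \<Otimes>\<^sub>M borel :: (real \<times> real) measure))"
    "(\<lambda>q. level t (snd (fst q))) \<in> borel_measurable (pair_space t \<Otimes>\<^sub>M (borel \<Otimes>\<^sub>M borel :: (real \<times> real) measure))"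
    by (rule measurable_compose[OF _ measurable_level[OF order_refl]], measurable)+
  have g: "?g \<in> borel_measurable (pair_space t \<Otimes>\<^sub>M (borel \<Otimes>\<^sub>M borel))"
    by (rule measurable_compose[OF _ f], intro measurable_Pair borel_measurable_diff l) measurable
  have "(\<integral>\<^sup>+z. f (increment (Suc t) (fst z), increment (Suc t) (snd z)) \<partial>\<gamma>') =
    (\<integral>\<^sup>+z. ?g (initials t z, (fst z (Suc t), snd z (Suc t))) \<partial>\<gamma>')"
    by (simp add: increment_Suc level_initial)
  also have "\<dots> = (\<integral>\<^sup>+z. \<integral>\<^sup>+p. ?g (initials t z, p) \<partial>K (initials t z) \<partial>\<gamma>')"
    by (rule cond_law_nn_integral[OF ps ii cc K g])
  also have "\<dots> \<le> (\<integral>\<^sup>+z. \<integral>\<^sup>+p. f p \<partial>J (initial t (snd z)) \<partial>\<gamma>')"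
    by (rule nn_integral_mono_AE) (use le in \<open>simp add: level_initial\<close>)
  also have "\<dots> = (\<integral>\<^sup>+y. \<integral>\<^sup>+p. f p \<partial>J y \<partial>distr \<gamma>' (path_space t) (\<lambda>z. initial t (snd z)))"
    by (rule nn_integral_distr[OF i', symmetric]) (use tm in simp)
  also have "distr \<gamma>' (path_space t) (\<lambda>z. initial t (snd z)) = distr \<gamma> (path_space t) (\<lambda>z. initial t (snd z))"
  proof -
    have i'': "initial t \<in> path_space N \<rightarrow>\<^sub>M path_space t" by (rule measurable_initial) (use t in simp)
    show ?thesis unfolding law D(7)[symmetric] by (subst distr_distr[OF i'' D(5)]) (simp add: comp_def)
  qed
  also have "(\<integral>\<^sup>+y. \<integral>\<^sup>+p. f p \<partial>J y \<partial>distr \<gamma> (path_space t) (\<lambda>z. initial t (snd z))) =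
     (\<integral>\<^sup>+z. \<integral>\<^sup>+p. f p \<partial>J (initial t (snd z)) \<partial>\<gamma>)"
    by (rule nn_integral_distr[OF i]) (use tm in simp)
  also have "\<dots> = (\<integral>\<^sup>+z. \<integral>\<^sup>+p. (\<lambda>q. f (snd q)) (initial t (snd z), p) \<partial>J (initial t (snd z)) \<partial>\<gamma>)" by simp
  also have "\<dots> = (\<integral>\<^sup>+z. (\<lambda>q. f (snd q)) (initial t (snd z), (increment (Suc t) (fst z), increment (Suc t) (snd z))) \<partial>\<gamma>)"
    by (rule cond_law_nn_integral[OF D(1) i c J', symmetric]) (rule measurable_compose[OF measurable_snd f])
  finally show ?thesis by simp
qed

section \<open>Causal couplings reduce to bicausal ones\<close>

lemma cond_law_of_independent_increments:
  assumes \<mu>: "\<mu> \<in> path_laws N" and ind: "independent_increments N \<mu>" and t: "t < N"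
  shows "is_cond_law \<mu> (path_space t) (initial t) borel (\<lambda>x. x (Suc t))
    (\<lambda>x. distr (distr \<mu> borel (increment (Suc t))) borel (\<lambda>d. level t x + d))"
proof -
  have "(\<lambda>x. x) \<in> \<mu> \<rightarrow>\<^sub>M path_space N" by (simp add: path_laws_measurable[OF \<mu>])
  from cond_law_coordinate_of_increment[OF path_laws_prob[OF \<mu>] this t] independent_increment[OF \<mu> ind t]
  show ?thesis by simp
qed

text \<open>
  The coupling that moves by the shifted kernels \<open>J\<close>. For it the comparison of costs in a step is an
  equality before integration.
\<close>

theorem bicausal_coupling_at_most_as_costly:
  assumes \<mu>: "\<mu> \<in> path_laws N" and \<nu>: "\<nu> \<in> path_laws N" and ind: "independent_increments N \<mu>"
    and \<gamma>: "\<gamma> \<in> causal_couplings N \<mu> \<nu>"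
  shows "\<exists>\<gamma>'\<in>bicausal_couplings N \<mu> \<nu>. \<forall>t<N. \<forall>f\<in>borel_measurable (borel \<Otimes>\<^sub>M borel).
      (\<integral>\<^sup>+z. f (increment (Suc t) (fst z), increment (Suc t) (snd z)) \<partial>\<gamma>') \<le>
      (\<integral>\<^sup>+z. f (increment (Suc t) (fst z), increment (Suc t) (snd z)) \<partial>\<gamma>)"
proof -
  have cpl: "\<gamma> \<in> couplings N \<mu> \<nu>" using \<gamma> by (simp add: causal_couplings_def)
  define good where "good t J \<longleftrightarrow> increment_kernel \<gamma> t J \<and> (AE y in distr \<nu> (path_space t) (initial t).
       distr (J y) borel fst = distr \<mu> borel (increment (Suc t)) \<and>
       distr (distr (J y) borel snd) borel (\<lambda>d. level t y + d) = next_law \<nu> t y)" for t J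
  have "\<exists>J. good t J" if t: "t < N" for t
    by (rule causal_increment_kernel[OF \<mu> \<nu> ind t \<gamma>]) (auto simp: good_def)
  then have "\<forall>t\<in>{..<N}. \<exists>J. good t J" by simp
  then obtain J where "\<forall>t\<in>{..<N}. good t (J t)" by (rule bchoice[THEN exE])
  then have J: "\<And>t. t < N \<Longrightarrow> increment_kernel \<gamma> t (J t)"
    and J_ae: "\<And>t. t < N \<Longrightarrow> AE y in distr \<nu> (path_space t) (initial t).
       distr (J t y) borel fst = distr \<mu> borel (increment (Suc t)) \<and>
       distr (distr (J t y) borel snd) borel (\<lambda>d. level t y + d) = next_law \<nu> t y"
    by (auto simp: good_def)
  have Jm: "J t \<in> path_space t \<rightarrow>\<^sub>M prob_algebra (borel \<Otimes>\<^sub>M borel)" if "t < N" for t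
    using J[OF that] by (simp add: increment_kernel_def is_cond_law_def)
  define K where "K t = shift_kernel t (J t)" for t
  have Km: "K t \<in> pair_space t \<rightarrow>\<^sub>M prob_algebra (borel \<Otimes>\<^sub>M borel)" if "t < N" for t
    unfolding K_def by (rule measurable_shift_kernel[OF Jm[OF that]])
  have sl: "seq_law K N \<in> space (prob_algebra (pair_space N))"
    by (rule seq_law_in_space[OF Km order_refl])
  then have ps: "prob_space (seq_law K N)" and s: "sets (seq_law K N) = sets (pair_space N)"
    by (auto simp: space_prob_algebra)
  have Kc: "is_cond_law (seq_law K N) (pair_space t) (initials t) (borel \<Otimes>\<^sub>M borel)
      (\<lambda>z. (fst z (Suc t), snd z (Suc t))) (K t)" if "t < N" for t
    by (rule cond_law_seq_law[OF Km that])
  have ae: "AE y in distr \<nu> (path_space t) (initial t). \<forall>x\<in>space (path_space t).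
      distr (K t (x, y)) borel fst = distr (distr \<mu> borel (increment (Suc t))) borel (\<lambda>d. level t x + d) \<and>
      distr (K t (x, y)) borel snd = next_law \<nu> t y" if t: "t < N" for t
    using J_ae[OF t] AE_space
  proof eventually_elim
    case (elim y)
    then have "y \<in> space (path_space t)" by simp
    note m = shift_kernel_marginals[OF Jm[OF t] this]
    show ?case using elim by (simp add: K_def m)
  qed
  note bi = bicausalI_cond_law[OF \<mu> \<nu> sl Kc cond_law_of_independent_increments[OF \<mu> ind] next_law[OF \<nu>] ae]
  show ?thesis
  proof (intro bexI[of _ "seq_law K N"] allI impI ballI)
    show "seq_law K N \<in> bicausal_couplings N \<mu> \<nu>" using bi(1) by blast
    fix t and f :: "real \<times> real \<Rightarrow> ennreal"
    assume t: "t < N" and f: "f \<in> borel_measurable (borel \<Otimes>\<^sub>M borel)"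
    show "(\<integral>\<^sup>+z. f (increment (Suc t) (fst z), increment (Suc t) (snd z)) \<partial>seq_law K N) \<le>
      (\<integral>\<^sup>+z. f (increment (Suc t) (fst z), increment (Suc t) (snd z)) \<partial>\<gamma>)"
    proof (rule increment_cost_le[OF cpl t J[OF t] ps s Kc[OF t] _ f])
      show "distr (seq_law K N) (path_space t) (\<lambda>z. initial t (snd z)) = distr \<nu> (path_space t) (initial t)"
        using bi(3) t by simp
      have "(\<integral>\<^sup>+p. f (fst p - level t (fst z), snd p - level t (snd z)) \<partial>K t (initials t z)) =
        (\<integral>\<^sup>+p. f p \<partial>J t (initial t (snd z)))" for z
        unfolding K_def
        by (subst nn_integral_shift_kernel[OF Jm[OF t] initial_in_space])
          (auto intro!: measurable_compose[OF _ f] simp: level_initial)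
      then show "AE z in seq_law K N. (\<integral>\<^sup>+p. f (fst p - level t (fst z), snd p - level t (snd z)) \<partial>K t (initials t z))
        \<le> (\<integral>\<^sup>+p. f p \<partial>J t (initial t (snd z)))" by simp
    qed
  qed
qed

section \<open>The Knothe-Rosenblatt rearrangement\<close>

definition KR_kernel :: "(nat \<Rightarrow> real) measure \<Rightarrow> (nat \<Rightarrow> real) measure \<Rightarrow> nat \<Rightarrow>
    (nat \<Rightarrow> real) \<times> (nat \<Rightarrow> real) \<Rightarrow> (real \<times> real) measure" where
  "KR_kernel \<mu> \<nu> t z = distr unif (borel \<Otimes>\<^sub>M borel)
     (\<lambda>u. (quantile (next_law \<mu> t (fst z)) u, quantile (next_law \<nu> t (snd z)) u))"

lemma quantile_path_cong:
  "(\<And>i. i \<in> {1..t} \<Longrightarrow> u i = u' i) \<Longrightarrow> quantile_path \<eta> u t = quantile_path \<eta> u' t"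
  by (induction t) auto

lemma quantile_path_in_space: "quantile_path \<eta> u t \<in> space (path_space t)"
  by (induction t) (auto simp: space_path_space extensional_def)

lemma initial_quantile_path: "s \<le> t \<Longrightarrow> initial s (quantile_path \<eta> u t) = quantile_path \<eta> u s"
proof (induction t)
  case 0 then show ?case by (simp add: initial_0)
next
  case (Suc t)
  show ?case
  proof (cases "s = Suc t")
    case True
    then show ?thesis by (simp only: initial_id[OF quantile_path_in_space])
  next
    case False
    then show ?thesis using Suc by (simp add: initial_extend del: fun_upd_apply)
  qed
qed

lemma measurable_into_unif: "M \<rightarrow>\<^sub>M unif = borel_measurable M"
  by (rule measurable_cong_sets) simp_all

lemma measurable_from_unif: "unif \<rightarrow>\<^sub>M N = borel \<rightarrow>\<^sub>M N"
  by (rule measurable_cong_sets) simp_all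

lemma measurable_quantile_path:
  assumes \<eta>: "\<eta> \<in> path_laws N" and n: "n \<le> N"
  shows "t \<le> n \<Longrightarrow> (\<lambda>u. quantile_path \<eta> u t) \<in> PiM {1..n} (\<lambda>_. unif) \<rightarrow>\<^sub>M path_space t"
proof (induction t)
  case 0 then show ?case by (simp add: space_path_space)
next
  case (Suc t)
  have q: "(\<lambda>u. quantile_path \<eta> u t) \<in> PiM {1..n} (\<lambda>_. unif) \<rightarrow>\<^sub>M path_space t"
    using Suc by simp
  have c: "(\<lambda>u. u (Suc t)) \<in> borel_measurable (PiM {1..n} (\<lambda>_. unif))"
  proof -
    have "(\<lambda>u. u (Suc t)) \<in> PiM {1..n} (\<lambda>_. unif) \<rightarrow>\<^sub>M unif"
      by (rule measurable_component_singleton) (use Suc in auto)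
    then show ?thesis unfolding measurable_into_unif .
  qed
  show ?case
    unfolding quantile_path.simps
    by (rule measurable_extend[OF q], rule measurable_quantile[OF measurable_compose[OF q] c], rule measurable_next_law[OF \<eta>])
      (use Suc n in simp)
qed

lemma measurable_KR_kernel:
  assumes "\<mu> \<in> path_laws N" "\<nu> \<in> path_laws N" "t < N"
  shows "KR_kernel \<mu> \<nu> t \<in> pair_space t \<rightarrow>\<^sub>M prob_algebra (borel \<Otimes>\<^sub>M borel)"
  unfolding KR_kernel_def
proof (rule measurable_distr_prob_space2)
  show "(\<lambda>z. unif) \<in> pair_space t \<rightarrow>\<^sub>M prob_algebra unif"
    by (rule measurable_const) (simp add: space_prob_algebra prob_space_unif)
  have u: "(\<lambda>q. snd q) \<in> borel_measurable (pair_space t \<Otimes>\<^sub>M unif)"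
    using measurable_snd[of "pair_space t" unif] unfolding measurable_into_unif .
  show "(\<lambda>(z, u). (quantile (next_law \<mu> t (fst z)) u, quantile (next_law \<nu> t (snd z)) u))
    \<in> pair_space t \<Otimes>\<^sub>M unif \<rightarrow>\<^sub>M borel \<Otimes>\<^sub>M borel"
    unfolding split_beta'
    by (intro measurable_Pair measurable_quantile[OF _ u]
        measurable_compose[OF measurable_compose[OF measurable_fst measurable_fst] measurable_next_law[OF assms(1,3)]]
        measurable_compose[OF measurable_compose[OF measurable_fst measurable_snd] measurable_next_law[OF assms(2,3)]])
qed

lemma next_law_real_distribution:
  assumes "\<eta> \<in> path_laws N" "t < N" "x \<in> space (path_space t)"
  shows "real_distribution (next_law \<eta> t x)"
  using measurable_space[OF measurable_next_law[OF assms(1,2)] assms(3)] by (simp add: real_distribution_iff)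

lemma KR_kernel_marginals:
  assumes "\<mu> \<in> path_laws N" "\<nu> \<in> path_laws N" "t < N" "x \<in> space (path_space t)" "y \<in> space (path_space t)"
  shows "distr (KR_kernel \<mu> \<nu> t (x, y)) borel fst = next_law \<mu> t x"
    "distr (KR_kernel \<mu> \<nu> t (x, y)) borel snd = next_law \<nu> t y"
proof -
  note r = next_law_real_distribution[OF assms(1,3,4)] next_law_real_distribution[OF assms(2,3,5)]
  have m: "(\<lambda>u. (quantile (next_law \<mu> t x) u, quantile (next_law \<nu> t y) u)) \<in> unif \<rightarrow>\<^sub>M borel \<Otimes>\<^sub>M borel"
    unfolding measurable_from_unif by (intro measurable_Pair measurable_quantile_level r)
  show "distr (KR_kernel \<mu> \<nu> t (x, y)) borel fst = next_law \<mu> t x"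
    "distr (KR_kernel \<mu> \<nu> t (x, y)) borel snd = next_law \<nu> t y"
    unfolding KR_kernel_def using distr_unif_quantile[OF r(1)] distr_unif_quantile[OF r(2)]
    by (simp_all add: distr_distr[OF _ m] comp_def)
qed

text \<open>
  Appending a coordinate \<open>u (Suc t)\<close> to the uniform variables does not change the paths up to time \<open>t\<close>,
  so the rearrangement is a Markov construction whose kernels are the monotone couplings.
\<close>

lemma quantile_paths_law:
  assumes \<mu>: "\<mu> \<in> path_laws N" and \<nu>: "\<nu> \<in> path_laws N"
  shows "t \<le> N \<Longrightarrow> distr (PiM {1..t} (\<lambda>_. unif)) (pair_space t) (\<lambda>u. (quantile_path \<mu> u t, quantile_path \<nu> u t)) =
    seq_law (KR_kernel \<mu> \<nu>) t"
proof (induction t)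
  case 0
  interpret p: prob_space "PiM {1..0::nat} (\<lambda>_. unif)" by (intro prob_space_PiM prob_space_unif)
  show ?case unfolding quantile_path.simps seq_law.simps
    by (rule p.distr_const) (simp add: space_pair_measure space_path_space)
next
  case (Suc t)
  then have t: "t < N" "t \<le> N" by auto
  interpret product_sigma_finite "\<lambda>_::nat. unif"
    by (rule product_sigma_finite.intro) (simp add: prob_space_imp_sigma_finite prob_space_unif)
  let ?P = "\<lambda>t. PiM {1..t} (\<lambda>_. unif)"
  let ?q = "\<lambda>t u. (quantile_path \<mu> u t, quantile_path \<nu> u t)"
  have qm: "?q n \<in> ?P n \<rightarrow>\<^sub>M pair_space n" if "n \<le> N" for n
    by (intro measurable_Pair measurable_quantile_path[OF \<mu> that] measurable_quantile_path[OF \<nu> that]) simp_all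
  note KRm = measurable_KR_kernel[OF \<mu> \<nu>]
  have sl: "seq_law (KR_kernel \<mu> \<nu>) (Suc t) \<in> space (prob_algebra (pair_space (Suc t)))"
    by (rule seq_law_in_space[OF KRm Suc.prems])
  show ?case
  proof (rule measure_eqI)
    show "sets (distr (?P (Suc t)) (pair_space (Suc t)) (?q (Suc t))) = sets (seq_law (KR_kernel \<mu> \<nu>) (Suc t))"
      using sl by (simp add: space_prob_algebra)
    fix A assume "A \<in> sets (distr (?P (Suc t)) (pair_space (Suc t)) (?q (Suc t)))"
    then have A: "A \<in> sets (pair_space (Suc t))" by simp
    have ins: "{1..Suc t} = insert (Suc t) {1..t}" by auto
    have iA: "(\<lambda>u. indicator A (?q (Suc t) u) :: ennreal) \<in> borel_measurable (?P (Suc t))"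
      by (rule measurable_compose[OF qm[OF Suc.prems] borel_measurable_indicator[OF A]])
    have Am: "(\<lambda>z. \<integral>\<^sup>+p. indicator A (extend2 t z p) \<partial>KR_kernel \<mu> \<nu> t z) \<in> borel_measurable (pair_space t)"
      by (rule measurable_nn_integral_kernel[OF KRm[OF t(1)]])
        (use measurable_compose[OF measurable_extend2 borel_measurable_indicator[OF A]] in \<open>simp add: split_beta'\<close>)
    have "emeasure (distr (?P (Suc t)) (pair_space (Suc t)) (?q (Suc t))) A = (\<integral>\<^sup>+u. indicator A (?q (Suc t) u) \<partial>?P (Suc t))"
      unfolding emeasure_distr[OF qm[OF Suc.prems] A] by (rule emeasure_vimage_eq_nn_integral[OF qm[OF Suc.prems] A])
    also have "\<dots> = (\<integral>\<^sup>+u. \<integral>\<^sup>+v. indicator A (?q (Suc t) (u(Suc t := v))) \<partial>unif \<partial>?P t)"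
      using iA unfolding ins by (intro product_nn_integral_insert) auto
    also have "\<dots> = (\<integral>\<^sup>+u. \<integral>\<^sup>+p. indicator A (extend2 t (?q t u) p) \<partial>KR_kernel \<mu> \<nu> t (?q t u) \<partial>?P t)"
    proof (rule nn_integral_cong)
      fix u
      have e: "quantile_path \<eta> (u(Suc t := v)) t = quantile_path \<eta> u t" for \<eta> v
        by (rule quantile_path_cong) auto
      note r = next_law_real_distribution[OF \<mu> t(1) quantile_path_in_space] next_law_real_distribution[OF \<nu> t(1) quantile_path_in_space]
      have m: "(\<lambda>v. (quantile (next_law \<mu> t (quantile_path \<mu> u t)) v, quantile (next_law \<nu> t (quantile_path \<nu> u t)) v))
          \<in> unif \<rightarrow>\<^sub>M borel \<Otimes>\<^sub>M borel"
        unfolding measurable_from_unif by (intro measurable_Pair measurable_quantile_level r)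
      have z: "?q t u \<in> space (pair_space t)" by (simp add: space_pair_measure quantile_path_in_space)
      have "(\<lambda>p. indicator A (extend2 t (?q t u) p) :: ennreal) \<in> borel_measurable (borel \<Otimes>\<^sub>M borel)"
        using measurable_compose[OF measurable_Pair1'[OF z] measurable_compose[OF measurable_extend2[of t] borel_measurable_indicator[OF A]]]
        by simp
      then show "(\<integral>\<^sup>+v. indicator A (?q (Suc t) (u(Suc t := v))) \<partial>unif) =
         (\<integral>\<^sup>+p. indicator A (extend2 t (?q t u) p) \<partial>KR_kernel \<mu> \<nu> t (?q t u))"
        unfolding KR_kernel_def by (subst nn_integral_distr) (use m in \<open>simp_all add: e extend2_def\<close>)
    qed
    also have "\<dots> = (\<integral>\<^sup>+z. \<integral>\<^sup>+p. indicator A (extend2 t z p) \<partial>KR_kernel \<mu> \<nu> t z \<partial>distr (?P t) (pair_space t) (?q t))"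
      by (rule nn_integral_distr[OF qm[OF t(2)], symmetric]) (use Am in simp)
    also have "\<dots> = (\<integral>\<^sup>+z. indicator A z \<partial>seq_law (KR_kernel \<mu> \<nu>) (Suc t))"
      unfolding Suc.IH[OF t(2)]
      by (rule nn_integral_seq_law_Suc[OF KRm t(1) borel_measurable_indicator[OF A], symmetric])
    also have "\<dots> = emeasure (seq_law (KR_kernel \<mu> \<nu>) (Suc t)) A"
      by (rule nn_integral_indicator) (use sl A in \<open>simp add: space_prob_algebra\<close>)
    finally show "emeasure (distr (?P (Suc t)) (pair_space (Suc t)) (?q (Suc t))) A = emeasure (seq_law (KR_kernel \<mu> \<nu>) (Suc t)) A" .
  qed
qed

lemma KR_rearrangement_seq_law:
  assumes "\<mu> \<in> path_laws N" "\<nu> \<in> path_laws N"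
  shows "KR_rearrangement N \<mu> \<nu> = seq_law (KR_kernel \<mu> \<nu>) N"
  unfolding KR_rearrangement_def by (rule quantile_paths_law[OF assms order_refl])

lemma KR_rearrangement_transitions:
  assumes \<mu>: "\<mu> \<in> path_laws N" and \<nu>: "\<nu> \<in> path_laws N"
  shows "KR_rearrangement N \<mu> \<nu> \<in> space (prob_algebra (pair_space N))"
    "t < N \<Longrightarrow> is_cond_law (KR_rearrangement N \<mu> \<nu>) (pair_space t) (initials t) (borel \<Otimes>\<^sub>M borel)
      (\<lambda>z. (fst z (Suc t), snd z (Suc t))) (KR_kernel \<mu> \<nu> t)"
proof -
  note K = measurable_KR_kernel[OF assms]
  show "KR_rearrangement N \<mu> \<nu> \<in> space (prob_algebra (pair_space N))"
    unfolding KR_rearrangement_seq_law[OF assms] by (rule seq_law_in_space[OF K order_refl])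
  assume "t < N"
  then show "is_cond_law (KR_rearrangement N \<mu> \<nu>) (pair_space t) (initials t) (borel \<Otimes>\<^sub>M borel)
      (\<lambda>z. (fst z (Suc t), snd z (Suc t))) (KR_kernel \<mu> \<nu> t)"
    unfolding KR_rearrangement_seq_law[OF assms] by (intro cond_law_seq_law[OF K])
qed

theorem KR_rearrangement_bicausal:
  assumes \<mu>: "\<mu> \<in> path_laws N" and \<nu>: "\<nu> \<in> path_laws N"
  shows "KR_rearrangement N \<mu> \<nu> \<in> bicausal_couplings N \<mu> \<nu>"
    and "\<And>t. t \<le> N \<Longrightarrow> distr (KR_rearrangement N \<mu> \<nu>) (path_space t) (\<lambda>z. initial t (fst z)) = distr \<mu> (path_space t) (initial t)"
    and "\<And>t. t \<le> N \<Longrightarrow> distr (KR_rearrangement N \<mu> \<nu>) (path_space t) (\<lambda>z. initial t (snd z)) = distr \<nu> (path_space t) (initial t)"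
proof -
  have ae: "AE y in distr \<nu> (path_space t) (initial t). \<forall>x\<in>space (path_space t).
      distr (KR_kernel \<mu> \<nu> t (x, y)) borel fst = next_law \<mu> t x \<and>
      distr (KR_kernel \<mu> \<nu> t (x, y)) borel snd = next_law \<nu> t y" if t: "t < N" for t
    by (rule AE_I2) (simp add: KR_kernel_marginals[OF \<mu> \<nu> t])
  note b = bicausalI_cond_law[OF \<mu> \<nu> KR_rearrangement_transitions(1)[OF \<mu> \<nu>]
      KR_rearrangement_transitions(2)[OF \<mu> \<nu>] next_law[OF \<mu>] next_law[OF \<nu>] ae]
  show "KR_rearrangement N \<mu> \<nu> \<in> bicausal_couplings N \<mu> \<nu>" using b(1) by blast
  show "\<And>t. t \<le> N \<Longrightarrow> distr (KR_rearrangement N \<mu> \<nu>) (path_space t) (\<lambda>z. initial t (fst z)) = distr \<mu> (path_space t) (initial t)"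
    using b(2) by blast
  show "\<And>t. t \<le> N \<Longrightarrow> distr (KR_rearrangement N \<mu> \<nu>) (path_space t) (\<lambda>z. initial t (snd z)) = distr \<nu> (path_space t) (initial t)"
    using b(3) by blast
qed

lemma AE_next_law_of_independent_increments:
  assumes \<mu>: "\<mu> \<in> path_laws N" and ind: "independent_increments N \<mu>" and t: "t < N"
  shows "AE x in distr \<mu> (path_space t) (initial t).
    next_law \<mu> t x = distr (distr \<mu> borel (increment (Suc t))) borel (\<lambda>d. level t x + d)"
proof -
  have "initial t \<in> \<mu> \<rightarrow>\<^sub>M path_space t"
    unfolding path_laws_measurable[OF \<mu>] by (rule measurable_initial) (use t in simp)
  from AE_cong_cond_law[OF path_laws_prob[OF \<mu>] this next_law[OF \<mu> t]
      cond_law_of_independent_increments[OF \<mu> ind t]] show ?thesis .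
qed

text \<open>
  Given both pasts, the rearrangement uses the monotone coupling of two conditional laws, and the
  shifted kernel of \<open>\<gamma>\<close> is another coupling of these two laws. The cost \<open>h\<close>, which is a function of
  increments, becomes a translate \<open>k\<close> of \<open>h\<close> when written in terms of coordinates.
\<close>

theorem KR_rearrangement_increment_cost_le:
  fixes h :: "real \<Rightarrow> real"
  assumes \<mu>: "\<mu> \<in> path_laws N" and \<nu>: "\<nu> \<in> path_laws N" and ind: "independent_increments N \<mu>"
    and \<gamma>: "\<gamma> \<in> causal_couplings N \<mu> \<nu>" and t: "t < N"
    and h: "convex_on UNIV h" and m: "\<And>z. m \<le> h z"
  shows "(\<integral>\<^sup>+z. ennreal (h (increment (Suc t) (fst z) - increment (Suc t) (snd z)) - m) \<partial>KR_rearrangement N \<mu> \<nu>) \<le>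
    (\<integral>\<^sup>+z. ennreal (h (increment (Suc t) (fst z) - increment (Suc t) (snd z)) - m) \<partial>\<gamma>)"
proof -
  let ?KR = "KR_rearrangement N \<mu> \<nu>"
  have cpl: "\<gamma> \<in> couplings N \<mu> \<nu>" using \<gamma> by (simp add: causal_couplings_def)
  obtain J where J: "increment_kernel \<gamma> t J"
    and J_ae: "AE y in distr \<nu> (path_space t) (initial t).
       distr (J y) borel fst = distr \<mu> borel (increment (Suc t)) \<and>
       distr (distr (J y) borel snd) borel (\<lambda>d. level t y + d) = next_law \<nu> t y"
    by (rule causal_increment_kernel[OF \<mu> \<nu> ind t \<gamma>])
  have Jm: "J \<in> path_space t \<rightarrow>\<^sub>M prob_algebra (borel \<Otimes>\<^sub>M borel)"
    using J by (simp add: increment_kernel_def is_cond_law_def)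
  have [measurable]: "h \<in> borel_measurable borel"
    by (rule borel_measurable_continuous_onI[OF convex_on_continuous[OF open_UNIV h]])
  define f :: "real \<times> real \<Rightarrow> ennreal" where "f p = ennreal (h (fst p - snd p) - m)" for p
  have fm: "f \<in> borel_measurable (borel \<Otimes>\<^sub>M borel)" unfolding f_def by measurable
  have ps: "prob_space ?KR" and s: "sets ?KR = sets (pair_space N)"
    using KR_rearrangement_transitions(1)[OF \<mu> \<nu>] by (auto simp: space_prob_algebra)
  have tN: "t \<le> N" using t by simp
  have i1: "(\<lambda>z. initial t (fst z)) \<in> ?KR \<rightarrow>\<^sub>M path_space t" and i2: "(\<lambda>z. initial t (snd z)) \<in> ?KR \<rightarrow>\<^sub>M path_space t"
    unfolding measurable_cong_sets[OF s refl]
    by (rule measurable_compose[OF measurable_fst measurable_initial[OF tN]],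
        rule measurable_compose[OF measurable_snd measurable_initial[OF tN]])
  note ae1 = AE_distrD[OF i1 AE_next_law_of_independent_increments[OF \<mu> ind t, folded KR_rearrangement_bicausal(2)[OF \<mu> \<nu> tN]]]
  note ae2 = AE_distrD[OF i2 J_ae[folded KR_rearrangement_bicausal(3)[OF \<mu> \<nu> tN]]]
  have "(\<integral>\<^sup>+z. f (increment (Suc t) (fst z), increment (Suc t) (snd z)) \<partial>?KR) \<le>
    (\<integral>\<^sup>+z. f (increment (Suc t) (fst z), increment (Suc t) (snd z)) \<partial>\<gamma>)"
  proof (rule increment_cost_le[OF cpl t J ps s KR_rearrangement_transitions(2)[OF \<mu> \<nu> t] _ fm])
    show "distr ?KR (path_space t) (\<lambda>z. initial t (snd z)) = distr \<nu> (path_space t) (initial t)"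
      by (rule KR_rearrangement_bicausal(3)[OF \<mu> \<nu> tN])
    show "AE z in ?KR. (\<integral>\<^sup>+p. f (fst p - level t (fst z), snd p - level t (snd z)) \<partial>KR_kernel \<mu> \<nu> t (initials t z))
      \<le> (\<integral>\<^sup>+p. f p \<partial>J (initial t (snd z)))"
      using ae1 ae2
    proof eventually_elim
      case (elim z)
      let ?x = "initial t (fst z)" and ?y = "initial t (snd z)"
      let ?a = "next_law \<mu> t ?x" and ?b = "next_law \<nu> t ?y" and ?S = "shift_kernel t J (?x, ?y)"
      have z: "(?x, ?y) \<in> space (pair_space t)" by (simp add: space_pair_measure initial_in_space)
      have cpl: "line_coupling ?a ?b ?S"
        unfolding line_coupling_def
        using measurable_space[OF measurable_shift_kernel[OF Jm] z] elim
        by (simp add: shift_kernel_marginals[OF Jm initial_in_space])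
      \<comment> \<open>The quantile functions produce coordinates, so the difference of the starting positions is moved into \<open>h\<close>.\<close>
      define k where "k w = h (w + (level t (snd z) - level t (fst z)))" for w
      have k: "convex_on UNIV k"
      proof (rule convex_onI)
        fix r x y :: real assume "0 < r" "r < 1"
        then show "k ((1 - r) *\<^sub>R x + r *\<^sub>R y) \<le> (1 - r) * k x + r * k y"
          using convex_onD[OF h, of r "x + (level t (snd z) - level t (fst z))" "y + (level t (snd z) - level t (fst z))"]
          by (simp add: k_def algebra_simps)
      qed simp
      note r = line_couplingD(4,5)[OF cpl]
      have m1: "(\<lambda>u. (quantile ?a u, quantile ?b u)) \<in> unif \<rightarrow>\<^sub>M borel \<Otimes>\<^sub>M borel"
        unfolding measurable_from_unif by (intro measurable_Pair measurable_quantile_level r)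
      have fl: "(\<lambda>p. f (fst p - level t (fst z), snd p - level t (snd z))) \<in> borel_measurable (borel \<Otimes>\<^sub>M borel)"
        by (rule measurable_compose[OF _ fm]) measurable
      have "(\<integral>\<^sup>+p. f (fst p - level t (fst z), snd p - level t (snd z)) \<partial>KR_kernel \<mu> \<nu> t (initials t z)) =
        (\<integral>\<^sup>+u. ennreal (k (quantile ?a u - quantile ?b u) - m) \<partial>unif)"
        unfolding KR_kernel_def by (subst nn_integral_distr) (use m1 fl in \<open>simp_all add: f_def k_def algebra_simps\<close>)
      also have "\<dots> \<le> (\<integral>\<^sup>+p. ennreal (k (fst p - snd p) - m) \<partial>?S)"
        by (rule monotone_coupling_optimal[OF cpl k]) (simp add: k_def m)
      also have "\<dots> = (\<integral>\<^sup>+p. f p \<partial>J ?y)"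
        unfolding k_def
        by (subst nn_integral_shift_kernel[OF Jm initial_in_space]) (simp_all add: f_def[abs_def] level_initial algebra_simps)
      finally show ?case .
    qed
  qed
  then show ?thesis by (simp add: f_def)
qed

section \<open>The Knothe-Rosenblatt map\<close>

text \<open>
  Here the point of evaluation varies with the parameter as well, so the value is written as the
  integral of a jointly measurable indicator.
\<close>

lemma measurable_cdf_kernel:
  assumes k: "k \<in> M \<rightarrow>\<^sub>M prob_algebra borel" and f: "f \<in> borel_measurable M"
  shows "(\<lambda>z. cdf (k z) (f z)) \<in> borel_measurable M"
proof -
  have s: "{p :: ('a \<times> real). snd p \<le> f (fst p) \<and> fst p \<in> space M} \<in> sets (M \<Otimes>\<^sub>M borel)"
  proof -
    have [measurable]: "f \<in> borel_measurable M" by fact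
    have "{p \<in> space (M \<Otimes>\<^sub>M borel). snd p \<le> f (fst p)} \<in> sets (M \<Otimes>\<^sub>M borel)" by measurable
    moreover have "{p \<in> space (M \<Otimes>\<^sub>M borel). snd p \<le> f (fst p)} = {p. snd p \<le> f (fst p) \<and> fst p \<in> space M}"
      by (auto simp: space_pair_measure)
    ultimately show ?thesis by simp
  qed
  have "(\<lambda>z. enn2real (\<integral>\<^sup>+y. indicator {p. snd p \<le> f (fst p) \<and> fst p \<in> space M} (z, y) \<partial>k z)) \<in> borel_measurable M"
    by (intro borel_measurable_enn2real measurable_nn_integral_kernel[OF k])
      (use borel_measurable_indicator[OF s] in simp)
  moreover have "enn2real (\<integral>\<^sup>+y. indicator {p. snd p \<le> f (fst p) \<and> fst p \<in> space M} (z, y) \<partial>k z) = cdf (k z) (f z)"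
    if z: "z \<in> space M" for z
  proof -
    have "(\<integral>\<^sup>+y. indicator {p. snd p \<le> f (fst p) \<and> fst p \<in> space M} (z, y) \<partial>k z) = (\<integral>\<^sup>+y. indicator {..f z} y \<partial>k z)"
      using z by (intro nn_integral_cong) (auto simp: indicator_def)
    also have "\<dots> = emeasure (k z) {..f z}"
      by (rule nn_integral_indicator) (use sets_kernel_prob(1)[OF k z] in simp)
    finally show ?thesis by (simp add: cdf_def measure_def)
  qed
  ultimately show ?thesis by (simp cong: measurable_cong)
qed

lemma measurable_KR_map:
  assumes \<mu>: "\<mu> \<in> path_laws N" and \<nu>: "\<nu> \<in> path_laws N"
  shows "t \<le> N \<Longrightarrow> (\<lambda>x. KR_map \<mu> \<nu> x t) \<in> path_space N \<rightarrow>\<^sub>M path_space t"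
proof (induction t)
  case 0 then show ?case by (simp add: space_path_space)
next
  case (Suc t)
  then have t: "t < N" "t \<le> N" and IH: "(\<lambda>x. KR_map \<mu> \<nu> x t) \<in> path_space N \<rightarrow>\<^sub>M path_space t" by auto
  show ?case
    unfolding KR_map.simps restrict_eq_initial initial_def[symmetric]
    by (intro measurable_extend[OF IH] measurable_quantile measurable_cdf_kernel
        measurable_compose[OF IH measurable_next_law[OF \<nu> t(1)]]
        measurable_compose[OF measurable_initial[OF t(2)] measurable_next_law[OF \<mu> t(1)]] measurable_coordinate)
      (use t in auto)
qed

text \<open>
  The two paths are functions of the same uniform variables. The atomless conditional law lets the map
  recover each uniform variable from the first path, so that almost surely the map sends the first path
  to the second.
\<close>

theorem KR_rearrangement_eq_map:
  assumes \<mu>: "\<mu> \<in> path_laws N" and \<nu>: "\<nu> \<in> path_laws N" and ind: "independent_increments N \<mu>"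
    and atomless: "\<And>t. t < N \<Longrightarrow> atomless (distr \<mu> borel (increment (Suc t)))"
  shows "KR_rearrangement N \<mu> \<nu> = distr \<mu> (pair_space N) (\<lambda>x. (x, KR_map \<mu> \<nu> x N))"
proof -
  let ?P = "PiM {1..N} (\<lambda>_. unif)"
  let ?KR = "KR_rearrangement N \<mu> \<nu>"
  interpret prob_space ?P by (intro prob_space_PiM prob_space_unif)
  note qm = measurable_quantile_path[OF \<mu> order_refl] measurable_quantile_path[OF \<nu> order_refl]
  have pm: "(\<lambda>u. (quantile_path \<mu> u N, quantile_path \<nu> u N)) \<in> ?P \<rightarrow>\<^sub>M pair_space N"
    by (intro measurable_Pair qm order_refl)
  have law: "distr ?P (path_space t) (\<lambda>u. quantile_path \<mu> u t) = distr \<mu> (path_space t) (initial t)" if "t \<le> N" for t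
  proof -
    have m: "(\<lambda>z. initial t (fst z)) \<in> pair_space N \<rightarrow>\<^sub>M path_space t"
      by (rule measurable_compose[OF measurable_fst measurable_initial[OF that]])
    show ?thesis
      unfolding KR_rearrangement_bicausal(2)[OF \<mu> \<nu> that, symmetric] KR_rearrangement_def
      by (subst distr_distr[OF m pm]) (simp add: comp_def initial_quantile_path that)
  qed
  have lawN: "distr ?P (path_space N) (\<lambda>u. quantile_path \<mu> u N) = \<mu>"
  proof -
    have "distr \<mu> (path_space N) (initial N) = distr \<mu> (path_space N) (\<lambda>x. x)"
      by (rule distr_cong) (simp_all add: initial_id sets_eq_imp_space_eq[OF path_laws_sets[OF \<mu>]])
    then show ?thesis using law[OF order_refl] distr_id2[OF path_laws_sets[OF \<mu>, symmetric]] by simp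
  qed
  have "AE u in ?P. (0 < u (Suc t) \<and> u (Suc t) < 1) \<and>
     next_law \<mu> t (quantile_path \<mu> u t) = distr (distr \<mu> borel (increment (Suc t))) borel (\<lambda>d. level t (quantile_path \<mu> u t) + d)"
    if t: "t \<in> {..<N}" for t
  proof -
    have "AE u in ?P. 0 < u (Suc t) \<and> u (Suc t) < 1"
      by (rule AE_PiM_component[OF prob_space_unif _ AE_unif]) (use t in auto)
    moreover have "AE u in ?P. next_law \<mu> t (quantile_path \<mu> u t) =
        distr (distr \<mu> borel (increment (Suc t))) borel (\<lambda>d. level t (quantile_path \<mu> u t) + d)"
    proof (rule AE_distrD[OF qm(1)])
      show tN: "t \<le> N" using t by simp
      show "AE x in distr ?P (path_space t) (\<lambda>u. quantile_path \<mu> u t).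
          next_law \<mu> t x = distr (distr \<mu> borel (increment (Suc t))) borel (\<lambda>d. level t x + d)"
        unfolding law[OF tN] by (rule AE_next_law_of_independent_increments[OF \<mu> ind]) (use t in simp)
    qed
    ultimately show ?thesis by eventually_elim simp
  qed
  then have ae: "AE u in ?P. \<forall>t\<in>{..<N}. (0 < u (Suc t) \<and> u (Suc t) < 1) \<and>
     next_law \<mu> t (quantile_path \<mu> u t) = distr (distr \<mu> borel (increment (Suc t))) borel (\<lambda>d. level t (quantile_path \<mu> u t) + d)"
    by (intro AE_finite_allI) simp_all
  have eq: "AE u in ?P. KR_map \<mu> \<nu> (quantile_path \<mu> u N) N = quantile_path \<nu> u N"
    using ae
  proof eventually_elim
    case (elim u)
    have "t \<le> N \<Longrightarrow> KR_map \<mu> \<nu> (quantile_path \<mu> u N) t = quantile_path \<nu> u t" for t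
    proof (induction t)
      case (Suc t)
      then have t: "t < N" "t \<le> N" by auto
      let ?a = "next_law \<mu> t (quantile_path \<mu> u t)"
      have r: "real_distribution ?a" by (rule next_law_real_distribution[OF \<mu> t(1) quantile_path_in_space])
      have "atomless ?a"
        unfolding atomless_def
      proof
        fix x
        have "measure ?a {x} = measure (distr \<mu> borel (increment (Suc t))) {x - level t (quantile_path \<mu> u t)}"
        proof -
          have "?a = distr (distr \<mu> borel (increment (Suc t))) borel (\<lambda>d. level t (quantile_path \<mu> u t) + d)"
            using elim t by simp
          then have "measure ?a {x} = measure (distr \<mu> borel (increment (Suc t)))
              ((\<lambda>d. level t (quantile_path \<mu> u t) + d) -` {x} \<inter> space (distr \<mu> borel (increment (Suc t))))"
            by (simp only:) (rule measure_distr; simp)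
          also have "(\<lambda>d. level t (quantile_path \<mu> u t) + d) -` {x} \<inter> space (distr \<mu> borel (increment (Suc t)))
              = {x - level t (quantile_path \<mu> u t)}" by auto
          finally show ?thesis .
        qed
        then show "measure ?a {x} = 0" using atomless[OF t(1)] by (simp add: atomless_def)
      qed
      then have "cdf ?a (quantile ?a (u (Suc t))) = u (Suc t)"
        by (intro cdf_quantile_atomless[OF r]) (use elim t in auto)
      moreover have "initial (Suc t) (quantile_path \<mu> u N) = quantile_path \<mu> u (Suc t)"
        "initial t (quantile_path \<mu> u N) = quantile_path \<mu> u t"
        using t by (simp_all only: initial_quantile_path Suc_leI)
      moreover from fun_cong[OF this(1), of "Suc t"]
      have "quantile_path \<mu> u N (Suc t) = quantile ?a (u (Suc t))" by (simp add: initial_def)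
      ultimately show ?case
        using Suc.IH[OF t(2)] unfolding KR_map.simps initial_def[symmetric] by simp
    qed simp
    then show ?case by simp
  qed
  have gm: "(\<lambda>x. (x, KR_map \<mu> \<nu> x N)) \<in> path_space N \<rightarrow>\<^sub>M pair_space N"
    by (intro measurable_Pair measurable_ident_sets[OF refl] measurable_KR_map[OF \<mu> \<nu> order_refl])
  have "?KR = distr ?P (pair_space N) (\<lambda>u. (quantile_path \<mu> u N, KR_map \<mu> \<nu> (quantile_path \<mu> u N) N))"
    unfolding KR_rearrangement_def
  proof (rule distr_cong_AE)
    show "AE u in ?P. (quantile_path \<mu> u N, quantile_path \<nu> u N) =
        (quantile_path \<mu> u N, KR_map \<mu> \<nu> (quantile_path \<mu> u N) N)"
      using eq by eventually_elim simp
    show "(\<lambda>u. (quantile_path \<mu> u N, KR_map \<mu> \<nu> (quantile_path \<mu> u N) N)) \<in> ?P \<rightarrow>\<^sub>M pair_space N"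
      using measurable_compose[OF qm(1)[OF order_refl] gm] .
  qed (use pm in simp_all)
  also have "\<dots> = distr (distr ?P (path_space N) (\<lambda>u. quantile_path \<mu> u N)) (pair_space N) (\<lambda>x. (x, KR_map \<mu> \<nu> x N))"
    by (subst distr_distr[OF gm qm(1)[OF order_refl]]) (simp add: comp_def)
  finally show ?thesis unfolding lawN .
qed

section \<open>Separable costs\<close>

text \<open>
  This form is monotone in the integral of a nonnegative function, which makes two values comparable
  although the positive parts may have infinite integral.
\<close>

lemma ext_integral_eq_shifted:
  fixes f :: "'a \<Rightarrow> real"
  assumes "prob_space M" and [measurable]: "f \<in> borel_measurable M" and m: "\<And>z. z \<in> space M \<Longrightarrow> m \<le> f z"
  shows "ext_integral M f = enn2ereal (\<integral>\<^sup>+z. ennreal (f z - m) \<partial>M) + ereal m"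
proof -
  interpret prob_space M by fact
  define P Q R where "P = (\<integral>\<^sup>+z. ennreal (f z) \<partial>M)" and "Q = (\<integral>\<^sup>+z. ennreal (- f z) \<partial>M)"
    and "R = (\<integral>\<^sup>+z. ennreal (f z - m) \<partial>M)"
  have "(\<integral>\<^sup>+z. ennreal (f z) + ennreal (- m) \<partial>M) = (\<integral>\<^sup>+z. ennreal (f z - m) + ennreal (- f z) + ennreal m \<partial>M)"
  proof (rule nn_integral_cong)
    fix z assume "z \<in> space M"
    from m[OF this] show "ennreal (f z) + ennreal (- m) = ennreal (f z - m) + ennreal (- f z) + ennreal m"
      by (cases "0 \<le> f z"; cases "0 \<le> m")
        (auto simp: ennreal_neg ennreal_plus[symmetric] simp del: ennreal_plus)
  qed
  then have eq: "P + ennreal (- m) = R + Q + ennreal m"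
    unfolding P_def Q_def R_def by (simp add: nn_integral_add emeasure_space_1)
  have "Q \<le> (\<integral>\<^sup>+z. ennreal (- m) \<partial>M)"
    unfolding Q_def by (rule nn_integral_mono) (use m in \<open>auto intro: ennreal_leI\<close>)
  then have "Q < top" by (auto simp: emeasure_space_1 intro: le_less_trans)
  then obtain q where q: "Q = ennreal q" "0 \<le> q" by (cases Q) auto
  show ?thesis
  proof (cases R)
    case (real r)
    have "P < top"
    proof -
      have "P \<le> P + ennreal (- m)" by simp
      also have "\<dots> < top" unfolding eq real(2) q(1) by simp
      finally show ?thesis .
    qed
    then obtain p where p: "P = ennreal p" "0 \<le> p" by (cases P) auto
    have "ennreal (p + max 0 (- m)) = ennreal (r + q + max 0 m)"
      using eq p q real by (cases "0 \<le> m") (simp_all add: ennreal_neg max_def ennreal_plus[symmetric] del: ennreal_plus)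
    then have "p + max 0 (- m) = r + q + max 0 m" using p q real by (subst (asm) ennreal_inj) auto
    then have "p - q = r + m" by (simp add: max_def split: if_splits)
    then show ?thesis
      using p q real unfolding ext_integral_def P_def[symmetric] Q_def[symmetric] R_def[symmetric] by simp
  next
    case top
    then have "P = top" using eq by (simp add: ennreal_add_eq_top)
    then show ?thesis
      using q top unfolding ext_integral_def P_def[symmetric] Q_def[symmetric] R_def[symmetric] by simp
  qed
qed

text \<open>The path whose only nonzero increment is \<open>a\<close>, at time \<open>s\<close>.\<close>

definition step_path :: "nat \<Rightarrow> nat \<Rightarrow> real \<Rightarrow> nat \<Rightarrow> real" where
  "step_path N s a = (\<lambda>i\<in>{1..N}. if i < s then 0 else a)"

lemma increment_step_path:
  assumes "t \<in> {1..N}" "1 \<le> s"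
  shows "increment t (step_path N s a) = (if t = s then a else 0)"
proof (cases "t = 1")
  case True
  then show ?thesis using assms by (auto simp: increment_def step_path_def)
next
  case False
  then have "t \<in> {1..N}" "t - 1 \<in> {1..N}" using assms by auto
  then show ?thesis using False assms by (auto simp: increment_def step_path_def)
qed

lemma step_path_in_space: "step_path N s a \<in> space (path_space N)"
  by (simp add: step_path_def space_path_space)

text \<open>
  On paths whose only nonzero increment is at time \<open>s\<close>, the cost \<open>c\<close> differs from its component \<open>cs s\<close>
  by a constant, and these paths depend continuously on the size of the increment. So the component
  inherits lower semicontinuity, hence measurability, and the lower bound.
\<close>

lemma lsc_separable_cost_component:
  fixes c :: "(nat \<Rightarrow> real) \<times> (nat \<Rightarrow> real) \<Rightarrow> real"
  assumes lsc: "lsc_on_topology (prod_topology (path_topology N) (path_topology N)) c"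
    and lower: "\<And>z. z \<in> space (pair_space N) \<Longrightarrow> m \<le> c z"
    and c: "\<And>x y. x \<in> space (path_space N) \<Longrightarrow> y \<in> space (path_space N) \<Longrightarrow>
        c (x, y) = (\<Sum>t=1..N. cs t (increment t x) (increment t y))"
    and s: "s \<in> {1..N}"
  shows "(\<lambda>p. cs s (fst p) (snd p)) \<in> borel_measurable (borel \<Otimes>\<^sub>M borel)" and "\<exists>k. \<forall>a b. k \<le> cs s a b"
proof -
  define D where "D = (\<Sum>t\<in>{1..N} - {s}. cs t 0 0)"
  have eq: "c (step_path N s a, step_path N s b) = cs s a b + D" for a b
  proof -
    have "c (step_path N s a, step_path N s b) = (\<Sum>t=1..N. cs t (if t = s then a else 0) (if t = s then b else 0))"
      unfolding c[OF step_path_in_space step_path_in_space]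
      by (rule sum.cong) (use s in \<open>simp_all add: increment_step_path\<close>)
    also have "\<dots> = cs s a b + D"
      unfolding D_def by (subst sum.remove[OF _ s]) (auto intro!: sum.cong)
    finally show ?thesis .
  qed
  have "m - D \<le> cs s a b" for a b
    using lower[of "(step_path N s a, step_path N s b)"] eq[of a b]
    by (simp add: space_pair_measure step_path_in_space)
  then show "\<exists>k. \<forall>a b. k \<le> cs s a b" by blast
  have comp: "continuous_map euclidean (path_topology N) (\<lambda>p. step_path N s (g p))"
    if g: "continuous_on UNIV g" for g :: "real \<times> real \<Rightarrow> real"
    unfolding path_topology_def continuous_map_componentwise
  proof (intro conjI ballI)
    show "(\<lambda>p. step_path N s (g p)) ` topspace euclidean \<subseteq> extensional {1..N}" by (auto simp: step_path_def)
    fix i assume "i \<in> {1..N}"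
    then show "continuous_map euclidean euclideanreal (\<lambda>p. step_path N s (g p) i)"
      using g by (cases "i < s") (simp_all add: step_path_def)
  qed
  have cont: "continuous_map euclidean (prod_topology (path_topology N) (path_topology N))
      (\<lambda>p :: real \<times> real. (step_path N s (fst p), step_path N s (snd p)))"
    by (intro continuous_map_paired[THEN iffD2] conjI comp continuous_intros)
  have "{p \<in> space (borel \<Otimes>\<^sub>M borel). \<alpha> < cs s (fst p) (snd p)} \<in> sets (borel \<Otimes>\<^sub>M borel :: (real \<times> real) measure)" for \<alpha>
  proof -
    have "openin (prod_topology (path_topology N) (path_topology N))
        {z \<in> topspace (prod_topology (path_topology N) (path_topology N)). \<alpha> + D < c z}" (is "openin ?T ?U")
      using lsc by (simp add: lsc_on_topology_def)
    from openin_continuous_map_preimage[OF cont this]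
    have "open {p :: real \<times> real. (step_path N s (fst p), step_path N s (snd p)) \<in> ?U}" by simp
    moreover have "(step_path N s a, step_path N s b) \<in> ?U \<longleftrightarrow> \<alpha> < cs s a b" for a b
      using eq[of a b] by (auto simp: path_topology_def step_path_def)
    ultimately have "open {p :: real \<times> real. \<alpha> < cs s (fst p) (snd p)}" by simp
    then show ?thesis unfolding borel_prod by simp
  qed
  then show "(\<lambda>p. cs s (fst p) (snd p)) \<in> borel_measurable (borel \<Otimes>\<^sub>M borel)"
    by (simp add: borel_measurable_iff_greater)
qed

lemma ext_integral_separable_cost:
  fixes c :: "(nat \<Rightarrow> real) \<times> (nat \<Rightarrow> real) \<Rightarrow> real"
  assumes \<gamma>: "\<gamma> \<in> couplings N \<mu> \<nu>"
    and c: "\<And>x y. x \<in> space (path_space N) \<Longrightarrow> y \<in> space (path_space N) \<Longrightarrow>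
        c (x, y) = (\<Sum>t<N. cs (Suc t) (increment (Suc t) x) (increment (Suc t) y))"
    and meas: "\<And>t. t < N \<Longrightarrow> (\<lambda>p. cs (Suc t) (fst p) (snd p)) \<in> borel_measurable (borel \<Otimes>\<^sub>M borel)"
    and k: "\<And>t a b. t < N \<Longrightarrow> k t \<le> cs (Suc t) a b"
  shows "ext_integral \<gamma> c = enn2ereal (\<Sum>t<N. \<integral>\<^sup>+z. ennreal (cs (Suc t) (increment (Suc t) (fst z)) (increment (Suc t) (snd z)) - k t) \<partial>\<gamma>)
     + ereal (\<Sum>t<N. k t)"
proof -
  note D = couplingsD[OF \<gamma>]
  define d where "d t z = cs (Suc t) (increment (Suc t) (fst z)) (increment (Suc t) (snd z))"
    for t and z :: "(nat \<Rightarrow> real) \<times> (nat \<Rightarrow> real)"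
  have dm: "d t \<in> borel_measurable \<gamma>" if t: "t < N" for t
    using measurable_compose[OF measurable_Pair[OF measurable_compose[OF D(4) measurable_increment[OF t]]
          measurable_compose[OF D(5) measurable_increment[OF t]]] meas[OF t]]
    by (simp add: d_def[abs_def])
  have cd: "c z = (\<Sum>t<N. d t z)" if "z \<in> space \<gamma>" for z
    using c[of "fst z" "snd z"] that by (auto simp: D(3) space_pair_measure d_def)
  have kd: "k t \<le> d t z" if "t < N" for t z using k[OF that] by (simp add: d_def)
  have sm: "(\<lambda>z. \<Sum>t<N. d t z) \<in> borel_measurable \<gamma>" by (rule borel_measurable_sum) (use dm in simp)
  have cm: "c \<in> borel_measurable \<gamma>" by (subst measurable_cong[OF cd]) (use sm in simp_all)
  have lo: "(\<Sum>t<N. k t) \<le> c z" if "z \<in> space \<gamma>" for z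
    unfolding cd[OF that] by (rule sum_mono) (use kd in simp)
  have "(\<integral>\<^sup>+z. ennreal (c z - (\<Sum>t<N. k t)) \<partial>\<gamma>) = (\<integral>\<^sup>+z. (\<Sum>t<N. ennreal (d t z - k t)) \<partial>\<gamma>)"
  proof (rule nn_integral_cong)
    fix z assume "z \<in> space \<gamma>"
    then have "c z - (\<Sum>t<N. k t) = (\<Sum>t<N. d t z - k t)" by (simp add: cd sum_subtractf)
    moreover have "(\<Sum>t<N. ennreal (d t z - k t)) = ennreal (\<Sum>t<N. d t z - k t)"
      by (rule sum_ennreal) (use kd in simp)
    ultimately show "ennreal (c z - (\<Sum>t<N. k t)) = (\<Sum>t<N. ennreal (d t z - k t))" by simp
  qed
  also have "\<dots> = (\<Sum>t<N. \<integral>\<^sup>+z. ennreal (d t z - k t) \<partial>\<gamma>)"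
    by (rule nn_integral_sum) (use dm in simp)
  finally have eq: "(\<integral>\<^sup>+z. ennreal (c z - (\<Sum>t<N. k t)) \<partial>\<gamma>) = (\<Sum>t<N. \<integral>\<^sup>+z. ennreal (d t z - k t) \<partial>\<gamma>)" .
  have "ext_integral \<gamma> c = enn2ereal (\<integral>\<^sup>+z. ennreal (c z - (\<Sum>t<N. k t)) \<partial>\<gamma>) + ereal (\<Sum>t<N. k t)"
    by (rule ext_integral_eq_shifted[OF D(1) cm lo])
  then show ?thesis unfolding eq d_def .
qed

theorem corollary2p10:
  fixes N :: nat
    and \<mu> \<nu> :: "(nat \<Rightarrow> real) measure"
    and c :: "(nat \<Rightarrow> real) \<times> (nat \<Rightarrow> real) \<Rightarrow> real"
    and cs :: "nat \<Rightarrow> real \<Rightarrow> real \<Rightarrow> real"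
  assumes "1 \<le> N"
    and "\<mu> \<in> path_laws N"
    and "\<nu> \<in> path_laws N"
    and "lsc_on_topology (prod_topology (path_topology N) (path_topology N)) c"
    and "\<exists>m. \<forall>z\<in>space (pair_space N). m \<le> c z"
    and "\<forall>x\<in>space (path_space N). \<forall>y\<in>space (path_space N).
           c (x, y) = cs 1 (x 1) (y 1) + (\<Sum>t\<in>{2..N}. cs t (x t - x (t - 1)) (y t - y (t - 1)))"
    and "independent_increments N \<mu>"
  shows "(INF \<gamma>\<in>causal_couplings N \<mu> \<nu>. ext_integral \<gamma> c) =
         (INF \<gamma>\<in>bicausal_couplings N \<mu> \<nu>. ext_integral \<gamma> c) \<and>
         (\<forall>h :: nat \<Rightarrow> real \<Rightarrow> real.
           (\<forall>t\<in>{1..N}. convex_on UNIV (h t) \<and> (\<forall>a b. cs t a b = h t (a - b))) \<longrightarrow>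
           (KR_rearrangement N \<mu> \<nu> \<in> causal_couplings N \<mu> \<nu> \<and>
            ext_integral (KR_rearrangement N \<mu> \<nu>) c =
              (INF \<gamma>\<in>causal_couplings N \<mu> \<nu>. ext_integral \<gamma> c)) \<and>
           ((\<forall>i\<in>{1..N}. atomless (marginal \<mu> i)) \<and>
            (\<forall>i\<in>{2..N}. atomless (distr \<mu> borel (increment i))) \<longrightarrow>
            KR_rearrangement N \<mu> \<nu> =
              distr \<mu> (pair_space N) (\<lambda>x. (x, KR_map \<mu> \<nu> x N))))"
proof -
  note \<mu> = assms(2) and \<nu> = assms(3) and ind = assms(7)
  let ?KR = "KR_rearrangement N \<mu> \<nu>"
  have c_sum: "c (x, y) = (\<Sum>t=1..N. cs t (increment t x) (increment t y))"
    if "x \<in> space (path_space N)" "y \<in> space (path_space N)" for x y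
  proof -
    have "{1..N} = insert 1 {2..N}" using assms(1) by auto
    then have "(\<Sum>t=1..N. cs t (increment t x) (increment t y)) =
        cs 1 (x 1) (y 1) + (\<Sum>t\<in>{2..N}. cs t (increment t x) (increment t y))"
      by (simp add: increment_def)
    also have "(\<Sum>t\<in>{2..N}. cs t (increment t x) (increment t y)) =
        (\<Sum>t\<in>{2..N}. cs t (x t - x (t - 1)) (y t - y (t - 1)))"
      by (rule sum.cong) (auto simp: increment_def)
    finally show ?thesis using assms(6) that by simp
  qed
  then have c_sum': "c (x, y) = (\<Sum>t<N. cs (Suc t) (increment (Suc t) x) (increment (Suc t) y))"
    if "x \<in> space (path_space N)" "y \<in> space (path_space N)" for x y
    using that by (simp add: sum.atLeast1_atMost_eq)
  obtain m where m: "\<And>z. z \<in> space (pair_space N) \<Longrightarrow> m \<le> c z" using assms(5) by blast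
  note component = lsc_separable_cost_component[OF assms(4) m c_sum]
  have meas: "(\<lambda>p. cs (Suc t) (fst p) (snd p)) \<in> borel_measurable (borel \<Otimes>\<^sub>M borel)" if "t < N" for t
    by (rule component(1)) (use that in simp_all)
  have "\<forall>t\<in>{..<N}. \<exists>k. \<forall>a b. k \<le> cs (Suc t) a b"
    by (intro ballI component(2)) simp_all
  then obtain k where "\<forall>t\<in>{..<N}. \<forall>a b. k t \<le> cs (Suc t) a b" by (rule bchoice[THEN exE])
  then have k: "\<And>t a b. t < N \<Longrightarrow> k t \<le> cs (Suc t) a b" by simp
  have ext: "ext_integral \<gamma> c = enn2ereal (\<Sum>t<N. \<integral>\<^sup>+z. ennreal (cs (Suc t) (increment (Suc t) (fst z))
      (increment (Suc t) (snd z)) - k t) \<partial>\<gamma>) + ereal (\<Sum>t<N. k t)"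
    if "\<gamma> \<in> couplings N \<mu> \<nu>" for \<gamma>
    by (rule ext_integral_separable_cost[OF that c_sum' meas k])
  have compare: "ext_integral \<gamma>' c \<le> ext_integral \<gamma> c"
    if "\<gamma> \<in> couplings N \<mu> \<nu>" "\<gamma>' \<in> couplings N \<mu> \<nu>"
      and "\<And>t. t < N \<Longrightarrow>
        (\<integral>\<^sup>+z. ennreal (cs (Suc t) (increment (Suc t) (fst z)) (increment (Suc t) (snd z)) - k t) \<partial>\<gamma>') \<le>
        (\<integral>\<^sup>+z. ennreal (cs (Suc t) (increment (Suc t) (fst z)) (increment (Suc t) (snd z)) - k t) \<partial>\<gamma>)"
    for \<gamma> \<gamma>'
    unfolding ext[OF that(1)] ext[OF that(2)]
    using that(3) by (intro add_right_mono) (auto simp: less_eq_ennreal.rep_eq[symmetric] intro!: sum_mono)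
  have causal: "causal_couplings N \<mu> \<nu> \<subseteq> couplings N \<mu> \<nu>" and bicausal: "bicausal_couplings N \<mu> \<nu> \<subseteq> causal_couplings N \<mu> \<nu>"
    by (auto simp: causal_couplings_def bicausal_couplings_def)
  have part1: "(INF \<gamma>\<in>causal_couplings N \<mu> \<nu>. ext_integral \<gamma> c) = (INF \<gamma>\<in>bicausal_couplings N \<mu> \<nu>. ext_integral \<gamma> c)"
  proof (rule antisym)
    show "(INF \<gamma>\<in>causal_couplings N \<mu> \<nu>. ext_integral \<gamma> c) \<le> (INF \<gamma>\<in>bicausal_couplings N \<mu> \<nu>. ext_integral \<gamma> c)"
      by (rule INF_superset_mono[OF bicausal]) simp
    show "(INF \<gamma>\<in>bicausal_couplings N \<mu> \<nu>. ext_integral \<gamma> c) \<le> (INF \<gamma>\<in>causal_couplings N \<mu> \<nu>. ext_integral \<gamma> c)"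
    proof (rule INF_greatest)
      fix \<gamma> assume \<gamma>: "\<gamma> \<in> causal_couplings N \<mu> \<nu>"
      from bicausal_coupling_at_most_as_costly[OF \<mu> \<nu> ind \<gamma>]
      obtain \<gamma>' where \<gamma>': "\<gamma>' \<in> bicausal_couplings N \<mu> \<nu>"
        and le: "\<forall>t<N. \<forall>f\<in>borel_measurable (borel \<Otimes>\<^sub>M borel).
          (\<integral>\<^sup>+z. f (increment (Suc t) (fst z), increment (Suc t) (snd z)) \<partial>\<gamma>') \<le>
          (\<integral>\<^sup>+z. f (increment (Suc t) (fst z), increment (Suc t) (snd z)) \<partial>\<gamma>)"
        by blast
      have "ext_integral \<gamma>' c \<le> ext_integral \<gamma> c"
      proof (rule compare)
        fix t assume t: "t < N"
        have "(\<lambda>p. ennreal (cs (Suc t) (fst p) (snd p) - k t)) \<in> borel_measurable (borel \<Otimes>\<^sub>M borel)"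
          using meas[OF t] by simp
        from le[rule_format, OF t this]
        show "(\<integral>\<^sup>+z. ennreal (cs (Suc t) (increment (Suc t) (fst z)) (increment (Suc t) (snd z)) - k t) \<partial>\<gamma>') \<le>
          (\<integral>\<^sup>+z. ennreal (cs (Suc t) (increment (Suc t) (fst z)) (increment (Suc t) (snd z)) - k t) \<partial>\<gamma>)" by simp
      qed (use \<gamma> \<gamma>' causal bicausal in auto)
      then show "(INF \<gamma>\<in>bicausal_couplings N \<mu> \<nu>. ext_integral \<gamma> c) \<le> ext_integral \<gamma> c"
        by (rule INF_lower2[OF \<gamma>'])
    qed
  qed
  have KR: "?KR \<in> causal_couplings N \<mu> \<nu>"
    using KR_rearrangement_bicausal(1)[OF \<mu> \<nu>] bicausal by blast
  have part2: "ext_integral ?KR c = (INF \<gamma>\<in>causal_couplings N \<mu> \<nu>. ext_integral \<gamma> c)"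
    if h: "\<forall>t\<in>{1..N}. convex_on UNIV (h t) \<and> (\<forall>a b. cs t a b = h t (a - b))" for h
  proof (rule antisym)
    show "(INF \<gamma>\<in>causal_couplings N \<mu> \<nu>. ext_integral \<gamma> c) \<le> ext_integral ?KR c" by (rule INF_lower[OF KR])
    show "ext_integral ?KR c \<le> (INF \<gamma>\<in>causal_couplings N \<mu> \<nu>. ext_integral \<gamma> c)"
    proof (rule INF_greatest, rule compare)
      fix \<gamma> t assume \<gamma>: "\<gamma> \<in> causal_couplings N \<mu> \<nu>" and t: "t < N"
      have cv: "convex_on UNIV (h (Suc t))" and ch: "\<And>a b. cs (Suc t) a b = h (Suc t) (a - b)" using h t by auto
      have "k t \<le> h (Suc t) z" for z using k[OF t, of z 0] ch[of z 0] by simp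
      from KR_rearrangement_increment_cost_le[OF \<mu> \<nu> ind \<gamma> t cv this]
      show "(\<integral>\<^sup>+z. ennreal (cs (Suc t) (increment (Suc t) (fst z)) (increment (Suc t) (snd z)) - k t) \<partial>?KR) \<le>
        (\<integral>\<^sup>+z. ennreal (cs (Suc t) (increment (Suc t) (fst z)) (increment (Suc t) (snd z)) - k t) \<partial>\<gamma>)"
        by (simp add: ch)
    qed (use KR causal in auto)
  qed
  have part3: "?KR = distr \<mu> (pair_space N) (\<lambda>x. (x, KR_map \<mu> \<nu> x N))"
    if a: "\<forall>i\<in>{1..N}. atomless (marginal \<mu> i)" "\<forall>i\<in>{2..N}. atomless (distr \<mu> borel (increment i))"
  proof (rule KR_rearrangement_eq_map[OF \<mu> \<nu> ind])
    fix t assume t: "t < N"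
    \<comment> \<open>The first increment is the first coordinate.\<close>
    show "atomless (distr \<mu> borel (increment (Suc t)))"
    proof (cases t)
      case 0
      have "increment (Suc 0) = (\<lambda>x. x (Suc 0))" by (simp add: increment_def fun_eq_iff)
      then show ?thesis using a(1) assms(1) by (simp add: 0 marginal_def)
    next
      case (Suc t')
      then show ?thesis using a(2) t by simp
    qed
  qed
  show ?thesis
    by (intro conjI allI impI part1 KR) (use part2 part3 in blast)+
qed

end
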